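(* Assume the Gaussian limit-layer hypotheses stated in the context for the $N\times N$ trained limit layer $W_2^*(N)=S_2^*(N)+R_2^*(N)$ with $R_2^*(N)_{ij}$ iid $N(0,g_*(N)/N)$. Assume a finite-rank deformation regime: $\operatorname{rank}S_2^*(N)\le r$ with $r$ fixed independently of $N$. Let $\sigma_1^*(N)\ge\sigma_2^*(N)\ge\cdots$ be the singular values of $S_2^*(N)$ and assume that for fixed $k$ there are persistent spikes $$\sigma_i^*(N)\to\bar\sigma_i>0,\qquad 1\le i\le k$$ (in probability when random). Then for $1\le i\le k$ $$\mathbb P\big(\sigma_i^*(N)>\sqrt{g_*(N)}\big)\to1,$$ so these spikes are eventually supercritical for the Gaussian bulk with edge $2\sqrt{g_*(N)}$. If moreover, for an index $i\le k$, the spike is separated, i.e. there is a fixed $\delta>0$ with $\mathbb P\big(|\sigma_i^*(N)-\sigma_j^*(N)|\ge\delta\ \forall j\ne i\big)\to1$, then the corresponding left and right spectral projectors (orthogonal projectors onto the span of the $i$-th left, respectively right, singular vector) of $W_2^*(N)$ converge to those of $S_2^*(N)$, i.e. the operator norm of the difference tends to $0$ in probability; and the inverse-BBP estimator $$\widehat\sigma_i^{\mathrm{BBP}}(N):=\frac12\left(s_i(W_2^*(N))+\sqrt{s_i(W_2^*(N))^2-4g_*(N)}\right)$$ is consistent in probability: $\widehat\sigma_i^{\mathrm{BBP}}(N)-\sigma_i^*(N)\to0$ in probability.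
   Context: Setting. For each $N$ there is a classifier network $\phi(\cdot,\alpha)=\rho\circ X(\cdot,\alpha)$ with $K$ classes and weight matrices $W_i$; $\rho(v)_i=e^{v_i}/\sum_{j=1}^K e^{v_j}$, $X(s,\alpha)\in\mathbb R^K$ are the logits. $T$ is a finite nonempty training set, fixed independently of $N$, with correct classes $C(s)\in\{1,\dots,K\}$. For $\lambda_{\mathrm{reg}}>0$ the loss is $$L(\alpha)=-\frac1{|T|}\sum_{s\in T}\log\big(\phi_{C(s)}(s,\alpha)\big)+\lambda_{\mathrm{reg}}\sum_i\|W_i\|_F^2 .$$ Gaussian limit-layer hypotheses. (i) For each $N$ the random training path $\alpha(t,N)$ converges in probability as $t\to\infty$ to $\alpha^*(N)$, whose distinguished $N\times N$ layer matrix is $W_2^*(N)=S_2^*(N)+R_2^*(N)$. At $\alpha^*(N)$, $\phi=\rho\circ\psi_2\circ(R_2^*(N)+S_2^*(N))\circ\psi_1$, where $\psi_1$ (values in $\mathbb R^N$) and $\psi_2:\mathbb R^N\to\mathbb R^K$ may depend on $N$ and on the remaining parameters. (ii) Conditionally on $(S_2^*(N),\psi_1,\psi_2)$ the entries of $R_2^*(N)$ are iid $N(0,g_*(N)/N)$, with $g_*(N)\ge0$ deterministic. (iii) For each $s\in T$ there is a set $\mathcal U_s\supseteq\{(S_2^*(N)+\vartheta R_2^*(N))\psi_1(s):\vartheta\in[0,1]\}$ with $$L_{\psi_2}(s):=\sup_{v,w\in\mathcal U_s,\,v\ne w}\frac{\|\psi_2(v)-\psi_2(w)\|_\infty}{\|v-w\|_\infty}<\infty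 .$$ (iv) There are nonnegative $d_1(N),d_2(N)\to0$ and a nonnegative function $J(v)$ of $v$ only such that for every $v$ measurable with respect to $\sigma(S_2^*(N),\psi_1,\psi_2)$, $\mathbb P(\|R_2^*(N)v\|_\infty>d_1(N)J(v)\mid S_2^*(N),\psi_1,\psi_2)\le d_2(N)$. (v) With $a_\phi(N,s):=J(\psi_1(s))L_{\psi_2}(s)d_1(N)$, for all $s\in T$ one has $a_\phi(N,s)\to0$ as $N\to\infty$ (in probability if random). (vi) $\langle S_2^*(N),R_2^*(N)\rangle_F\to0$ in probability as $N\to\infty$. (vii) Let $\alpha^*_\vartheta(N)$ denote $\alpha^*(N)$ with $W_2^*(N)$ replaced by $S_2^*(N)+\vartheta R_2^*(N)$. There are nonnegative random variables $\epsilon_N\to0$ in probability such that the event $\liminf_{h\downarrow0}h^{-1}\big(L(\alpha^*_{1-h}(N))-L(\alpha^*(N))\big)\ge-\epsilon_N$ has probability tending to one. $s_i(\cdot)$ denotes the $i$-th largest singular value. On events where the square root in the estimator is not real, or a projector is not uniquely determined, arbitrary values may be assigned. $\|\cdot\|_F$, $\langle\cdot,\cdot\rangle_F$ are the Frobenius norm and inner product; $\|\cdot\|_\infty$ of a vector is the maximum norm. *)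

theory Defs
  imports
    "HOL-Probability.Probability"
    "Jordan_Normal_Form.DL_Rank"
    "Jordan_Normal_Form.Char_Poly"
begin

unbundle no vec_syntax
unbundle no inner_syntax

text \<open>
  Some events below need not be measurable (a lower limit over uncountably many \<open>h\<close>, a random
  Lipschitz constant, arbitrary selections on exceptional events), so probabilities tending to
  \<open>0\<close> or \<open>1\<close> are understood through measurable hulls. For measurable events this is
  the usual notion, see \<open>vanishing_prob_iff\<close> and \<open>prob_to_one_iff\<close>. The index of
  the probability space may vary, so random objects for different \<open>N\<close> need not be coupled.
\<close>

definition vanishing_prob :: "'i filter \<Rightarrow> ('i \<Rightarrow> 'w measure) \<Rightarrow> ('i \<Rightarrow> 'w \<Rightarrow> bool) \<Rightarrow> bool" where
  "vanishing_prob F M P \<longleftrightarrow>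
    (\<exists>B. (\<forall>n. B n \<in> sets (M n) \<and> {\<omega> \<in> space (M n). P n \<omega>} \<subseteq> B n) \<and>
         ((\<lambda>n. measure (M n) (B n)) \<longlongrightarrow> 0) F)"

definition prob_to_one :: "'i filter \<Rightarrow> ('i \<Rightarrow> 'w measure) \<Rightarrow> ('i \<Rightarrow> 'w \<Rightarrow> bool) \<Rightarrow> bool" where
  "prob_to_one F M P \<longleftrightarrow> vanishing_prob F M (\<lambda>n \<omega>. \<not> P n \<omega>)"

definition tendsto_in_prob ::
  "'i filter \<Rightarrow> ('i \<Rightarrow> 'w measure) \<Rightarrow> ('i \<Rightarrow> 'w \<Rightarrow> real) \<Rightarrow> real \<Rightarrow> bool" where
  "tendsto_in_prob F M Y c \<longleftrightarrow> (\<forall>e>0. vanishing_prob F M (\<lambda>n \<omega>. e < \<bar>Y n \<omega> - c\<bar>))"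

lemma vanishing_prob_iff:
  assumes "\<And>n. prob_space (M n)" and "\<And>n. {\<omega> \<in> space (M n). P n \<omega>} \<in> sets (M n)"
  shows "vanishing_prob F M P \<longleftrightarrow>
    ((\<lambda>n. measure (M n) {\<omega> \<in> space (M n). P n \<omega>}) \<longlongrightarrow> 0) F"
proof
  assume "vanishing_prob F M P"
  then obtain B where B: "\<And>n. B n \<in> sets (M n)" "\<And>n. {\<omega> \<in> space (M n). P n \<omega>} \<subseteq> B n"
    and lim: "((\<lambda>n. measure (M n) (B n)) \<longlongrightarrow> 0) F"
    unfolding vanishing_prob_def by blast
  have "measure (M n) {\<omega> \<in> space (M n). P n \<omega>} \<le> measure (M n) (B n)" for n
    using assms(1)[of n] B by (intro finite_measure.finite_measure_mono prob_space.finite_measure)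
  then show "((\<lambda>n. measure (M n) {\<omega> \<in> space (M n). P n \<omega>}) \<longlongrightarrow> 0) F"
    by (intro tendsto_sandwich[OF _ _ tendsto_const lim] always_eventually allI) simp_all
next
  assume "((\<lambda>n. measure (M n) {\<omega> \<in> space (M n). P n \<omega>}) \<longlongrightarrow> 0) F"
  then show "vanishing_prob F M P"
    unfolding vanishing_prob_def
    by (intro exI[of _ "\<lambda>n. {\<omega> \<in> space (M n). P n \<omega>}"]) (use assms(2) in simp)
qed

lemma prob_to_one_iff:
  assumes "\<And>n. prob_space (M n)" and meas: "\<And>n. {\<omega> \<in> space (M n). P n \<omega>} \<in> sets (M n)"
  shows "prob_to_one F M P \<longleftrightarrow>
    ((\<lambda>n. measure (M n) {\<omega> \<in> space (M n). P n \<omega>}) \<longlongrightarrow> 1) F"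
proof -
  have compl: "{\<omega> \<in> space (M n). \<not> P n \<omega>} = space (M n) - {\<omega> \<in> space (M n). P n \<omega>}" for n
    by auto
  have prob: "measure (M n) {\<omega> \<in> space (M n). \<not> P n \<omega>}
      = 1 - measure (M n) {\<omega> \<in> space (M n). P n \<omega>}" for n
    unfolding compl by (rule prob_space.prob_compl[OF assms(1) meas])
  have "{\<omega> \<in> space (M n). \<not> P n \<omega>} \<in> sets (M n)" for n
    unfolding compl using meas by blast
  then have "prob_to_one F M P \<longleftrightarrow>
      ((\<lambda>n. 1 - measure (M n) {\<omega> \<in> space (M n). P n \<omega>}) \<longlongrightarrow> 0) F"
    unfolding prob_to_one_def by (simp add: vanishing_prob_iff[OF assms(1)] prob)
  also have "\<dots> \<longleftrightarrow> ((\<lambda>n. measure (M n) {\<omega> \<in> space (M n). P n \<omega>}) \<longlongrightarrow> 1) F"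
    using tendsto_diff[OF tendsto_const[of 1], of "\<lambda>n. measure (M n) {\<omega> \<in> space (M n). P n \<omega>}" 1 F]
      tendsto_diff[OF tendsto_const[of 1],
        of "\<lambda>n. 1 - measure (M n) {\<omega> \<in> space (M n). P n \<omega>}" 0 F]
    by auto
  finally show ?thesis .
qed

definition max_norm :: "real vec \<Rightarrow> real" where
  "max_norm v = Max (insert 0 {\<bar>v $ i\<bar> | i. i < dim_vec v})"

definition euclid_norm :: "real vec \<Rightarrow> real" where
  "euclid_norm v = sqrt (v \<bullet> v)"

definition frob_inner :: "real mat \<Rightarrow> real mat \<Rightarrow> real" where
  "frob_inner A B = (\<Sum>i<dim_row A. \<Sum>j<dim_col A. A $$ (i, j) * B $$ (i, j))"

definition frob_norm :: "real mat \<Rightarrow> real" where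
  "frob_norm A = sqrt (frob_inner A A)"

definition op_norm :: "real mat \<Rightarrow> real" where
  "op_norm A = (SUP x \<in> carrier_vec (dim_col A). euclid_norm (A *\<^sub>v x) / euclid_norm x)"

text \<open>
  The singular values are the square roots of the eigenvalues of \<open>A\<^sup>T A\<close>, with
  multiplicity and in decreasing order. All complex roots of this characteristic polynomial
  are real and nonnegative, so the list has \<open>dim_col A\<close> entries. Singular values and
  singular vectors are numbered from \<open>1\<close>; \<open>sing_val A i\<close> is meaningful for
  \<open>1 \<le> i \<le> dim_col A\<close> only.
\<close>

definition sing_vals :: "real mat \<Rightarrow> real list" where
  "sing_vals A =
    rev (sorted_list_of_multiset (image_mset sqrt (proots (char_poly (transpose_mat A * A)))))"

definition sing_val :: "real mat \<Rightarrow> nat \<Rightarrow> real" where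
  "sing_val A i = sing_vals A ! (i - 1)"

definition sing_vec_pair :: "real mat \<Rightarrow> nat \<Rightarrow> real vec \<Rightarrow> real vec \<Rightarrow> bool" where
  "sing_vec_pair A i u v \<longleftrightarrow>
    u \<in> carrier_vec (dim_row A) \<and> v \<in> carrier_vec (dim_col A) \<and>
    euclid_norm u = 1 \<and> euclid_norm v = 1 \<and>
    A *\<^sub>v v = sing_val A i \<cdot>\<^sub>v u \<and> transpose_mat A *\<^sub>v u = sing_val A i \<cdot>\<^sub>v v"

text \<open>For a unit vector \<open>v\<close>, the matrix \<open>v v\<^sup>T\<close> is the orthogonal projector onto its span.\<close>

definition line_proj :: "real vec \<Rightarrow> real mat" where
  "line_proj v = mat (dim_vec v) (dim_vec v) (\<lambda>(i, j). v $ i * v $ j)"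

definition left_sing_proj :: "nat \<Rightarrow> real mat \<Rightarrow> real mat \<Rightarrow> bool" where
  "left_sing_proj i A P \<longleftrightarrow> (\<exists>u v. sing_vec_pair A i u v \<and> P = line_proj u)"

definition right_sing_proj :: "nat \<Rightarrow> real mat \<Rightarrow> real mat \<Rightarrow> bool" where
  "right_sing_proj i A P \<longleftrightarrow> (\<exists>u v. sing_vec_pair A i u v \<and> P = line_proj v)"

text \<open>
  \<open>is_version Q M A P\<close>: the random matrices \<open>P N\<close> are the projectors of the random matrices
  \<open>A N\<close> described by \<open>Q\<close> (one of the two relations above) wherever these are uniquely
  determined, and are arbitrary elsewhere.
\<close>

definition is_version :: "(real mat \<Rightarrow> real mat \<Rightarrow> bool) \<Rightarrow> (nat \<Rightarrow> 'w measure) \<Rightarrow>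
    (nat \<Rightarrow> 'w \<Rightarrow> real mat) \<Rightarrow> (nat \<Rightarrow> 'w \<Rightarrow> real mat) \<Rightarrow> bool" where
  "is_version Q M A P \<longleftrightarrow>
    (\<forall>N. \<forall>\<omega> \<in> space (M N). (\<exists>!Z. Q (A N \<omega>) Z) \<longrightarrow> Q (A N \<omega>) (P N \<omega>))"

record params =
  weights :: "real mat list"
  others :: "real vec"  \<comment> \<open>all parameters that are not entries of weight matrices\<close>

definition param_space :: "(nat \<times> nat) list \<Rightarrow> nat \<Rightarrow> params set" where
  "param_space sh q = {a. length (weights a) = length sh \<and>
    (\<forall>l<length sh. weights a ! l \<in> carrier_mat (fst (sh ! l)) (snd (sh ! l))) \<and>
    others a \<in> carrier_vec q}"

definition param_dist :: "params \<Rightarrow> params \<Rightarrow> real" where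
  "param_dist a b = sqrt ((\<Sum>l<length (weights a). (frob_norm (weights a ! l - weights b ! l))\<^sup>2)
    + (euclid_norm (others a - others b))\<^sup>2)"

definition random_params :: "'w measure \<Rightarrow> (nat \<times> nat) list \<Rightarrow> nat \<Rightarrow> ('w \<Rightarrow> params) \<Rightarrow> bool" where
  "random_params M sh q a \<longleftrightarrow>
    (\<forall>\<omega> \<in> space M. a \<omega> \<in> param_space sh q) \<and>
    (\<forall>l<length sh. \<forall>i<fst (sh ! l). \<forall>j<snd (sh ! l).
      (\<lambda>\<omega>. weights (a \<omega>) ! l $$ (i, j)) \<in> borel_measurable M) \<and>
    (\<forall>i<q. (\<lambda>\<omega>. others (a \<omega>) $ i) \<in> borel_measurable M)"

text \<open>The list of weight matrices is \<open>[W\<^sub>1, W\<^sub>2, \<dots>]\<close>, so \<open>W\<^sub>2\<close> has list index \<open>1\<close>.\<close>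

definition W2 :: "params \<Rightarrow> real mat" where
  "W2 a = weights a ! 1"

definition set_W2 :: "params \<Rightarrow> real mat \<Rightarrow> params" where
  "set_W2 a A = a\<lparr>weights := (weights a)[1 := A]\<rparr>"

definition softmax :: "real vec \<Rightarrow> real vec" where
  "softmax v = vec (dim_vec v) (\<lambda>i. exp (v $ i) / (\<Sum>j<dim_vec v. exp (v $ j)))"

text \<open>Classes are numbered from \<open>1\<close>, vector entries from \<open>0\<close>. \<open>X\<close> is the logit map.\<close>

definition loss :: "('s \<Rightarrow> params \<Rightarrow> real vec) \<Rightarrow> 's set \<Rightarrow> ('s \<Rightarrow> nat) \<Rightarrow> real \<Rightarrow> params \<Rightarrow> real" where
  "loss X T C lam a =
    - (1 / real (card T)) * (\<Sum>s\<in>T. ln (softmax (X s a) $ (C s - 1)))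
    + lam * (\<Sum>l<length (weights a). (frob_norm (weights a ! l))\<^sup>2)"

definition normal_law :: "real \<Rightarrow> real \<Rightarrow> real measure" where
  "normal_law mu var = (if var = 0 then return borel mu
    else density lborel (\<lambda>x. ennreal (normal_density mu (sqrt var) x)))"

text \<open>The \<open>\<sigma>\<close>-algebra generated by \<open>S\<close>, \<open>\<psi>\<^sub>1\<close> and \<open>\<psi>\<^sub>2\<close>, the last two as random functions, i.e.\ by
  all their values.\<close>

definition limit_algebra :: "'w measure \<Rightarrow> nat \<Rightarrow> nat \<Rightarrow> ('w \<Rightarrow> real mat) \<Rightarrow>
    ('w \<Rightarrow> 's \<Rightarrow> real vec) \<Rightarrow> ('w \<Rightarrow> real vec \<Rightarrow> real vec) \<Rightarrow> 'w measure" where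
  "limit_algebra M N K S \<psi>\<^sub>1 \<psi>\<^sub>2 = sigma (space M)
    ({{\<omega> \<in> space M. S \<omega> $$ (i, j) \<le> c} | i j c. i < N \<and> j < N} \<union>
     {{\<omega> \<in> space M. \<psi>\<^sub>1 \<omega> s $ i \<le> c} | s i c. i < N} \<union>
     {{\<omega> \<in> space M. \<psi>\<^sub>2 \<omega> v $ i \<le> c} | v i c. v \<in> carrier_vec N \<and> i < K})"

definition cond_prob_given :: "'w measure \<Rightarrow> 'w measure \<Rightarrow> 'w set \<Rightarrow> 'w \<Rightarrow> real" where
  "cond_prob_given M F A = real_cond_exp M F (indicator A)"

definition interp :: "real mat \<Rightarrow> real mat \<Rightarrow> real \<Rightarrow> real mat" where
  "interp S R \<theta> = S + \<theta> \<cdot>\<^sub>m R"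

text \<open>Taken in \<open>ennreal\<close>, so that the supremum over an empty set of quotients is \<open>0\<close>.\<close>

definition max_norm_lipschitz :: "(real vec \<Rightarrow> real vec) \<Rightarrow> real vec set \<Rightarrow> ennreal" where
  "max_norm_lipschitz \<psi> U =
    (SUP (v, w) \<in> {(v, w). v \<in> U \<and> w \<in> U \<and> v \<noteq> w}.
      ennreal (max_norm (\<psi> v - \<psi> w) / max_norm (v - w)))"

text \<open>
  Data of the locale: probability spaces \<open>M N\<close>; number of classes \<open>K\<close>, training set \<open>T\<close> (inputs of
  type \<open>'s\<close>), classes \<open>C\<close>, regularisation \<open>lam\<close>; logit maps \<open>X N\<close>; shapes \<open>sh N\<close> of the weight
  matrices and number \<open>q N\<close> of further parameters; training path \<open>\<alpha>\<close> and its limit \<open>\<alpha>s\<close>;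
  \<open>S + R\<close> is the limit layer, \<open>\<psi>\<^sub>1\<close>, \<open>\<psi>\<^sub>2\<close> the maps before and after it and \<open>g N / N\<close> the entry variance of
  \<open>R\<close>; \<open>U N \<omega> s\<close> are the sets on which \<open>\<psi>\<^sub>2\<close> is Lipschitz.

  The maps \<open>\<psi>\<^sub>1\<close>, \<open>\<psi>\<^sub>2\<close> are random but do not depend on the content of the second layer; hence
  \<open>factorization\<close> is stated also after \<open>W\<^sub>2\<close> has been replaced by \<open>S + \<theta> R\<close>; \<open>\<theta> = 1\<close> is the network
  at \<open>\<alpha>s\<close> itself. The dependence of \<open>J\<close> on \<open>v\<close> includes the dimension of \<open>v\<close>.
\<close>

locale gaussian_limit_layer =
  fixes M :: "nat \<Rightarrow> 'w measure"
    and K :: nat and T :: "'s set" and C :: "'s \<Rightarrow> nat" and lam :: real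
    and X :: "nat \<Rightarrow> 's \<Rightarrow> params \<Rightarrow> real vec"
    and sh :: "nat \<Rightarrow> (nat \<times> nat) list" and q :: "nat \<Rightarrow> nat"
    and \<alpha> :: "nat \<Rightarrow> real \<Rightarrow> 'w \<Rightarrow> params" and \<alpha>s :: "nat \<Rightarrow> 'w \<Rightarrow> params"
    and S :: "nat \<Rightarrow> 'w \<Rightarrow> real mat" and R :: "nat \<Rightarrow> 'w \<Rightarrow> real mat"
    and \<psi>\<^sub>1 :: "nat \<Rightarrow> 'w \<Rightarrow> 's \<Rightarrow> real vec"
    and \<psi>\<^sub>2 :: "nat \<Rightarrow> 'w \<Rightarrow> real vec \<Rightarrow> real vec"
    and g :: "nat \<Rightarrow> real"
    and U :: "nat \<Rightarrow> 'w \<Rightarrow> 's \<Rightarrow> real vec set"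
    and d\<^sub>1 d\<^sub>2 :: "nat \<Rightarrow> real" and J :: "real vec \<Rightarrow> real"
    and \<epsilon> :: "nat \<Rightarrow> 'w \<Rightarrow> real"
  assumes prob: "\<And>N. prob_space (M N)"
    and training_set: "finite T" "T \<noteq> {}" "\<And>s. s \<in> T \<Longrightarrow> C s \<in> {1..K}"
    and lam_pos: "0 < lam"
    and shapes: "\<And>N. 1 \<le> N \<Longrightarrow> 2 \<le> length (sh N) \<and> sh N ! 1 = (N, N)"
    and logits: "\<And>N s a. 1 \<le> N \<Longrightarrow> a \<in> param_space (sh N) (q N) \<Longrightarrow> X N s a \<in> carrier_vec K"
    and path: "\<And>N t. 1 \<le> N \<Longrightarrow> 0 \<le> t \<Longrightarrow> random_params (M N) (sh N) (q N) (\<alpha> N t)"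
    and limit: "\<And>N. 1 \<le> N \<Longrightarrow> random_params (M N) (sh N) (q N) (\<alpha>s N)"
    and path_tendsto: "\<And>N. 1 \<le> N \<Longrightarrow>
      tendsto_in_prob at_top (\<lambda>_. M N) (\<lambda>t \<omega>. param_dist (\<alpha> N t \<omega>) (\<alpha>s N \<omega>)) 0"
    and S_carrier: "\<And>N \<omega>. 1 \<le> N \<Longrightarrow> \<omega> \<in> space (M N) \<Longrightarrow> S N \<omega> \<in> carrier_mat N N"
    and R_carrier: "\<And>N \<omega>. 1 \<le> N \<Longrightarrow> \<omega> \<in> space (M N) \<Longrightarrow> R N \<omega> \<in> carrier_mat N N"
    and decomposition: "\<And>N \<omega>. 1 \<le> N \<Longrightarrow> \<omega> \<in> space (M N) \<Longrightarrow> W2 (\<alpha>s N \<omega>) = S N \<omega> + R N \<omega>"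
    and psi1_carrier: "\<And>N \<omega> s. 1 \<le> N \<Longrightarrow> \<omega> \<in> space (M N) \<Longrightarrow> \<psi>\<^sub>1 N \<omega> s \<in> carrier_vec N"
    and psi2_carrier: "\<And>N \<omega> v. 1 \<le> N \<Longrightarrow> \<omega> \<in> space (M N) \<Longrightarrow> v \<in> carrier_vec N \<Longrightarrow>
      \<psi>\<^sub>2 N \<omega> v \<in> carrier_vec K"
    and factorization: "\<And>N \<omega> \<theta> s. 1 \<le> N \<Longrightarrow> \<omega> \<in> space (M N) \<Longrightarrow> \<theta> \<in> {0..1} \<Longrightarrow>
      softmax (X N s (set_W2 (\<alpha>s N \<omega>) (interp (S N \<omega>) (R N \<omega>) \<theta>))) =
      softmax (\<psi>\<^sub>2 N \<omega> (interp (S N \<omega>) (R N \<omega>) \<theta> *\<^sub>v \<psi>\<^sub>1 N \<omega> s))"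
    and sub_algebra: "\<And>N. 1 \<le> N \<Longrightarrow>
      subalgebra (M N) (limit_algebra (M N) N K (S N) (\<psi>\<^sub>1 N) (\<psi>\<^sub>2 N))"
    and g_nonneg: "\<And>N. 0 \<le> g N"
    and R_measurable: "\<And>N i j. 1 \<le> N \<Longrightarrow> i < N \<Longrightarrow> j < N \<Longrightarrow>
      (\<lambda>\<omega>. R N \<omega> $$ (i, j)) \<in> borel_measurable (M N)"
    and R_cond_iid: "\<And>N B. 1 \<le> N \<Longrightarrow> (\<forall>i<N. \<forall>j<N. B i j \<in> sets (borel :: real measure)) \<Longrightarrow>
      AE \<omega> in M N. cond_prob_given (M N) (limit_algebra (M N) N K (S N) (\<psi>\<^sub>1 N) (\<psi>\<^sub>2 N))
          {\<omega> \<in> space (M N). \<forall>i<N. \<forall>j<N. R N \<omega> $$ (i, j) \<in> B i j} \<omega> =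
        (\<Prod>i<N. \<Prod>j<N. measure (normal_law 0 (g N / real N)) (B i j))"
    and U_carrier: "\<And>N \<omega> s. 1 \<le> N \<Longrightarrow> \<omega> \<in> space (M N) \<Longrightarrow> s \<in> T \<Longrightarrow> U N \<omega> s \<subseteq> carrier_vec N"
    and U_segment: "\<And>N \<omega> s \<theta>. 1 \<le> N \<Longrightarrow> \<omega> \<in> space (M N) \<Longrightarrow> s \<in> T \<Longrightarrow> \<theta> \<in> {0..1} \<Longrightarrow>
      interp (S N \<omega>) (R N \<omega>) \<theta> *\<^sub>v \<psi>\<^sub>1 N \<omega> s \<in> U N \<omega> s"
    and U_lipschitz: "\<And>N \<omega> s. 1 \<le> N \<Longrightarrow> \<omega> \<in> space (M N) \<Longrightarrow> s \<in> T \<Longrightarrow>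
      max_norm_lipschitz (\<psi>\<^sub>2 N \<omega>) (U N \<omega> s) < \<infinity>"
    and d_nonneg: "\<And>N. 0 \<le> d\<^sub>1 N" "\<And>N. 0 \<le> d\<^sub>2 N"
    and d_tendsto: "d\<^sub>1 \<longlonglongrightarrow> 0" "d\<^sub>2 \<longlonglongrightarrow> 0"
    and J_nonneg: "\<And>v. 0 \<le> J v"
    and R_small: "\<And>N v. 1 \<le> N \<Longrightarrow> (\<forall>\<omega> \<in> space (M N). v \<omega> \<in> carrier_vec N) \<Longrightarrow>
      (\<forall>i<N. (\<lambda>\<omega>. v \<omega> $ i) \<in>
        borel_measurable (limit_algebra (M N) N K (S N) (\<psi>\<^sub>1 N) (\<psi>\<^sub>2 N))) \<Longrightarrow>
      {\<omega> \<in> space (M N). d\<^sub>1 N * J (v \<omega>) < max_norm (R N \<omega> *\<^sub>v v \<omega>)} \<in> sets (M N) \<and>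
      (AE \<omega> in M N. cond_prob_given (M N) (limit_algebra (M N) N K (S N) (\<psi>\<^sub>1 N) (\<psi>\<^sub>2 N))
          {\<omega> \<in> space (M N). d\<^sub>1 N * J (v \<omega>) < max_norm (R N \<omega> *\<^sub>v v \<omega>)} \<omega> \<le> d\<^sub>2 N)"
    and a_tendsto: "\<And>s. s \<in> T \<Longrightarrow> tendsto_in_prob sequentially M
      (\<lambda>N \<omega>. J (\<psi>\<^sub>1 N \<omega> s) * enn2real (max_norm_lipschitz (\<psi>\<^sub>2 N \<omega>) (U N \<omega> s)) * d\<^sub>1 N) 0"
    and SR_tendsto: "tendsto_in_prob sequentially M (\<lambda>N \<omega>. frob_inner (S N \<omega>) (R N \<omega>)) 0"
    and eps_random: "\<And>N. 1 \<le> N \<Longrightarrow> \<epsilon> N \<in> borel_measurable (M N)"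
    and eps_nonneg: "\<And>N \<omega>. 1 \<le> N \<Longrightarrow> \<omega> \<in> space (M N) \<Longrightarrow> 0 \<le> \<epsilon> N \<omega>"
    and eps_tendsto: "tendsto_in_prob sequentially M \<epsilon> 0"
    and almost_minimal: "prob_to_one sequentially M (\<lambda>N \<omega>.
      - ereal (\<epsilon> N \<omega>) \<le> Liminf (at_right 0) (\<lambda>h. ereal
        ((loss (X N) T C lam (set_W2 (\<alpha>s N \<omega>) (interp (S N \<omega>) (R N \<omega>) (1 - h)))
          - loss (X N) T C lam (\<alpha>s N \<omega>)) / h)))"

end

theory Submission
  imports Defs
begin

text \<open>
  No random matrix theory is needed: the hypotheses force the Gaussian part to disappear. Moving
  the limit layer from \<open>S + R\<close> to \<open>S + (1 - h) R\<close> raises the data term by at most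
  \<open>2 h max\<^sub>s a\<^sub>\<phi>(N,s)\<close> off an event of small probability, but lowers the regulariser by about
  \<open>2 h lam (\<langle>S,R\<rangle> + \<parallel>R\<parallel>\<^sup>2)\<close>; almost minimality therefore gives \<open>\<parallel>R\<parallel> \<rightarrow> 0\<close> in probability in
  the Frobenius norm. As \<open>\<parallel>R\<parallel>\<^sup>2\<close> concentrates around \<open>N g N\<close>, this is only possible if
  \<open>g \<rightarrow> 0\<close>. Hence \<open>W\<^sub>2\<close> is a vanishing perturbation of \<open>S\<close>, the singular values are
  controlled by Weyl's inequality, the singular vectors at a separated spike by a gap argument of
  Davis--Kahan type, and the inverse BBP map differs from the identity by at most \<open>\<surd>g\<close>.
\<close>

section \<open>Spectral theorem for real symmetric matrices\<close>

text \<open>Events are controlled only through measurable hulls, so the reasoning is pathwise: on an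
  event whose complement has a vanishing hull, each conclusion is a deterministic matrix inequality,
  with constants that depend neither on the dimension nor on the sample point. In the passage to
  \<open>g\<close> the event bounding the norm of \<open>R\<close> has to be measurable, because its
  true probability is confronted with a small-ball bound. In the regulariser, half of the gain
  proportional to the squared norm of \<open>R\<close> pays for the remainder quadratic in
  \<open>h\<close>. This makes the estimate of the difference quotient uniform in \<open>h\<close>.
  Singular vectors are determined only up to a sign, and the signs of a left and a right vector are
  tied together. Hence right vectors are compared up to a sign \<open>c\<close>, and left ones
  inherit the same \<open>c\<close> because they are normalised images of the right ones; line
  projectors do not see \<open>c\<close>. The perturbed matrix needs a gap of its own before its
  projector is even well defined; Weyl's inequality transfers it from the gap of
  \<open>S\<close>.\<close>

lemma euclid_norm_eq_L2_set: "euclid_norm v = L2_set (\<lambda>i. v $ i) {..<dim_vec v}"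
  unfolding euclid_norm_def L2_set_def scalar_prod_def by (simp add: power2_eq_square lessThan_atLeast0)

lemma euclid_norm_nonneg [simp]: "0 \<le> euclid_norm v"
  unfolding euclid_norm_eq_L2_set by (rule L2_set_nonneg)

lemma scalar_prod_self_nonneg [simp]: "0 \<le> (v::real vec) \<bullet> v"
  unfolding scalar_prod_def by (rule sum_nonneg) simp

lemma euclid_norm_power2: "(euclid_norm v)\<^sup>2 = v \<bullet> v"
  unfolding euclid_norm_def by simp

lemma euclid_norm_eq_1_iff: "euclid_norm v = 1 \<longleftrightarrow> v \<bullet> v = 1"
  unfolding euclid_norm_def by simp

lemma scalar_prod_self_eq_0_iff:
  assumes "(v::real vec) \<in> carrier_vec n"
  shows "v \<bullet> v = 0 \<longleftrightarrow> v = 0\<^sub>v n"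
proof
  assume "v \<bullet> v = 0"
  then have "\<forall>i\<in>{0..<dim_vec v}. v $ i * v $ i = 0"
    unfolding scalar_prod_def by (subst (asm) sum_nonneg_eq_0_iff) auto
  then show "v = 0\<^sub>v n" using assms by (intro eq_vecI) auto
qed (use assms in simp)

lemma abs_scalar_prod_le:
  assumes "dim_vec x = dim_vec y"
  shows "\<bar>x \<bullet> y\<bar> \<le> euclid_norm x * euclid_norm y"
proof -
  have "\<bar>x \<bullet> y\<bar> \<le> (\<Sum>i<dim_vec y. \<bar>x $ i\<bar> * \<bar>y $ i\<bar>)"
    unfolding scalar_prod_def lessThan_atLeast0 abs_mult[symmetric] by (rule sum_abs)
  also have "\<dots> \<le> euclid_norm x * euclid_norm y"
    unfolding euclid_norm_eq_L2_set assms by (rule L2_set_mult_ineq)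
  finally show ?thesis .
qed

lemma euclid_norm_smult: "euclid_norm (c \<cdot>\<^sub>v x) = \<bar>c\<bar> * euclid_norm x"
proof -
  have "(c \<cdot>\<^sub>v x) \<bullet> (c \<cdot>\<^sub>v x) = c\<^sup>2 * (x \<bullet> x)"
    unfolding scalar_prod_def by (simp add: sum_distrib_left power2_eq_square algebra_simps)
  then show ?thesis unfolding euclid_norm_def by (simp add: real_sqrt_mult)
qed

lemma euclid_norm_add_le:
  assumes "dim_vec x = dim_vec y"
  shows "euclid_norm (x + y) \<le> euclid_norm x + euclid_norm y"
proof -
  have "euclid_norm (x + y) = L2_set (\<lambda>i. x $ i + y $ i) {..<dim_vec y}"
    unfolding euclid_norm_eq_L2_set by (intro L2_set_cong) (auto simp: assms)
  also have "\<dots> \<le> euclid_norm x + euclid_norm y"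
    unfolding euclid_norm_eq_L2_set assms by (rule L2_set_triangle_ineq)
  finally show ?thesis .
qed

lemma euclid_norm_minus_commute:
  assumes "dim_vec x = dim_vec y"
  shows "euclid_norm (x - y) = euclid_norm (y - x)"
proof -
  have "x - y = (-1) \<cdot>\<^sub>v (y - x)" using assms by (intro eq_vecI) auto
  then show ?thesis using euclid_norm_smult[of "-1" "y - x"] by simp
qed

lemma euclid_norm_minus_self [simp]: "euclid_norm (v - v) = 0"
proof -
  have "v - v = 0\<^sub>v (dim_vec v)" by (intro eq_vecI) auto
  then show ?thesis unfolding euclid_norm_def by (metis real_sqrt_zero scalar_prod_left_zero zero_carrier_vec)
qed

lemma euclid_norm_diff_le:
  assumes "dim_vec x = dim_vec y"
  shows "euclid_norm x - euclid_norm y \<le> euclid_norm (x - y)"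
proof -
  have "x = (x - y) + y" using assms by (intro eq_vecI) auto
  then show ?thesis using euclid_norm_add_le[of "x - y" y] assms by simp
qed

lemma frob_inner_self_nonneg [simp]: "0 \<le> frob_inner A A"
  unfolding frob_inner_def by (intro sum_nonneg) simp

lemma frob_norm_power2: "(frob_norm A)\<^sup>2 = frob_inner A A"
  unfolding frob_norm_def by simp

lemma frob_norm_nonneg [simp]: "0 \<le> frob_norm A"
  unfolding frob_norm_def by simp

text \<open>Cauchy-Schwarz in every row. Through this bound, smallness of \<open>R\<close> in the
  Frobenius norm becomes closeness of \<open>S\<close> and \<open>W2\<close> as operators.\<close>

lemma euclid_norm_mult_mat_vec_le:
  assumes "A \<in> carrier_mat n m" "x \<in> carrier_vec m"
  shows "euclid_norm (A *\<^sub>v x) \<le> frob_norm A * euclid_norm x"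
proof (rule power2_le_imp_le)
  have row: "(row A i \<bullet> x)\<^sup>2 \<le> (row A i \<bullet> row A i) * (x \<bullet> x)" if "i < n" for i
  proof -
    have "\<bar>row A i \<bullet> x\<bar>\<^sup>2 \<le> (euclid_norm (row A i) * euclid_norm x)\<^sup>2"
      by (intro power_mono abs_scalar_prod_le) (use assms that in auto)
    then show ?thesis by (simp add: power_mult_distrib euclid_norm_power2)
  qed
  have "(A *\<^sub>v x) \<bullet> (A *\<^sub>v x) = (\<Sum>i<n. (row A i \<bullet> x)\<^sup>2)"
    using assms unfolding scalar_prod_def[of "A *\<^sub>v x"]
    by (simp add: power2_eq_square lessThan_atLeast0)
  also have "\<dots> \<le> (\<Sum>i<n. (row A i \<bullet> row A i) * (x \<bullet> x))"
    by (intro sum_mono row) simp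
  also have "\<dots> = frob_inner A A * (x \<bullet> x)"
    using assms unfolding frob_inner_def sum_distrib_right[symmetric]
    by (simp add: scalar_prod_def lessThan_atLeast0 row_def)
  finally show "(euclid_norm (A *\<^sub>v x))\<^sup>2 \<le> (frob_norm A * euclid_norm x)\<^sup>2"
    by (simp add: power_mult_distrib euclid_norm_power2 frob_norm_power2)
qed simp

text \<open>The reflection \<open>1 - 2 w w^T / (w . w)\<close> with \<open>w = v - e_0\<close>
  exchanges \<open>v\<close> and the first unit vector. Being symmetric and involutory, it is an
  orthogonal change of basis that equals its own inverse and whose first vector is prescribed. For
  \<open>w = 0\<close> the formula breaks down, hence the separate case.\<close>

lemma householder_reflection:
  fixes v :: "real vec"
  assumes v: "v \<in> carrier_vec (Suc m)" and unit: "v \<bullet> v = 1"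
  obtains H where "H \<in> carrier_mat (Suc m) (Suc m)" "transpose_mat H = H" "H * H = 1\<^sub>m (Suc m)"
    "col H 0 = v"
proof (cases "v = unit_vec (Suc m) 0")
  case True
  then show ?thesis by (intro that[of "1\<^sub>m (Suc m)"]) auto
next
  case False
  define n where "n = Suc m"
  define w where "w = v - unit_vec n 0"
  have wc: "w \<in> carrier_vec n" using v by (simp add: w_def n_def)
  have "w \<noteq> 0\<^sub>v n"
  proof
    assume *: "w = 0\<^sub>v n"
    have "v = unit_vec n 0"
    proof (intro eq_vecI)
      fix i assume "i < dim_vec (unit_vec n 0 :: real vec)"
      then show "v $ i = unit_vec n 0 $ i"
        using arg_cong[OF *, of "\<lambda>u. u $ i"] v by (simp add: w_def n_def)
    qed (use v in \<open>simp add: n_def\<close>)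
    with False show False by (simp add: n_def)
  qed
  then have w0: "w \<bullet> w \<noteq> 0" using scalar_prod_self_eq_0_iff[OF wc] by simp
  define c where "c = 2 / (w \<bullet> w)"
  have ww: "w \<bullet> w = (\<Sum>k<n. w $ k * w $ k)"
    using wc by (simp add: scalar_prod_def lessThan_atLeast0)
  have cc: "c * c * (w \<bullet> w) = 2 * c" using w0 by (simp add: c_def field_simps)
  \<comment> \<open>Both \<open>v\<close> and the unit vector have length 1, so only their inner
    product \<open>v $ 0\<close> enters. It follows that \<open>c * w $ 0 = - 1\<close>, which makes
    column 0 of \<open>H\<close> equal to the unit vector plus \<open>w\<close>, that is, to
    \<open>v\<close>.\<close>
  have "w \<bullet> w = - 2 * w $ 0"
  proof -
    have "w \<bullet> w = (\<Sum>k<n. (v $ k * v $ k) - 2 * (if k = 0 then v $ 0 else 0) + (if k = 0 then 1 else 0))"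
      unfolding ww by (intro sum.cong) (use v in \<open>auto simp: w_def n_def algebra_simps\<close>)
    also have "\<dots> = v \<bullet> v - 2 * v $ 0 + 1"
      using v by (simp add: sum.distrib sum_subtractf n_def scalar_prod_def lessThan_atLeast0
        flip: sum_distrib_left)
    also have "\<dots> = - 2 * w $ 0" using v unit by (simp add: w_def n_def)
    finally show ?thesis .
  qed
  then have cw: "c * w $ 0 = - 1" using w0 by (simp add: c_def field_simps)
  define H where "H = mat n n (\<lambda>(i, j). (if i = j then 1 else 0) - c * (w $ i * w $ j))"
  show ?thesis
  proof (rule that[of H])
    show "H \<in> carrier_mat (Suc m) (Suc m)" by (simp add: H_def n_def)
    show "transpose_mat H = H" by (intro eq_matI) (auto simp: H_def)
    show "H * H = 1\<^sub>m (Suc m)"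
    proof (intro eq_matI)
      fix i j assume "i < dim_row (1\<^sub>m (Suc m))" "j < dim_col (1\<^sub>m (Suc m))"
      then have ij: "i < n" "j < n" by (auto simp: n_def)
      have "(H * H) $$ (i, j) = (\<Sum>k<n. ((if i = k then 1 else 0) - c * (w $ i * w $ k)) *
          ((if k = j then 1 else 0) - c * (w $ k * w $ j)))"
        using ij by (simp add: H_def scalar_prod_def lessThan_atLeast0)
      also have "\<dots> = (\<Sum>k<n. (if k = i then (if i = j then 1 else 0) - c * (w $ i * w $ j) else 0)
          - (if k = j then c * (w $ i * w $ j) else 0) + c * c * w $ i * w $ j * (w $ k * w $ k))"
        by (intro sum.cong) (auto simp: algebra_simps)
      also have "\<dots> = (if i = j then 1 else 0) - 2 * (c * (w $ i * w $ j))
          + c * c * w $ i * w $ j * (w \<bullet> w)"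
        using ij by (simp add: sum.distrib sum_subtractf ww flip: sum_distrib_left)
      also have "\<dots> = (if i = j then 1 else 0)"
        using arg_cong[OF cc, of "\<lambda>t. t * (w $ i * w $ j)"] by (simp add: algebra_simps)
      finally show "(H * H) $$ (i, j) = 1\<^sub>m (Suc m) $$ (i, j)" using ij by (simp add: n_def)
    qed (auto simp: H_def n_def)
    show "col H 0 = v"
    proof (intro eq_vecI)
      fix i assume "i < dim_vec v"
      then have i: "i < n" using v by (simp add: n_def)
      have "col H 0 $ i = (if i = 0 then 1 else 0) - (c * w $ 0) * w $ i"
        using i by (simp add: H_def n_def)
      also have "\<dots> = v $ i" unfolding cw using i v by (simp add: w_def n_def)
      finally show "col H 0 $ i = v $ i" .
    qed (use v in \<open>simp add: H_def n_def\<close>)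
  qed
qed

lemma mult_block_diag_mat:
  assumes "A \<in> carrier_mat n n" "B \<in> carrier_mat n n" "C \<in> carrier_mat m m" "D \<in> carrier_mat m m"
  shows "four_block_mat A (0\<^sub>m n m) (0\<^sub>m m n) C * four_block_mat B (0\<^sub>m n m) (0\<^sub>m m n) D =
    four_block_mat (A * B) (0\<^sub>m n m) (0\<^sub>m m n) (C * D)"
  by (subst mult_four_block_mat[of _ n n _ m _ m _ _ n _ m]) (use assms in auto)

text \<open>Deflation: a reflection whose first column is a unit eigenvector for the head of the
  list splits off a one-by-one block, and cancelling one linear factor identifies the characteristic
  polynomial of the remaining block. The list \<open>es\<close> is prescribed instead of produced,
  so that the columns of \<open>P\<close> can follow any chosen order of the eigenvalues.\<close>

theorem real_symmetric_diagonalization: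
  fixes A :: "real mat"
  assumes "A \<in> carrier_mat n n" "transpose_mat A = A" "char_poly A = (\<Prod>e\<leftarrow>es. [:- e, 1:])"
  shows "\<exists>P \<in> carrier_mat n n. transpose_mat P * P = 1\<^sub>m n \<and> A * P = P * mat_diag n (\<lambda>i. es ! i)"
  using assms
proof (induction es arbitrary: n A)
  case Nil
  have "n = 0" using degree_monic_char_poly[OF Nil.prems(1)] Nil.prems(3) by simp
  then show ?case using Nil.prems by (intro bexI[of _ "1\<^sub>m 0"] conjI eq_matI) (auto simp: mat_diag_def)
next
  case (Cons e es)
  define m where "m = length es"
  have "n = degree (\<Prod>e\<leftarrow>e # es. [:- e, 1:])"
    using degree_monic_char_poly[OF Cons.prems(1)] Cons.prems(3) by simp
  also have "\<dots> = Suc m" using degree_linear_factors[of uminus "e # es"] by (simp add: m_def)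
  finally have n: "n = Suc m" .
  have A: "A \<in> carrier_mat (Suc m) (Suc m)" using Cons.prems(1) n by simp
  have "eigenvalue A e" using eigenvalue_root_char_poly[OF A] Cons.prems(3) by simp
  then obtain v0 where v0: "v0 \<in> carrier_vec (Suc m)" "v0 \<noteq> 0\<^sub>v (Suc m)" "A *\<^sub>v v0 = e \<cdot>\<^sub>v v0"
    using A unfolding eigenvalue_def eigenvector_def by auto
  have nv0: "euclid_norm v0 \<noteq> 0"
    using scalar_prod_self_eq_0_iff[OF v0(1)] v0(2) by (simp add: euclid_norm_def)
  define v where "v = (1 / euclid_norm v0) \<cdot>\<^sub>v v0"
  have v: "v \<in> carrier_vec (Suc m)" using v0 by (simp add: v_def)
  have "euclid_norm v = 1" unfolding v_def euclid_norm_smult using nv0 by simp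
  then have v1: "v \<bullet> v = 1" by (simp add: euclid_norm_eq_1_iff)
  have Av: "A *\<^sub>v v = e \<cdot>\<^sub>v v"
    using mult_mat_vec[OF A v0(1), of "1 / euclid_norm v0"] v0
    by (simp add: v_def smult_smult_assoc mult.commute)
  obtain H where H: "H \<in> carrier_mat (Suc m) (Suc m)" and HT: "transpose_mat H = H"
    and HH: "H * H = 1\<^sub>m (Suc m)" and Hv: "col H 0 = v"
    by (rule householder_reflection[OF v v1])
  define B where "B = H * (A * H)"
  have B: "B \<in> carrier_mat (Suc m) (Suc m)" using A H by (simp add: B_def)
  have BT: "transpose_mat B = B"
    using A H by (simp add: B_def transpose_mult[of _ "Suc m" "Suc m" _ "Suc m"] HT Cons.prems(2)
      assoc_mult_mat[of _ "Suc m" "Suc m" _ "Suc m" _ "Suc m"])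
  have "H *\<^sub>v v = col (H * H) 0" using col_mult2[OF H H, of 0] by (simp add: Hv)
  then have Hv': "H *\<^sub>v v = unit_vec (Suc m) 0" by (simp add: HH)
  have "col B 0 = H *\<^sub>v (A *\<^sub>v v)"
    using col_mult2[OF H mult_carrier_mat[OF A H], of 0] col_mult2[OF A H, of 0] by (simp add: B_def Hv)
  then have B0: "col B 0 = e \<cdot>\<^sub>v unit_vec (Suc m) 0"
    using mult_mat_vec[OF H v, of e] by (simp add: Av Hv')
  \<comment> \<open>The first column of \<open>B\<close> is \<open>e\<close> times a unit vector;
    symmetry passes its zeros on to the first row, which gives the block form.\<close>
  have Bi0: "B $$ (i, 0) = (if i = 0 then e else 0)" if "i < Suc m" for i
    using arg_cong[OF B0, of "\<lambda>u. u $ i"] that B by simp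
  have B0i: "B $$ (0, i) = (if i = 0 then e else 0)" if "i < Suc m" for i
  proof -
    have "B $$ (0, i) = transpose_mat B $$ (i, 0)" using that B by simp
    then show ?thesis using Bi0[OF that] BT by simp
  qed
  define A' where "A' = mat m m (\<lambda>(i, j). B $$ (Suc i, Suc j))"
  define E where "E = mat 1 1 (\<lambda>_. e)"
  have E: "E \<in> carrier_mat 1 1" and A': "A' \<in> carrier_mat m m" by (auto simp: E_def A'_def)
  have Bblock: "B = four_block_mat E (0\<^sub>m 1 m) (0\<^sub>m m 1) A'"
  proof (intro eq_matI)
    fix i j assume "i < dim_row (four_block_mat E (0\<^sub>m 1 m) (0\<^sub>m m 1) A')"
      "j < dim_col (four_block_mat E (0\<^sub>m 1 m) (0\<^sub>m m 1) A')"
    then have ij: "i < Suc m" "j < Suc m" using E A' by auto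
    then show "B $$ (i, j) = four_block_mat E (0\<^sub>m 1 m) (0\<^sub>m m 1) A' $$ (i, j)"
      using Bi0[OF ij(1)] B0i[OF ij(2)] by (cases i; cases j) (simp_all add: E_def A'_def)
  qed (use B E A' in auto)
  have "H * B * H = (H * H) * (A * (H * H))"
    unfolding B_def using A H by (simp add: assoc_mult_mat[of _ "Suc m" "Suc m" _ "Suc m" _ "Suc m"])
  then have "A = H * B * H" using A HH by simp
  then have "char_poly A = char_poly B"
    using A B H HH by (intro char_poly_similar similar_matI[of _ _ H H "Suc m"]) auto
  also have "\<dots> = char_poly E * char_poly A'"
    unfolding Bblock by (rule char_poly_four_block_zeros_col[OF E _ A']) simp
  also have "char_poly E = [:- e, 1:]"
    by (subst char_poly_upper_triangular[OF E]) (auto simp: E_def diag_mat_def)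
  finally have "[:- e, 1:] * char_poly A' = [:- e, 1:] * (\<Prod>e\<leftarrow>es. [:- e, 1:])"
    using Cons.prems(3) by simp
  then have "char_poly A' = (\<Prod>e\<leftarrow>es. [:- e, 1:])"
    by (subst (asm) mult_cancel_left) auto
  moreover have "transpose_mat A' = A'"
  proof (intro eq_matI)
    fix i j assume "i < dim_row A'" "j < dim_col A'"
    then have "i < m" "j < m" using A' by auto
    then show "transpose_mat A' $$ (i, j) = A' $$ (i, j)"
      using arg_cong[OF BT, of "\<lambda>M. M $$ (Suc i, Suc j)"] B by (simp add: A'_def)
  qed (use A' in auto)
  ultimately obtain P' where P': "P' \<in> carrier_mat m m" "transpose_mat P' * P' = 1\<^sub>m m"
    "A' * P' = P' * mat_diag m (\<lambda>i. es ! i)"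
    using Cons.IH[OF A'] by blast
  let ?D' = "mat_diag m (\<lambda>i. es ! i)" and ?D = "mat_diag (Suc m) (\<lambda>i. (e # es) ! i)"
  have D': "?D' \<in> carrier_mat m m" by (rule mat_diag_dim)
  define Q where "Q = four_block_mat (1\<^sub>m 1) (0\<^sub>m 1 m) (0\<^sub>m m 1) P'"
  have Q: "Q \<in> carrier_mat (Suc m) (Suc m)"
    using four_block_carrier_mat[OF _ P'(1), of "1\<^sub>m 1" 1 1] by (simp add: Q_def)
  have D: "?D = four_block_mat E (0\<^sub>m 1 m) (0\<^sub>m m 1) ?D'"
  proof (intro eq_matI)
    fix i j assume "i < dim_row (four_block_mat E (0\<^sub>m 1 m) (0\<^sub>m m 1) ?D')"
      "j < dim_col (four_block_mat E (0\<^sub>m 1 m) (0\<^sub>m m 1) ?D')"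
    then have "i < Suc m" "j < Suc m" using E D' by auto
    then show "?D $$ (i, j) = four_block_mat E (0\<^sub>m 1 m) (0\<^sub>m m 1) ?D' $$ (i, j)"
      using E D' by (cases i; cases j) (auto simp: E_def mat_diag_def)
  qed (use E D' in \<open>auto simp: mat_diag_def\<close>)
  have BQ: "B * Q = Q * ?D"
    unfolding Bblock Q_def D using E A' P' D' by (simp add: mult_block_diag_mat)
  have QT: "transpose_mat Q = four_block_mat (1\<^sub>m 1) (0\<^sub>m 1 m) (0\<^sub>m m 1) (transpose_mat P')"
    unfolding Q_def using P' by (subst transpose_four_block_mat[of _ 1 1 _ m _ m]) auto
  have "four_block_mat (1\<^sub>m 1) (0\<^sub>m 1 m) (0\<^sub>m m 1) (1\<^sub>m m) = (1\<^sub>m (Suc m) :: real mat)"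
    by (intro eq_matI) auto
  then have QQ: "transpose_mat Q * Q = 1\<^sub>m (Suc m)"
    unfolding QT unfolding Q_def using P' by (simp add: mult_block_diag_mat)
  show ?case unfolding n
  proof (intro bexI[of _ "H * Q"] conjI)
    show "H * Q \<in> carrier_mat (Suc m) (Suc m)" using H Q by simp
    have "transpose_mat (H * Q) * (H * Q) = transpose_mat Q * (H * H) * Q"
      using H Q by (simp add: transpose_mult[of _ "Suc m" "Suc m" _ "Suc m"] HT
        assoc_mult_mat[of _ "Suc m" "Suc m" _ "Suc m" _ "Suc m"])
    then show "transpose_mat (H * Q) * (H * Q) = 1\<^sub>m (Suc m)" using HH QQ Q by simp
    have "H * B = (H * H) * (A * H)"
      unfolding B_def using A H by (simp add: assoc_mult_mat[of _ "Suc m" "Suc m" _ "Suc m" _ "Suc m"])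
    then have "A * H = H * B" using A H HH by simp
    then have "A * (H * Q) = H * B * Q" using assoc_mult_mat[OF A H Q] by simp
    also have "\<dots> = H * (Q * ?D)" unfolding assoc_mult_mat[OF H B Q] BQ ..
    also have "\<dots> = H * Q * ?D" by (rule assoc_mult_mat[OF H Q mat_diag_dim, symmetric])
    finally show "A * (H * Q) = H * Q * ?D" .
  qed
qed

text \<open>Over the complex numbers the polynomial factors. For a root \<open>a\<close> with
  eigenvector \<open>x + i y\<close>, evaluating \<open>(A y) . x = y . (A x)\<close> in two ways
  gives \<open>Im a * (x . x + y . y) = 0\<close>, so \<open>a\<close> is real. The factorization
  descends to the reals because the coefficient embedding is injective.\<close>

theorem real_symmetric_char_poly_splits:
  fixes A :: "real mat"
  assumes A: "A \<in> carrier_mat n n" and sym: "transpose_mat A = A"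
  shows "\<exists>es. char_poly A = (\<Prod>e\<leftarrow>es. [:- e, 1:]) \<and> length es = n"
proof -
  let ?h = "of_real :: real \<Rightarrow> complex"
  interpret mp: map_poly_inj_comm_ring_hom ?h ..
  let ?C = "map_mat ?h A"
  have C: "?C \<in> carrier_mat n n" using A by simp
  obtain as where as: "char_poly ?C = (\<Prod>a\<leftarrow>as. [:- a, 1:])" "length as = n"
    using char_poly_factorized[OF C] by blast
  have real: "Im a = 0" if "a \<in> set as" for a
  proof -
    have "poly (char_poly ?C) a = 0" using that unfolding as poly_prod_list by (auto simp: prod_list_zero_iff)
    then have "eigenvalue ?C a" using eigenvalue_root_char_poly[OF C] by simp
    then obtain z where z: "z \<in> carrier_vec n" "z \<noteq> 0\<^sub>v n" "?C *\<^sub>v z = a \<cdot>\<^sub>v z"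
      using C unfolding eigenvalue_def eigenvector_def by auto
    define x y where "x = map_vec Re z" and "y = map_vec Im z"
    have x: "x \<in> carrier_vec n" and y: "y \<in> carrier_vec n" using z by (auto simp: x_def y_def)
    have Ax: "A *\<^sub>v x = Re a \<cdot>\<^sub>v x - Im a \<cdot>\<^sub>v y"
    proof (intro eq_vecI)
      fix i assume "i < dim_vec (Re a \<cdot>\<^sub>v x - Im a \<cdot>\<^sub>v y)"
      then have i: "i < n" using y by simp
      have "(A *\<^sub>v x) $ i = Re ((?C *\<^sub>v z) $ i)"
        using i A z(1) by (simp add: scalar_prod_def x_def)
      then show "(A *\<^sub>v x) $ i = (Re a \<cdot>\<^sub>v x - Im a \<cdot>\<^sub>v y) $ i"
        using i z by (simp add: x_def y_def)
    qed (use A y in simp)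
    have Ay: "A *\<^sub>v y = Im a \<cdot>\<^sub>v x + Re a \<cdot>\<^sub>v y"
    proof (intro eq_vecI)
      fix i assume "i < dim_vec (Im a \<cdot>\<^sub>v x + Re a \<cdot>\<^sub>v y)"
      then have i: "i < n" using y by simp
      have "(A *\<^sub>v y) $ i = Im ((?C *\<^sub>v z) $ i)"
        using i A z(1) by (simp add: scalar_prod_def y_def)
      then show "(A *\<^sub>v y) $ i = (Im a \<cdot>\<^sub>v x + Re a \<cdot>\<^sub>v y) $ i"
        using i z by (simp add: x_def y_def algebra_simps)
    qed (use A y in simp)
    have "(A *\<^sub>v y) \<bullet> x = y \<bullet> (A *\<^sub>v x)" using transpose_vec_mult_scalar[OF A x y] sym by simp
    then have "Im a * (x \<bullet> x) + Re a * (y \<bullet> x) = Re a * (y \<bullet> x) - Im a * (y \<bullet> y)"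
      unfolding Ax Ay using x y
      by (simp add: add_scalar_prod_distrib[of _ n] scalar_prod_minus_distrib[of _ n])
    then have 0: "Im a * (x \<bullet> x + y \<bullet> y) = 0" by (simp add: algebra_simps)
    have "x \<bullet> x + y \<bullet> y \<noteq> 0"
    proof
      assume "x \<bullet> x + y \<bullet> y = 0"
      then have "x \<bullet> x = 0" "y \<bullet> y = 0"
        using scalar_prod_self_nonneg[of x] scalar_prod_self_nonneg[of y] by linarith+
      then have xy: "x = 0\<^sub>v n" "y = 0\<^sub>v n"
        using scalar_prod_self_eq_0_iff[OF x] scalar_prod_self_eq_0_iff[OF y] by auto
      have "z = 0\<^sub>v n"
      proof (intro eq_vecI)
        fix i assume "i < dim_vec (0\<^sub>v n :: complex vec)"
        then show "z $ i = 0\<^sub>v n $ i"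
          using arg_cong[OF xy(1), of "\<lambda>u. u $ i"] arg_cong[OF xy(2), of "\<lambda>u. u $ i"] z
          by (simp add: x_def y_def complex_eq_iff)
      qed (use z in simp)
      with z show False by simp
    qed
    with 0 show ?thesis by simp
  qed
  let ?es = "map Re as"
  have "map_poly ?h (char_poly A) = (\<Prod>a\<leftarrow>as. [:- a, 1:])"
    using of_real_hom.char_poly_hom[OF A] as by metis
  also have "\<dots> = (\<Prod>e\<leftarrow>?es. map_poly ?h [:- e, 1:])"
    unfolding map_map comp_def using real
    by (intro arg_cong[of _ _ prod_list] map_cong) (auto simp: complex_eq_iff)
  also have "\<dots> = map_poly ?h (\<Prod>e\<leftarrow>?es. [:- e, 1:])"
    by (simp add: mp.hom_prod_list comp_def)
  finally show ?thesis using as by (intro exI[of _ ?es]) (auto dest: mp.injectivity)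
qed

section \<open>Singular values and their perturbation\<close>

lemma proots_prod_linear_factors:
  fixes es :: "'a::idom list"
  shows "proots (\<Prod>e\<leftarrow>es. [:- e, 1:]) = mset es"
proof (induction es)
  case (Cons e es)
  have "(\<Prod>e\<leftarrow>es. [:- e, 1:]) \<noteq> 0" by (auto simp: prod_list_zero_iff)
  moreover have "proots [:- e, 1:] = {#e#}" by (subst proots_linear_factor) simp
  ultimately have "proots ([:- e, 1:] * (\<Prod>e\<leftarrow>es. [:- e, 1:])) = {#e#} + mset es"
    by (subst proots_mult) (auto simp: Cons)
  then show ?case unfolding list.map prod_list.Cons by simp
qed simp

lemma gram_scalar_prod:
  fixes A :: "real mat"
  assumes "A \<in> carrier_mat n m" "x \<in> carrier_vec m" "y \<in> carrier_vec m"
  shows "x \<bullet> (transpose_mat A *\<^sub>v (A *\<^sub>v y)) = (A *\<^sub>v x) \<bullet> (A *\<^sub>v y)"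
proof -
  have Ax: "A *\<^sub>v x \<in> carrier_vec n" and Ay: "A *\<^sub>v y \<in> carrier_vec n" using assms by auto
  have "x \<bullet> (transpose_mat A *\<^sub>v (A *\<^sub>v y)) = (transpose_mat A *\<^sub>v (A *\<^sub>v y)) \<bullet> x"
    using assms by (intro comm_scalar_prod[of _ m]) auto
  also have "\<dots> = (A *\<^sub>v y) \<bullet> (A *\<^sub>v x)" by (rule transpose_vec_mult_scalar[OF assms(1,2) Ay])
  finally show ?thesis using comm_scalar_prod[OF Ax Ay] by simp
qed

text \<open>An orthonormal basis of right singular vectors, in the order of
  \<open>sing_vals\<close>; the basis is indexed from 0 and \<open>sing_val\<close> from 1, hence
  \<open>Suc j\<close>. Completeness is expressed as the bilinear Parseval identity, the form in
  which it is applied. The eigenvalue equation of the Gram matrix replaces left singular vectors,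
  which would require division by singular values that may vanish.\<close>

definition sing_basis :: "real mat \<Rightarrow> (nat \<Rightarrow> real vec) \<Rightarrow> bool" where
  "sing_basis A v \<longleftrightarrow>
    (\<forall>j<dim_col A. v j \<in> carrier_vec (dim_col A) \<and>
      transpose_mat A *\<^sub>v (A *\<^sub>v v j) = (sing_val A (Suc j))\<^sup>2 \<cdot>\<^sub>v v j) \<and>
    (\<forall>i<dim_col A. \<forall>j<dim_col A. v i \<bullet> v j = (if i = j then 1 else 0)) \<and>
    (\<forall>x \<in> carrier_vec (dim_col A). \<forall>y \<in> carrier_vec (dim_col A).
      x \<bullet> y = (\<Sum>j<dim_col A. (v j \<bullet> x) * (v j \<bullet> y)))"

text \<open>A root \<open>e\<close> of the Gram polynomial with eigenvector \<open>v\<close>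
  satisfies \<open>e * (v . v) = |A v|^2\<close>, so it is nonnegative and squaring undoes the
  square root in \<open>sing_vals\<close>. Sorting only permutes the linear factors.\<close>

lemma sing_vals_properties:
  assumes A: "A \<in> carrier_mat n m"
  shows "length (sing_vals A) = m"
    and "char_poly (transpose_mat A * A) = (\<Prod>e\<leftarrow>map power2 (sing_vals A). [:- e, 1:])"
    and "\<And>x. x \<in> set (sing_vals A) \<Longrightarrow> 0 \<le> x"
proof -
  let ?G = "transpose_mat A * A"
  have G: "?G \<in> carrier_mat m m" using A by simp
  have "transpose_mat ?G = ?G" using A by (simp add: transpose_mult[of _ m n _ m])
  then obtain es where es: "char_poly ?G = (\<Prod>e\<leftarrow>es. [:- e, 1:])" "length es = m"
    using real_symmetric_char_poly_splits[OF G] by blast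
  have nonneg: "0 \<le> e" if "e \<in> set es" for e
  proof -
    have "poly (char_poly ?G) e = 0"
      using that unfolding es poly_prod_list by (auto simp: prod_list_zero_iff)
    then have "eigenvalue ?G e" using eigenvalue_root_char_poly[OF G] by simp
    then obtain v where v: "v \<in> carrier_vec m" "v \<noteq> 0\<^sub>v m" "?G *\<^sub>v v = e \<cdot>\<^sub>v v"
      using G A unfolding eigenvalue_def eigenvector_def by auto
    have "e * (v \<bullet> v) = v \<bullet> (?G *\<^sub>v v)" using v by simp
    also have "\<dots> = v \<bullet> (transpose_mat A *\<^sub>v (A *\<^sub>v v))"
      using A v(1) by (simp add: assoc_mult_mat_vec[of _ m n _ m])
    also have "\<dots> = (A *\<^sub>v v) \<bullet> (A *\<^sub>v v)" by (rule gram_scalar_prod[OF A v(1) v(1)])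
    also have "\<dots> \<ge> 0" by simp
    finally have "0 \<le> e * (v \<bullet> v)" .
    moreover have "0 < v \<bullet> v"
      using scalar_prod_self_nonneg[of v] scalar_prod_self_eq_0_iff[OF v(1)] v(2) by linarith
    ultimately show ?thesis by (simp add: zero_le_mult_iff)
  qed
  have ms: "mset (sing_vals A) = image_mset sqrt (mset es)"
    by (simp add: sing_vals_def es proots_prod_linear_factors)
  show "length (sing_vals A) = m" using arg_cong[OF ms, of size] es(2) by simp
  show "0 \<le> x" if "x \<in> set (sing_vals A)" for x
    using that arg_cong[OF ms, of set_mset] nonneg by auto
  have "mset (map power2 (sing_vals A)) = image_mset (\<lambda>e. (sqrt e)\<^sup>2) (mset es)"
    by (simp add: ms image_mset.compositionality comp_def)
  also have "\<dots> = image_mset (\<lambda>e. e) (mset es)"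
    by (rule image_mset_cong) (simp add: nonneg)
  finally have perm: "mset (map power2 (sing_vals A)) = mset es" by simp
  have "mset (map (\<lambda>e. [:- e, 1:]) (map power2 (sing_vals A))) = mset (map (\<lambda>e. [:- e, 1:]) es)"
    unfolding mset_map[of "\<lambda>e. [:- e, 1:]"] perm ..
  then show "char_poly ?G = (\<Prod>e\<leftarrow>map power2 (sing_vals A). [:- e, 1:])"
    unfolding es by (metis prod_mset_prod_list)
qed

lemma sing_val_nonneg:
  assumes "A \<in> carrier_mat n m" "j < m"
  shows "0 \<le> sing_val A (Suc j)"
  using sing_vals_properties[OF assms(1)] assms(2) by (simp add: sing_val_def)

lemma sing_val_antimono:
  assumes "A \<in> carrier_mat n m" "i \<le> j" "j < m"
  shows "sing_val A (Suc j) \<le> sing_val A (Suc i)"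
proof -
  have "sorted (rev (sing_vals A))" by (simp add: sing_vals_def)
  then have "sing_vals A ! j \<le> sing_vals A ! i"
    using sorted_rev_nth_mono[of "sing_vals A" i j] assms sing_vals_properties(1)[OF assms(1)] by simp
  then show ?thesis by (simp add: sing_val_def)
qed

text \<open>The columns of the orthogonal matrix that diagonalizes the Gram matrix, with the squared
  singular values as prescribed list. Orthonormality is \<open>P^T P = 1\<close>; Parseval is the
  opposite product \<open>P P^T = 1\<close>.\<close>

lemma ex_sing_basis:
  assumes A: "A \<in> carrier_mat n m"
  shows "\<exists>v. sing_basis A v"
proof -
  let ?G = "transpose_mat A * A"
  have G: "?G \<in> carrier_mat m m" using A by simp
  have GT: "transpose_mat ?G = ?G" using A by (simp add: transpose_mult[of _ m n _ m])
  obtain P where P: "P \<in> carrier_mat m m" "transpose_mat P * P = 1\<^sub>m m"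
    and GP: "?G * P = P * mat_diag m (\<lambda>i. map power2 (sing_vals A) ! i)"
    using real_symmetric_diagonalization[OF G GT sing_vals_properties(2)[OF A]] by blast
  have PT: "transpose_mat P \<in> carrier_mat m m" using P(1) by simp
  have PPT: "P * transpose_mat P = 1\<^sub>m m"
    using mat_mult_left_right_inverse[OF _ P(1) P(2)] P(1) by simp
  have "?G *\<^sub>v col P j = (sing_val A (Suc j))\<^sup>2 \<cdot>\<^sub>v col P j" if j: "j < m" for j
  proof -
    have "?G *\<^sub>v col P j = col (?G * P) j" by (rule col_mult2[OF G P(1) j, symmetric])
    also have "\<dots> = col (mat m m (\<lambda>(i, j). P $$ (i, j) * map power2 (sing_vals A) ! j)) j"
      unfolding GP by (subst mat_diag_mult_right[OF P(1)]) simp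
    also have "\<dots> = (sing_val A (Suc j))\<^sup>2 \<cdot>\<^sub>v col P j"
      by (intro eq_vecI) (use P j sing_vals_properties(1)[OF A] in \<open>auto simp: sing_val_def\<close>)
    finally show ?thesis .
  qed
  note Gcol = this
  have AT: "transpose_mat A \<in> carrier_mat m n" using A by simp
  have ev: "transpose_mat A *\<^sub>v (A *\<^sub>v col P j) = (sing_val A (Suc j))\<^sup>2 \<cdot>\<^sub>v col P j"
    if j: "j < m" for j
    using Gcol[OF j] assoc_mult_mat_vec[OF AT A, of "col P j"] P(1) j by simp
  have orth: "col P i \<bullet> col P j = (if i = j then 1 else 0)" if "i < m" "j < m" for i j
  proof -
    have "(transpose_mat P * P) $$ (i, j) = col P i \<bullet> col P j"
      using that P(1) by simp
    then show ?thesis using that P(2) by simp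
  qed
  have parseval: "x \<bullet> y = (\<Sum>j<m. (col P j \<bullet> x) * (col P j \<bullet> y))"
    if x: "x \<in> carrier_vec m" and y: "y \<in> carrier_vec m" for x y
  proof -
    have Px: "transpose_mat P *\<^sub>v x \<in> carrier_vec m" using P(1) x by simp
    have "x \<bullet> y = x \<bullet> (P *\<^sub>v (transpose_mat P *\<^sub>v y))"
      using assoc_mult_mat_vec[OF P(1) PT y] PPT y by simp
    also have "\<dots> = (transpose_mat P *\<^sub>v x) \<bullet> (transpose_mat P *\<^sub>v y)"
      using transpose_vec_mult_scalar[OF P(1) _ x, of "transpose_mat P *\<^sub>v y"] P(1) y by simp
    also have "\<dots> = (\<Sum>j<m. (col P j \<bullet> x) * (col P j \<bullet> y))"
      using P(1) by (simp add: scalar_prod_def[of "_ *\<^sub>v _"] lessThan_atLeast0)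
    finally show ?thesis .
  qed
  have dim: "dim_col A = m" using A by simp
  show ?thesis
    unfolding sing_basis_def dim
    by (intro exI[of _ "col P"] conjI allI impI ballI ev orth parseval) (use P(1) in auto)
qed

context
  fixes A :: "real mat" and v and n m
  assumes A: "A \<in> carrier_mat n m" and basis: "sing_basis A v"
begin

lemma sing_basis_carrier: "j < m \<Longrightarrow> v j \<in> carrier_vec m"
  and sing_basis_eigen: "j < m \<Longrightarrow>
    transpose_mat A *\<^sub>v (A *\<^sub>v v j) = (sing_val A (Suc j))\<^sup>2 \<cdot>\<^sub>v v j"
  and sing_basis_orthonormal: "i < m \<Longrightarrow> j < m \<Longrightarrow> v i \<bullet> v j = (if i = j then 1 else 0)"
  and sing_basis_parseval: "x \<in> carrier_vec m \<Longrightarrow> y \<in> carrier_vec m \<Longrightarrow>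
    x \<bullet> y = (\<Sum>j<m. (v j \<bullet> x) * (v j \<bullet> y))"
proof -
  have dim: "dim_col A = m" using A by simp
  show "j < m \<Longrightarrow> v j \<in> carrier_vec m"
    "j < m \<Longrightarrow> transpose_mat A *\<^sub>v (A *\<^sub>v v j) = (sing_val A (Suc j))\<^sup>2 \<cdot>\<^sub>v v j"
    "i < m \<Longrightarrow> j < m \<Longrightarrow> v i \<bullet> v j = (if i = j then 1 else 0)"
    "x \<in> carrier_vec m \<Longrightarrow> y \<in> carrier_vec m \<Longrightarrow> x \<bullet> y = (\<Sum>j<m. (v j \<bullet> x) * (v j \<bullet> y))"
    using basis unfolding sing_basis_def dim by blast+
qed

lemma sing_basis_gram:
  assumes x: "x \<in> carrier_vec m" and j: "j < m"
  shows "v j \<bullet> (transpose_mat A *\<^sub>v (A *\<^sub>v x)) = (sing_val A (Suc j))\<^sup>2 * (v j \<bullet> x)"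
proof -
  note vj = sing_basis_carrier[OF j]
  have "v j \<bullet> (transpose_mat A *\<^sub>v (A *\<^sub>v x)) = (A *\<^sub>v v j) \<bullet> (A *\<^sub>v x)"
    by (rule gram_scalar_prod[OF A vj x])
  also have "\<dots> = (A *\<^sub>v x) \<bullet> (A *\<^sub>v v j)"
    using A vj x by (intro comm_scalar_prod[of _ n]) auto
  also have "\<dots> = x \<bullet> (transpose_mat A *\<^sub>v (A *\<^sub>v v j))"
    by (rule gram_scalar_prod[OF A x vj, symmetric])
  also have "\<dots> = (sing_val A (Suc j))\<^sup>2 * (x \<bullet> v j)"
    unfolding sing_basis_eigen[OF j] using x vj by simp
  finally show ?thesis using comm_scalar_prod[OF x vj] by simp
qed

text \<open>In these coordinates the quadratic form is diagonal. The operator bound and both halves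
  of Weyl's inequality come from comparing its weights with a single squared singular value.\<close>

lemma sing_basis_norm:
  assumes x: "x \<in> carrier_vec m"
  shows "(A *\<^sub>v x) \<bullet> (A *\<^sub>v x) = (\<Sum>j<m. (sing_val A (Suc j))\<^sup>2 * (v j \<bullet> x)\<^sup>2)"
proof -
  have "(A *\<^sub>v x) \<bullet> (A *\<^sub>v x) = x \<bullet> (transpose_mat A *\<^sub>v (A *\<^sub>v x))"
    by (rule gram_scalar_prod[OF A x x, symmetric])
  also have "\<dots> = (\<Sum>j<m. (v j \<bullet> x) * (v j \<bullet> (transpose_mat A *\<^sub>v (A *\<^sub>v x))))"
    using A x by (intro sing_basis_parseval) auto
  also have "\<dots> = (\<Sum>j<m. (sing_val A (Suc j))\<^sup>2 * (v j \<bullet> x)\<^sup>2)"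
    by (intro sum.cong refl) (simp add: sing_basis_gram[OF x] power2_eq_square)
  finally show ?thesis .
qed

end

section \<open>Operator bound and Weyl's inequality\<close>

lemma euclid_norm_mult_le_sing_val:
  assumes A: "A \<in> carrier_mat n m" and "0 < m" and x: "x \<in> carrier_vec m"
  shows "euclid_norm (A *\<^sub>v x) \<le> sing_val A 1 * euclid_norm x"
proof -
  obtain v where v: "sing_basis A v" using ex_sing_basis[OF A] by blast
  have "(A *\<^sub>v x) \<bullet> (A *\<^sub>v x) \<le> (\<Sum>j<m. (sing_val A 1)\<^sup>2 * (v j \<bullet> x)\<^sup>2)"
    unfolding sing_basis_norm[OF A v x]
  proof (intro sum_mono mult_right_mono power_mono)
    fix j assume "j \<in> {..<m}"
    then show "sing_val A (Suc j) \<le> sing_val A 1" "0 \<le> sing_val A (Suc j)"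
      using sing_val_antimono[OF A, of 0 j] sing_val_nonneg[OF A, of j] by auto
  qed simp
  also have "\<dots> = (sing_val A 1)\<^sup>2 * (x \<bullet> x)"
    unfolding sing_basis_parseval[OF A v x x] by (simp add: sum_distrib_left power2_eq_square)
  finally have "(euclid_norm (A *\<^sub>v x))\<^sup>2 \<le> (sing_val A 1 * euclid_norm x)\<^sup>2"
    by (simp add: power_mult_distrib euclid_norm_power2)
  then show ?thesis
    by (rule power2_le_imp_le) (use sing_val_nonneg[OF A \<open>0 < m\<close>] in simp)
qed

text \<open>A dimension count as in Courant-Fischer: the span of the \<open>i + 1\<close> leading
  directions of \<open>A\<close> contains a nonzero \<open>x\<close> orthogonal to the
  \<open>i\<close> leading directions of \<open>B\<close>. On this \<open>x\<close>,
  \<open>A\<close> stretches at least by its singular value and \<open>B\<close> at most by its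
  own.\<close>

theorem weyl_sing_val_le:
  assumes A: "A \<in> carrier_mat n m" and B: "B \<in> carrier_mat n m" and i: "i < m"
    and close: "\<And>x. x \<in> carrier_vec m \<Longrightarrow> euclid_norm (A *\<^sub>v x - B *\<^sub>v x) \<le> \<rho> * euclid_norm x"
  shows "sing_val A (Suc i) \<le> sing_val B (Suc i) + \<rho>"
proof -
  obtain v where v: "sing_basis A v" using ex_sing_basis[OF A] by blast
  obtain w where w: "sing_basis B w" using ex_sing_basis[OF B] by blast
  \<comment> \<open>The \<open>i\<close> orthogonality conditions on \<open>i + 1\<close>
    coefficients, padded by a zero last row to a square matrix. The zero row forces the determinant
    to vanish, and a kernel vector \<open>c\<close> holds the coefficients of
    \<open>x\<close>.\<close>
  define M where "M = mat (Suc i) (Suc i) (\<lambda>(k, l). if k < i then w k \<bullet> v l else 0)"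
  have M: "M \<in> carrier_mat (Suc i) (Suc i)" by (simp add: M_def)
  have "transpose_mat M *\<^sub>v unit_vec (Suc i) i = 0\<^sub>v (Suc i)"
    by (intro eq_vecI) (auto simp: M_def scalar_prod_right_unit)
  moreover have "(unit_vec (Suc i) i :: real vec) \<noteq> 0\<^sub>v (Suc i)"
    using index_unit_vec(1)[of i "Suc i" i] by (auto dest: arg_cong[of _ _ "\<lambda>u. u $ i"])
  moreover have MT: "transpose_mat M \<in> carrier_mat (Suc i) (Suc i)" using M by simp
  ultimately have "det (transpose_mat M) = 0"
    using det_0_iff_vec_prod_zero_field[OF MT] unit_vec_carrier by blast
  then have "det M = 0" using det_transpose[OF M] by simp
  then obtain c where c: "c \<in> carrier_vec (Suc i)" "c \<noteq> 0\<^sub>v (Suc i)" "M *\<^sub>v c = 0\<^sub>v (Suc i)"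
    using det_0_iff_vec_prod_zero_field[OF M] by blast
  define x where "x = vec m (\<lambda>p. \<Sum>l\<le>i. c $ l * v l $ p)"
  have x: "x \<in> carrier_vec m" by (simp add: x_def)
  have dot: "y \<bullet> x = (\<Sum>l\<le>i. c $ l * (y \<bullet> v l))" if "y \<in> carrier_vec m" for y
  proof -
    have "y \<bullet> x = (\<Sum>p<m. \<Sum>l\<le>i. c $ l * (y $ p * v l $ p))"
      by (simp add: scalar_prod_def x_def sum_distrib_left lessThan_atLeast0 mult.left_commute)
    also have "\<dots> = (\<Sum>l\<le>i. \<Sum>p<m. c $ l * (y $ p * v l $ p))" by (rule sum.swap)
    also have "\<dots> = (\<Sum>l\<le>i. c $ l * (y \<bullet> v l))"
    proof (intro sum.cong refl)
      fix l assume "l \<in> {..i}"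
      then have "v l \<in> carrier_vec m" using sing_basis_carrier[OF A v, of l] i by simp
      then show "(\<Sum>p<m. c $ l * (y $ p * v l $ p)) = c $ l * (y \<bullet> v l)"
        by (simp add: scalar_prod_def sum_distrib_left lessThan_atLeast0)
    qed
    finally show ?thesis .
  qed
  have vx: "v j \<bullet> x = (if j \<le> i then c $ j else 0)" if "j < m" for j
  proof -
    have "v j \<bullet> x = (\<Sum>l\<le>i. if l = j then c $ j else 0)"
      unfolding dot[OF sing_basis_carrier[OF A v that]]
      by (intro sum.cong refl) (use sing_basis_orthonormal[OF A v that] i in auto)
    then show ?thesis by simp
  qed
  have wx: "w k \<bullet> x = 0" if "k < i" for k
  proof -
    have "w k \<bullet> x = (M *\<^sub>v c) $ k"
      unfolding dot[OF sing_basis_carrier[OF B w less_trans[OF that i]]]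
      using that c(1) by (simp add: M_def scalar_prod_def atLeast0LessThan lessThan_Suc_atMost mult.commute
        del: sum.op_ivl_Suc)
    then show ?thesis using c(3) that by simp
  qed
  have xx: "x \<bullet> x = (\<Sum>j<m. (v j \<bullet> x)\<^sup>2)" "x \<bullet> x = (\<Sum>j<m. (w j \<bullet> x)\<^sup>2)"
    unfolding power2_eq_square
    by (rule sing_basis_parseval[OF A v x x], rule sing_basis_parseval[OF B w x x])
  have "x \<noteq> 0\<^sub>v m"
  proof
    assume *: "x = 0\<^sub>v m"
    have "c = 0\<^sub>v (Suc i)"
    proof (intro eq_vecI)
      fix j assume "j < dim_vec (0\<^sub>v (Suc i) :: real vec)"
      then show "c $ j = 0\<^sub>v (Suc i) $ j"
        using vx[of j] i sing_basis_carrier[OF A v, of j] * by simp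
    qed (use c in simp)
    with c(2) show False by simp
  qed
  then have pos: "0 < euclid_norm x"
    using scalar_prod_self_eq_0_iff[OF x] scalar_prod_self_nonneg[of x]
    by (simp add: euclid_norm_def less_le)
  \<comment> \<open>\<open>x\<close> has components only along \<open>v j\<close> with
    \<open>j \<le> i\<close>, where the weights are at least that of \<open>i\<close>.\<close>
  have "sing_val A (Suc i) * euclid_norm x \<le> euclid_norm (A *\<^sub>v x)"
  proof (rule power2_le_imp_le)
    have "(sing_val A (Suc i))\<^sup>2 * (v j \<bullet> x)\<^sup>2 \<le> (sing_val A (Suc j))\<^sup>2 * (v j \<bullet> x)\<^sup>2" if "j < m" for j
      using sing_val_antimono[OF A, of j i] sing_val_nonneg[OF A i] i vx[OF that]
      by (cases "j \<le> i") (auto intro!: mult_right_mono power_mono)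
    then show "(sing_val A (Suc i) * euclid_norm x)\<^sup>2 \<le> (euclid_norm (A *\<^sub>v x))\<^sup>2"
      unfolding power_mult_distrib euclid_norm_power2 sing_basis_norm[OF A v x] xx(1) sum_distrib_left
      by (intro sum_mono) simp
  qed simp
  also have "\<dots> \<le> euclid_norm (B *\<^sub>v x) + euclid_norm (A *\<^sub>v x - B *\<^sub>v x)"
    using euclid_norm_diff_le[of "A *\<^sub>v x" "B *\<^sub>v x"] A B by simp
  \<comment> \<open>The components of \<open>x\<close> along \<open>w j\<close> vanish for
    \<open>j < i\<close>, so only weights up to that of \<open>i\<close> survive.\<close>
  also have "euclid_norm (B *\<^sub>v x) \<le> sing_val B (Suc i) * euclid_norm x"
  proof (rule power2_le_imp_le)
    have "(sing_val B (Suc j))\<^sup>2 * (w j \<bullet> x)\<^sup>2 \<le> (sing_val B (Suc i))\<^sup>2 * (w j \<bullet> x)\<^sup>2" if "j < m" for j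
      using sing_val_antimono[OF B, of i j] sing_val_nonneg[OF B that] that wx[of j]
      by (cases "j < i") (auto intro!: mult_right_mono power_mono)
    then show "(euclid_norm (B *\<^sub>v x))\<^sup>2 \<le> (sing_val B (Suc i) * euclid_norm x)\<^sup>2"
      unfolding power_mult_distrib euclid_norm_power2 sing_basis_norm[OF B w x] xx(2) sum_distrib_left
      by (intro sum_mono) simp
  qed (use sing_val_nonneg[OF B i] in simp)
  also have "euclid_norm (A *\<^sub>v x - B *\<^sub>v x) \<le> \<rho> * euclid_norm x" by (rule close[OF x])
  finally have "sing_val A (Suc i) * euclid_norm x \<le> (sing_val B (Suc i) + \<rho>) * euclid_norm x"
    by (simp add: algebra_simps)
  then show ?thesis using pos by simp
qed

corollary weyl_sing_val:
  assumes A: "A \<in> carrier_mat n m" and B: "B \<in> carrier_mat n m" and i: "i < m"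
    and close: "\<And>x. x \<in> carrier_vec m \<Longrightarrow> euclid_norm (A *\<^sub>v x - B *\<^sub>v x) \<le> \<rho> * euclid_norm x"
  shows "\<bar>sing_val A (Suc i) - sing_val B (Suc i)\<bar> \<le> \<rho>"
proof -
  have "euclid_norm (B *\<^sub>v x - A *\<^sub>v x) \<le> \<rho> * euclid_norm x" if "x \<in> carrier_vec m" for x
    using close[OF that] euclid_norm_minus_commute[of "A *\<^sub>v x" "B *\<^sub>v x"] A B by simp
  then show ?thesis
    using weyl_sing_val_le[OF A B i close] weyl_sing_val_le[OF B A i] by fastforce
qed

section \<open>Singular vectors of nearby matrices\<close>

lemma ex_sing_vec_pair:
  assumes A: "A \<in> carrier_mat n m" and i: "i < m" and pos: "0 < sing_val A (Suc i)"
  shows "\<exists>u v. sing_vec_pair A (Suc i) u v"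
proof -
  obtain v where v: "sing_basis A v" using ex_sing_basis[OF A] by blast
  define s where "s = sing_val A (Suc i)"
  define u where "u = (1 / s) \<cdot>\<^sub>v (A *\<^sub>v v i)"
  note vi = sing_basis_carrier[OF A v i]
  have Avi: "A *\<^sub>v v i \<in> carrier_vec n" using A vi by simp
  have v1: "v i \<bullet> v i = 1" using sing_basis_orthonormal[OF A v i i] by simp
  have "(A *\<^sub>v v i) \<bullet> (A *\<^sub>v v i) = s\<^sup>2"
    using gram_scalar_prod[OF A vi vi] vi v1 unfolding sing_basis_eigen[OF A v i] by (simp add: s_def)
  then have "u \<bullet> u = 1"
    using Avi pos by (simp add: u_def s_def power2_eq_square)
  moreover have "A *\<^sub>v v i = s \<cdot>\<^sub>v u" using pos by (simp add: u_def s_def smult_smult_assoc)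
  moreover have "transpose_mat A *\<^sub>v u = s \<cdot>\<^sub>v v i"
  proof -
    have "transpose_mat A *\<^sub>v u = (1 / s) \<cdot>\<^sub>v (s\<^sup>2 \<cdot>\<^sub>v v i)"
      unfolding u_def using mult_mat_vec[of "transpose_mat A" m n "A *\<^sub>v v i" "1 / s"] A Avi
        sing_basis_eigen[OF A v i] by (simp add: s_def)
    then show ?thesis using pos by (simp add: s_def smult_smult_assoc power2_eq_square)
  qed
  moreover have "u \<in> carrier_vec n" using Avi by (simp add: u_def)
  ultimately have "sing_vec_pair A (Suc i) u (v i)"
    unfolding sing_vec_pair_def using A vi v1 by (auto simp: s_def euclid_norm_eq_1_iff)
  then show ?thesis by blast
qed

lemma sing_vec_pair_carrier:
  assumes "sing_vec_pair A i u v" "A \<in> carrier_mat n m"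
  shows "u \<in> carrier_vec n" "v \<in> carrier_vec m" "euclid_norm u = 1" "euclid_norm v = 1"
    "A *\<^sub>v v = sing_val A i \<cdot>\<^sub>v u"
    "transpose_mat A *\<^sub>v (A *\<^sub>v v) = (sing_val A i)\<^sup>2 \<cdot>\<^sub>v v"
proof -
  show u: "u \<in> carrier_vec n" and v: "v \<in> carrier_vec m" "euclid_norm u = 1" "euclid_norm v = 1"
    and Av: "A *\<^sub>v v = sing_val A i \<cdot>\<^sub>v u"
    using assms by (auto simp: sing_vec_pair_def)
  have AT: "transpose_mat A \<in> carrier_mat m n" using assms(2) by simp
  show "transpose_mat A *\<^sub>v (A *\<^sub>v v) = (sing_val A i)\<^sup>2 \<cdot>\<^sub>v v"
    using assms(1) mult_mat_vec[OF AT u, of "sing_val A i"] unfolding Av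
    by (simp add: sing_vec_pair_def smult_smult_assoc power2_eq_square)
qed

text \<open>The component of a singular vector \<open>y\<close> of \<open>B\<close> along any other singular direction of \<open>A\<close>
  is a component of \<open>(A\<^sup>T A - B\<^sup>T B) y\<close> divided by a difference of squared singular values.\<close>

lemma sing_vec_concentration:
  assumes A: "A \<in> carrier_mat n m" and B: "B \<in> carrier_mat n m" and i: "i < m"
    and basis: "sing_basis A v" and pair: "sing_vec_pair B (Suc i) w y"
    and close: "\<And>x. x \<in> carrier_vec m \<Longrightarrow> euclid_norm (A *\<^sub>v x - B *\<^sub>v x) \<le> \<rho> * euclid_norm x"
    and gap: "\<And>j. j < m \<Longrightarrow> j \<noteq> i \<Longrightarrow> \<eta> \<le> \<bar>sing_val A (Suc j) - sing_val B (Suc i)\<bar>"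
    and pos: "0 < \<eta>" "0 < \<tau>" "\<tau> \<le> sing_val B (Suc i)" and \<rho>: "0 \<le> \<rho>"
  shows "1 - (v i \<bullet> y)\<^sup>2 \<le> (\<rho> * (sing_val A 1 + sing_val B (Suc i)) / (\<eta> * \<tau>))\<^sup>2"
proof -
  define s where "s = sing_val B (Suc i)"
  note y = sing_vec_pair_carrier[OF pair B]
  have yc: "y \<in> carrier_vec m" by (rule y(2))
  have s: "0 < s" "\<tau> \<le> s" using pos by (auto simp: s_def)
  have \<sigma>1: "0 \<le> sing_val A 1" using sing_val_nonneg[OF A, of 0] i by simp
  let ?x = "transpose_mat A *\<^sub>v (A *\<^sub>v y)" and ?z = "transpose_mat B *\<^sub>v (B *\<^sub>v y)"
  define D where "D = ?x - ?z"
  have xz: "?x \<in> carrier_vec m" "?z \<in> carrier_vec m" using A B yc by auto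
  then have D: "D \<in> carrier_vec m" by (simp add: D_def)
  have nBy: "euclid_norm (B *\<^sub>v y) = s"
    unfolding y(5) euclid_norm_smult using s y(3) by (simp add: s_def)
  have car: "A *\<^sub>v D \<in> carrier_vec n" "A *\<^sub>v y \<in> carrier_vec n"
    "B *\<^sub>v D \<in> carrier_vec n" "B *\<^sub>v y \<in> carrier_vec n"
    using A B D yc by auto
  have "D \<bullet> D = D \<bullet> ?x - D \<bullet> ?z"
    unfolding D_def[symmetric] using scalar_prod_minus_distrib[OF D xz] by (simp add: D_def)
  also have "\<dots> = (A *\<^sub>v D) \<bullet> (A *\<^sub>v y) - (B *\<^sub>v D) \<bullet> (B *\<^sub>v y)"
    by (simp add: gram_scalar_prod[OF A D yc] gram_scalar_prod[OF B D yc])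
  \<comment> \<open>The mixed product of \<open>A D\<close> and \<open>B y\<close> is added and
    subtracted, so that the difference of the Gram matrices is controlled by \<open>A - B\<close>
    alone.\<close>
  also have "\<dots> = (A *\<^sub>v D) \<bullet> (A *\<^sub>v y - B *\<^sub>v y) + (A *\<^sub>v D - B *\<^sub>v D) \<bullet> (B *\<^sub>v y)"
    using scalar_prod_minus_distrib[OF car(1,2,4)] minus_scalar_prod_distrib[OF car(1,3,4)] by simp
  also have "\<dots> \<le> euclid_norm (A *\<^sub>v D) * euclid_norm (A *\<^sub>v y - B *\<^sub>v y)
      + euclid_norm (A *\<^sub>v D - B *\<^sub>v D) * euclid_norm (B *\<^sub>v y)"
    by (intro add_mono order_trans[OF abs_ge_self abs_scalar_prod_le]) (use A B in simp_all)
  also have "\<dots> \<le> (sing_val A 1 * euclid_norm D) * \<rho> + (\<rho> * euclid_norm D) * s"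
    using euclid_norm_mult_le_sing_val[OF A _ D] i close[OF yc] close[OF D] y(4) nBy \<sigma>1 s \<rho>
    by (intro add_mono mult_mono) auto
  finally have "euclid_norm D * euclid_norm D \<le> (\<rho> * (sing_val A 1 + s)) * euclid_norm D"
    using euclid_norm_power2[of D] by (simp add: power2_eq_square algebra_simps)
  moreover have nonneg: "0 \<le> \<rho> * (sing_val A 1 + s)" using \<rho> \<sigma>1 s by simp
  ultimately have nD: "euclid_norm D \<le> \<rho> * (sing_val A 1 + s)"
    by (cases "euclid_norm D = 0") (auto dest: mult_right_le_imp_le simp: less_le)
  have comp: "((\<eta> * \<tau>) * (v j \<bullet> y))\<^sup>2 \<le> (v j \<bullet> D)\<^sup>2" if j: "j < m" "j \<noteq> i" for j
  proof -
    let ?\<sigma> = "sing_val A (Suc j)"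
    note vj = sing_basis_carrier[OF A basis j(1)]
    have "v j \<bullet> D = (?\<sigma>\<^sup>2 - s\<^sup>2) * (v j \<bullet> y)"
      unfolding D_def scalar_prod_minus_distrib[OF vj xz] sing_basis_gram[OF A basis yc j(1)]
      unfolding y(6) using vj yc by (simp add: s_def algebra_simps)
    also have "?\<sigma>\<^sup>2 - s\<^sup>2 = (?\<sigma> - s) * (?\<sigma> + s)" by (simp add: power2_eq_square algebra_simps)
    finally have "\<bar>v j \<bullet> D\<bar> = (\<bar>?\<sigma> - s\<bar> * (?\<sigma> + s)) * \<bar>v j \<bullet> y\<bar>"
      using sing_val_nonneg[OF A j(1)] s by (simp add: abs_mult)
    \<comment> \<open>\<open>?\<sigma> + s\<close> is at least \<open>\<tau>\<close>; this factor
      converts the gap between singular values into one between their squares.\<close>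
    moreover have "\<eta> * \<tau> \<le> \<bar>?\<sigma> - s\<bar> * (?\<sigma> + s)"
      using gap[OF j] sing_val_nonneg[OF A j(1)] s pos by (intro mult_mono) (auto simp: s_def)
    ultimately have "\<bar>(\<eta> * \<tau>) * (v j \<bullet> y)\<bar> \<le> \<bar>v j \<bullet> D\<bar>"
      using pos by (simp add: abs_mult mult_right_mono)
    then show ?thesis by (rule abs_le_square_iff[THEN iffD1])
  qed
  have "(\<eta> * \<tau>)\<^sup>2 * (1 - (v i \<bullet> y)\<^sup>2) = (\<Sum>j\<in>{..<m} - {i}. ((\<eta> * \<tau>) * (v j \<bullet> y))\<^sup>2)"
  proof -
    have "1 = (\<Sum>j<m. (v j \<bullet> y)\<^sup>2)"
      using sing_basis_parseval[OF A basis yc yc] y(4)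
      by (simp add: euclid_norm_eq_1_iff power2_eq_square)
    also have "\<dots> = (v i \<bullet> y)\<^sup>2 + (\<Sum>j\<in>{..<m} - {i}. (v j \<bullet> y)\<^sup>2)"
      using i by (subst sum.remove[of _ i]) auto
    finally have "1 - (v i \<bullet> y)\<^sup>2 = (\<Sum>j\<in>{..<m} - {i}. (v j \<bullet> y)\<^sup>2)" by simp
    then show ?thesis by (simp add: sum_distrib_left power_mult_distrib)
  qed
  also have "\<dots> \<le> (\<Sum>j\<in>{..<m} - {i}. (v j \<bullet> D)\<^sup>2)"
    by (intro sum_mono comp) auto
  also have "\<dots> \<le> (\<Sum>j<m. (v j \<bullet> D)\<^sup>2)" by (intro sum_mono2) auto
  also have "\<dots> = (euclid_norm D)\<^sup>2"
    unfolding euclid_norm_power2 sing_basis_parseval[OF A basis D D] by (simp add: power2_eq_square)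
  also have "\<dots> \<le> (\<rho> * (sing_val A 1 + s))\<^sup>2" using nD by (intro power_mono) auto
  finally have "(1 - (v i \<bullet> y)\<^sup>2) * (\<eta> * \<tau>)\<^sup>2 \<le> (\<rho> * (sing_val A 1 + s))\<^sup>2"
    by (simp add: mult.commute)
  then show ?thesis using pos by (simp add: power_divide pos_le_divide_eq s_def)
qed

text \<open>With the sign chosen so that \<open>c * (x . y)\<close> is nonnegative, the squared
  distance is \<open>2 - 2 |x . y|\<close>. As \<open>|x . y| \<le> 1\<close>, this is at most
  \<open>2 (1 - (x . y)^2)\<close>. The constant 2 is a convenient enlargement of the square root of
  2.\<close>

lemma unit_vec_sign_dist:
  assumes x: "x \<in> carrier_vec m" and y: "y \<in> carrier_vec m"
    and unit: "euclid_norm x = 1" "euclid_norm y = 1"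
    and \<kappa>: "1 - (x \<bullet> y)\<^sup>2 \<le> \<kappa>\<^sup>2" "0 \<le> \<kappa>"
  shows "\<exists>c::real. \<bar>c\<bar> = 1 \<and> euclid_norm (y - c \<cdot>\<^sub>v x) \<le> 2 * \<kappa>"
proof -
  define c :: real where "c = (if 0 \<le> x \<bullet> y then 1 else - 1)"
  have c: "\<bar>c\<bar> = 1" "c * c = 1" "c * (x \<bullet> y) = \<bar>x \<bullet> y\<bar>" by (auto simp: c_def)
  have le1: "\<bar>x \<bullet> y\<bar> \<le> 1" using abs_scalar_prod_le[of x y] x y unit by simp
  have xx: "x \<bullet> x = 1" "y \<bullet> y = 1" using unit by (simp_all add: euclid_norm_eq_1_iff)
  have yx: "y \<bullet> x = x \<bullet> y" by (rule comm_scalar_prod[OF y x])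
  have cx: "c \<cdot>\<^sub>v x \<in> carrier_vec m" using x by simp
  have "(euclid_norm (y - c \<cdot>\<^sub>v x))\<^sup>2 = (y \<bullet> y - c * (y \<bullet> x)) - (c * (x \<bullet> y) - c * (c * (x \<bullet> x)))"
    unfolding euclid_norm_power2 minus_scalar_prod_distrib[OF y cx minus_carrier_vec[OF y cx]]
      scalar_prod_minus_distrib[OF y y cx] scalar_prod_minus_distrib[OF cx y cx]
    using x y by simp
  also have "\<dots> = 2 - 2 * \<bar>x \<bullet> y\<bar>" using c xx yx by (simp add: mult.assoc[symmetric])
  also have "\<dots> \<le> 2 * (1 - (x \<bullet> y)\<^sup>2)"
  proof -
    have "\<bar>x \<bullet> y\<bar> * \<bar>x \<bullet> y\<bar> \<le> \<bar>x \<bullet> y\<bar> * 1" by (intro mult_left_mono le1) simp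
    then show ?thesis by (simp add: power2_eq_square)
  qed
  also have "\<dots> \<le> 2 * \<kappa>\<^sup>2" using \<kappa>(1) by simp
  also have "\<dots> \<le> (2 * \<kappa>)\<^sup>2" by (simp add: power_mult_distrib)
  finally have "euclid_norm (y - c \<cdot>\<^sub>v x) \<le> 2 * \<kappa>" by (rule power2_le_imp_le) (use \<kappa> in simp)
  with c show ?thesis by blast
qed

text \<open>The right vector \<open>y\<close> concentrates on the basis direction
  \<open>v i\<close>, which coincides with \<open>x\<close> up to sign. The left vectors then follow
  by dividing the images by singular values that are at least \<open>\<tau>\<close>, with the same
  sign \<open>c\<close>. Half of the gap \<open>2 * \<eta>\<close> is spent on the shift of the
  singular value, which is at most \<open>\<rho> \<le> \<eta>\<close>.\<close>

theorem sing_vec_pair_perturbation: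
  assumes A: "A \<in> carrier_mat n m" and B: "B \<in> carrier_mat n m" and i: "i < m"
    and pairA: "sing_vec_pair A (Suc i) u x" and pairB: "sing_vec_pair B (Suc i) w y"
    and close: "\<And>x. x \<in> carrier_vec m \<Longrightarrow> euclid_norm (A *\<^sub>v x - B *\<^sub>v x) \<le> \<rho> * euclid_norm x"
    and gap: "\<And>j. j < m \<Longrightarrow> j \<noteq> i \<Longrightarrow> 2 * \<eta> \<le> \<bar>sing_val A (Suc i) - sing_val A (Suc j)\<bar>"
    and pos: "0 < \<eta>" "0 < \<tau>" "\<tau> \<le> sing_val A (Suc i)" "\<tau> \<le> sing_val B (Suc i)"
    and \<rho>: "0 \<le> \<rho>" "\<rho> \<le> \<eta>"
    and \<kappa>: "\<kappa> = 2 * (\<rho> * (sing_val A 1 + sing_val B (Suc i)) / (\<eta> * \<tau>))"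
  shows "\<exists>c. \<bar>c\<bar> = 1 \<and> euclid_norm (y - c \<cdot>\<^sub>v x) \<le> \<kappa> \<and>
    euclid_norm (w - c \<cdot>\<^sub>v u) \<le> (2 * \<rho> + sing_val A 1 * \<kappa>) / \<tau>"
proof -
  define \<sigma> s where "\<sigma> = sing_val A (Suc i)" and "s = sing_val B (Suc i)"
  note x = sing_vec_pair_carrier[OF pairA A] and y = sing_vec_pair_carrier[OF pairB B]
  have \<sigma>1: "0 \<le> sing_val A 1" using sing_val_nonneg[OF A, of 0] i by simp
  have s: "0 < s" "\<tau> \<le> s" "\<bar>\<sigma> - s\<bar> \<le> \<rho>"
    using pos weyl_sing_val[OF A B i close] by (auto simp: s_def \<sigma>_def)
  obtain v where v: "sing_basis A v" using ex_sing_basis[OF A] by blast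
  note vi = sing_basis_carrier[OF A v i]
  have vn: "euclid_norm (v i) = 1"
    using sing_basis_orthonormal[OF A v i i] by (simp add: euclid_norm_eq_1_iff)
  have "\<eta> \<le> \<bar>sing_val A (Suc j) - s\<bar>" "\<eta> \<le> \<bar>sing_val A (Suc j) - \<sigma>\<bar>" if "j < m" "j \<noteq> i" for j
    using gap[OF that] s(3) \<rho> pos(1) by (auto simp: \<sigma>_def)
  note gaps = this[unfolded s_def \<sigma>_def]
  \<comment> \<open>Concentration of \<open>A\<close> against itself with error 0: a separated
    singular direction is unique up to sign, so the given \<open>x\<close> can replace the basis
    vector \<open>v i\<close>.\<close>
  have "1 - (v i \<bullet> x)\<^sup>2 \<le> (0 * (sing_val A 1 + sing_val A (Suc i)) / (\<eta> * \<tau>))\<^sup>2"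
    by (rule sing_vec_concentration[OF A A i v pairA _ gaps(2) pos(1,2,3)])
      simp_all
  then obtain c1 where c1: "\<bar>c1\<bar> = 1" "euclid_norm (x - c1 \<cdot>\<^sub>v v i) \<le> 2 * 0"
    using unit_vec_sign_dist[OF vi x(2) vn x(4), of 0] by auto
  have xc: "x - c1 \<cdot>\<^sub>v v i \<in> carrier_vec m" using x(2) vi by simp
  have "x - c1 \<cdot>\<^sub>v v i = 0\<^sub>v m"
    using c1(2) scalar_prod_self_eq_0_iff[OF xc] scalar_prod_self_nonneg[of "x - c1 \<cdot>\<^sub>v v i"]
    by (simp add: euclid_norm_def)
  have xv: "x = c1 \<cdot>\<^sub>v v i"
  proof (intro eq_vecI)
    fix k assume "k < dim_vec (c1 \<cdot>\<^sub>v v i)"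
    then show "x $ k = (c1 \<cdot>\<^sub>v v i) $ k"
      using arg_cong[OF \<open>x - c1 \<cdot>\<^sub>v v i = 0\<^sub>v m\<close>, of "\<lambda>u. u $ k"] x(2) vi by simp
  qed (use x(2) vi in simp)
  have "1 - (v i \<bullet> y)\<^sup>2 \<le> (\<rho> * (sing_val A 1 + s) / (\<eta> * \<tau>))\<^sup>2"
    unfolding s_def by (rule sing_vec_concentration[OF A B i v pairB close gaps(1) pos(1,2,4) \<rho>(1)])
  moreover have "v i \<bullet> y = c1 * (x \<bullet> y)"
    using xv vi y(2) c1(1) by (auto simp: abs_if split: if_splits)
  then have "(v i \<bullet> y)\<^sup>2 = (x \<bullet> y)\<^sup>2"
    using c1(1) by (simp add: power_mult_distrib) (metis power2_abs power_one mult_1)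
  ultimately have "1 - (x \<bullet> y)\<^sup>2 \<le> (\<rho> * (sing_val A 1 + s) / (\<eta> * \<tau>))\<^sup>2" by simp
  moreover have "0 \<le> \<rho> * (sing_val A 1 + s) / (\<eta> * \<tau>)" using \<rho> pos \<sigma>1 s by simp
  ultimately obtain c where c: "\<bar>c\<bar> = 1" "euclid_norm (y - c \<cdot>\<^sub>v x) \<le> \<kappa>"
    using unit_vec_sign_dist[OF x(2) y(2) x(4) y(4)] unfolding \<kappa> s_def by blast
  have car: "A *\<^sub>v y \<in> carrier_vec n" "B *\<^sub>v y \<in> carrier_vec n" "c \<cdot>\<^sub>v x \<in> carrier_vec m"
    "y - c \<cdot>\<^sub>v x \<in> carrier_vec m"
    using A B x(2) y(2) by auto
  \<comment> \<open>From \<open>B y = s w\<close> and \<open>A x = \<sigma> u\<close>: the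
    difference of left vectors splits into the error of the matrix, the error of the right vector
    and the error of the singular value, bounded by \<open>\<rho>\<close>,
    \<open>sing_val A 1 * \<kappa>\<close> and \<open>\<rho>\<close>.\<close>
  have "s \<cdot>\<^sub>v (w - c \<cdot>\<^sub>v u) = (B *\<^sub>v y - A *\<^sub>v y) + (A *\<^sub>v (y - c \<cdot>\<^sub>v x) + (c * (\<sigma> - s)) \<cdot>\<^sub>v u)"
    unfolding mult_minus_distrib_mat_vec[OF A y(2) car(3)] mult_mat_vec[OF A x(2)] x(5) y(5)
    unfolding s_def[symmetric] \<sigma>_def[symmetric]
    using x(1) y(1) A by (intro eq_vecI) (auto simp: algebra_simps)
  then have "s * euclid_norm (w - c \<cdot>\<^sub>v u) =
      euclid_norm ((B *\<^sub>v y - A *\<^sub>v y) + (A *\<^sub>v (y - c \<cdot>\<^sub>v x) + (c * (\<sigma> - s)) \<cdot>\<^sub>v u))"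
    using euclid_norm_smult[of s "w - c \<cdot>\<^sub>v u"] s(1) by simp
  also have "\<dots> \<le> euclid_norm (B *\<^sub>v y - A *\<^sub>v y)
      + (euclid_norm (A *\<^sub>v (y - c \<cdot>\<^sub>v x)) + euclid_norm ((c * (\<sigma> - s)) \<cdot>\<^sub>v u))"
    using A x(1) car euclid_norm_add_le[of "A *\<^sub>v (y - c \<cdot>\<^sub>v x)" "(c * (\<sigma> - s)) \<cdot>\<^sub>v u"]
    by (intro order_trans[OF euclid_norm_add_le] add_left_mono) auto
  also have "\<dots> \<le> \<rho> + (sing_val A 1 * \<kappa> + \<rho>)"
  proof (intro add_mono)
    show "euclid_norm (B *\<^sub>v y - A *\<^sub>v y) \<le> \<rho>"
      using close[OF y(2)] euclid_norm_minus_commute[of "B *\<^sub>v y" "A *\<^sub>v y"] A B y(4) by simp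
    show "euclid_norm (A *\<^sub>v (y - c \<cdot>\<^sub>v x)) \<le> sing_val A 1 * \<kappa>"
      using euclid_norm_mult_le_sing_val[OF A _ car(4)] mult_left_mono[OF c(2) \<sigma>1] i by fastforce
    show "euclid_norm ((c * (\<sigma> - s)) \<cdot>\<^sub>v u) \<le> \<rho>"
      unfolding euclid_norm_smult x(3) abs_mult c(1) using s(3) by simp
  qed
  finally have "\<tau> * euclid_norm (w - c \<cdot>\<^sub>v u) \<le> 2 * \<rho> + sing_val A 1 * \<kappa>"
    using mult_right_mono[OF s(2) euclid_norm_nonneg[of "w - c \<cdot>\<^sub>v u"]] by simp
  then have "euclid_norm (w - c \<cdot>\<^sub>v u) \<le> (2 * \<rho> + sing_val A 1 * \<kappa>) / \<tau>"
    using pos(2) by (simp add: pos_le_divide_eq mult.commute)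
  with c show ?thesis by blast
qed

section \<open>Line projectors in operator norm\<close>

lemma line_proj_mult_vec:
  assumes "v \<in> carrier_vec n" "x \<in> carrier_vec n"
  shows "line_proj v *\<^sub>v x = (v \<bullet> x) \<cdot>\<^sub>v v"
  using assms by (intro eq_vecI)
    (auto simp: line_proj_def scalar_prod_def sum_distrib_left sum_distrib_right mult_ac)

lemma op_norm_nonneg_and_le:
  assumes A: "A \<in> carrier_mat n m" and "0 \<le> b"
    and le: "\<And>x. x \<in> carrier_vec m \<Longrightarrow> euclid_norm (A *\<^sub>v x) \<le> b * euclid_norm x"
  shows "0 \<le> op_norm A" "op_norm A \<le> b"
proof -
  \<comment> \<open>The supremum also ranges over the zero vector, where the quotient is
    \<open>0 / 0 = 0\<close>. This keeps the bound \<open>b\<close> valid and supplies the element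
    that makes the supremum nonnegative.\<close>
  have quot: "euclid_norm (A *\<^sub>v x) / euclid_norm x \<le> b" if "x \<in> carrier_vec (dim_col A)" for x
    using le[of x] that A \<open>0 \<le> b\<close> by (cases "euclid_norm x = 0") (auto simp: divide_le_eq less_le)
  have "euclid_norm (A *\<^sub>v 0\<^sub>v m) / euclid_norm (0\<^sub>v m) \<le> op_norm A"
    unfolding op_norm_def by (intro cSUP_upper bdd_aboveI2[where M = b] quot) (use A in auto)
  moreover have "euclid_norm (0\<^sub>v m) = 0" by (simp add: euclid_norm_def)
  ultimately show "0 \<le> op_norm A" by simp
  show "op_norm A \<le> b"
    unfolding op_norm_def by (intro cSUP_least quot) (use zero_carrier_vec in blast)
qed

text \<open>With \<open>e = y - c x\<close> and \<open>c * c = 1\<close>, the difference of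
  projectors sends \<open>z\<close> to \<open>(y . z) e + c (e . z) x\<close>. Each term has norm at
  most \<open>\<kappa>\<close> times that of \<open>z\<close>, whichever sign \<open>c\<close>
  is.\<close>

lemma op_norm_line_proj_diff:
  assumes x: "x \<in> carrier_vec n" and y: "y \<in> carrier_vec n"
    and unit: "euclid_norm x = 1" "euclid_norm y = 1" and c: "\<bar>c\<bar> = 1"
    and d: "euclid_norm (y - c \<cdot>\<^sub>v x) \<le> \<kappa>"
  shows "0 \<le> op_norm (line_proj y - line_proj x)" "op_norm (line_proj y - line_proj x) \<le> 2 * \<kappa>"
proof -
  have LP: "line_proj x \<in> carrier_mat n n" "line_proj y \<in> carrier_mat n n"
    using x y by (auto simp: line_proj_def)
  have cc: "c * c = 1" using c by (metis abs_mult_self_eq mult_1)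
  have \<kappa>: "0 \<le> \<kappa>" using order_trans[OF euclid_norm_nonneg d] .
  define e where "e = y - c \<cdot>\<^sub>v x"
  have e: "e \<in> carrier_vec n" using x y by (simp add: e_def)
  have bound: "euclid_norm ((line_proj y - line_proj x) *\<^sub>v z) \<le> (2 * \<kappa>) * euclid_norm z"
    if z: "z \<in> carrier_vec n" for z
  proof -
    have ez: "e \<bullet> z = y \<bullet> z - c * (x \<bullet> z)"
      using x y z minus_scalar_prod_distrib[OF y _ z, of "c \<cdot>\<^sub>v x"] by (simp add: e_def)
    have "(line_proj y - line_proj x) *\<^sub>v z = line_proj y *\<^sub>v z - line_proj x *\<^sub>v z"
      by (rule minus_mult_distrib_mat_vec[OF LP(2,1) z])
    also have "\<dots> = (y \<bullet> z) \<cdot>\<^sub>v e + ((e \<bullet> z) * c) \<cdot>\<^sub>v x"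
      unfolding line_proj_mult_vec[OF x z] line_proj_mult_vec[OF y z] ez
    proof (intro eq_vecI)
      fix k assume "k < dim_vec ((y \<bullet> z) \<cdot>\<^sub>v e + ((y \<bullet> z - c * (x \<bullet> z)) * c) \<cdot>\<^sub>v x)"
      then have "k < n" using x by simp
      moreover have "(x \<bullet> z) * x $ k = (c * c) * ((x \<bullet> z) * x $ k)" unfolding cc by simp
      ultimately show "((y \<bullet> z) \<cdot>\<^sub>v y - (x \<bullet> z) \<cdot>\<^sub>v x) $ k
          = ((y \<bullet> z) \<cdot>\<^sub>v e + ((y \<bullet> z - c * (x \<bullet> z)) * c) \<cdot>\<^sub>v x) $ k"
        using x y e by (simp add: e_def algebra_simps)
    qed (use x y e in simp)
    finally have "euclid_norm ((line_proj y - line_proj x) *\<^sub>v z)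
        \<le> euclid_norm ((y \<bullet> z) \<cdot>\<^sub>v e) + euclid_norm (((e \<bullet> z) * c) \<cdot>\<^sub>v x)"
      using euclid_norm_add_le[of "(y \<bullet> z) \<cdot>\<^sub>v e" "((e \<bullet> z) * c) \<cdot>\<^sub>v x"] x e by simp
    also have "\<dots> = \<bar>y \<bullet> z\<bar> * euclid_norm e + \<bar>e \<bullet> z\<bar>"
      by (simp add: euclid_norm_smult abs_mult c unit)
    also have "\<dots> \<le> euclid_norm z * \<kappa> + \<kappa> * euclid_norm z"
    proof (intro add_mono mult_mono)
      show "\<bar>y \<bullet> z\<bar> \<le> euclid_norm z" using abs_scalar_prod_le[of y z] y z unit by simp
      show "euclid_norm e \<le> \<kappa>" using d by (simp add: e_def)
      have "\<bar>e \<bullet> z\<bar> \<le> euclid_norm e * euclid_norm z" using abs_scalar_prod_le[of e z] e z by simp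
      also have "\<dots> \<le> \<kappa> * euclid_norm z"
        using d by (intro mult_right_mono) (auto simp: e_def)
      finally show "\<bar>e \<bullet> z\<bar> \<le> \<kappa> * euclid_norm z" .
    qed auto
    finally show ?thesis by simp
  qed
  have L: "line_proj y - line_proj x \<in> carrier_mat n n" by (rule minus_carrier_mat[OF LP(1)])
  show "0 \<le> op_norm (line_proj y - line_proj x)" "op_norm (line_proj y - line_proj x) \<le> 2 * \<kappa>"
    using op_norm_nonneg_and_le[OF L _ bound] \<kappa> by auto
qed

text \<open>The perturbation theorem for \<open>A\<close> against itself with error 0: two singular
  pairs differ by a common sign, which the projectors do not see. This is the condition under which
  \<open>is_version\<close> pins down its values.\<close>

lemma sing_proj_unique:
  assumes A: "A \<in> carrier_mat n m" and i: "i < m" and pos: "0 < \<eta>" "0 < sing_val A (Suc i)"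
    and gap: "\<And>j. j < m \<Longrightarrow> j \<noteq> i \<Longrightarrow> \<eta> \<le> \<bar>sing_val A (Suc i) - sing_val A (Suc j)\<bar>"
  shows "\<exists>!Z. left_sing_proj (Suc i) A Z" "\<exists>!Z. right_sing_proj (Suc i) A Z"
proof -
  obtain u x where ux: "sing_vec_pair A (Suc i) u x" using ex_sing_vec_pair[OF A i pos(2)] by blast
  have eq: "line_proj w = line_proj u \<and> line_proj y = line_proj x" if wy: "sing_vec_pair A (Suc i) w y" for w y
  proof -
    have "\<exists>c. \<bar>c\<bar> = 1 \<and> euclid_norm (y - c \<cdot>\<^sub>v x) \<le> 0 \<and>
        euclid_norm (w - c \<cdot>\<^sub>v u) \<le> (2 * 0 + sing_val A 1 * 0) / sing_val A (Suc i)"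
      by (rule sing_vec_pair_perturbation[OF A A i ux wy, of 0 "\<eta> / 2"]) (use pos gap in auto)
    then obtain c where c: "\<bar>c\<bar> = 1" "euclid_norm (y - c \<cdot>\<^sub>v x) \<le> 0" "euclid_norm (w - c \<cdot>\<^sub>v u) \<le> 0"
      by auto
    have cc: "c * c = 1" using c by (metis abs_mult_self_eq mult_1)
    have *: "line_proj b = line_proj a"
      if "a \<in> carrier_vec k" "b \<in> carrier_vec k" "euclid_norm (b - c \<cdot>\<^sub>v a) \<le> 0" for a b k
    proof -
      have car: "b - c \<cdot>\<^sub>v a \<in> carrier_vec k" using that by simp
      have "(b - c \<cdot>\<^sub>v a) \<bullet> (b - c \<cdot>\<^sub>v a) \<le> 0" using that(3) by (simp add: euclid_norm_def)
      then have "(b - c \<cdot>\<^sub>v a) \<bullet> (b - c \<cdot>\<^sub>v a) = 0"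
        using scalar_prod_self_nonneg[of "b - c \<cdot>\<^sub>v a"] by linarith
      then have 0: "b - c \<cdot>\<^sub>v a = 0\<^sub>v k" using scalar_prod_self_eq_0_iff[OF car] by simp
      have "b $ p = c * a $ p" if "p < k" for p
        using arg_cong[OF 0, of "\<lambda>u. u $ p"] \<open>a \<in> _\<close> \<open>b \<in> _\<close> that by simp
      then have "b $ p * b $ q = a $ p * a $ q" if "p < k" "q < k" for p q
        using that cc by (simp add: algebra_simps)
      then show ?thesis unfolding line_proj_def using that by (intro cong_mat) auto
    qed
    show ?thesis
      using * c sing_vec_pair_carrier[OF ux A] sing_vec_pair_carrier[OF wy A] by blast
  qed
  show "\<exists>!Z. left_sing_proj (Suc i) A Z"
    using ux eq unfolding left_sing_proj_def by (intro ex1I[of _ "line_proj u"]) blast+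
  show "\<exists>!Z. right_sing_proj (Suc i) A Z"
    using ux eq unfolding right_sing_proj_def by (intro ex1I[of _ "line_proj x"]) blast+
qed

section \<open>Convergence in probability\<close>

lemma vanishing_prob_mono:
  assumes "vanishing_prob F M Q" "\<forall>\<^sub>F n in F. \<forall>\<omega> \<in> space (M n). P n \<omega> \<longrightarrow> Q n \<omega>"
  shows "vanishing_prob F M P"
proof -
  obtain B where B: "\<And>n. B n \<in> sets (M n)" "\<And>n. {\<omega> \<in> space (M n). Q n \<omega>} \<subseteq> B n"
    and lim: "((\<lambda>n. measure (M n) (B n)) \<longlongrightarrow> 0) F"
    using assms(1) unfolding vanishing_prob_def by blast
  \<comment> \<open>A hull is demanded for every index, while the implication may hold only
    eventually. At the remaining indices the whole space is used, without effect on the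
    limit.\<close>
  define B' where "B' n = (if \<forall>\<omega> \<in> space (M n). P n \<omega> \<longrightarrow> Q n \<omega> then B n else space (M n))" for n
  have "\<forall>\<^sub>F n in F. measure (M n) (B n) = measure (M n) (B' n)"
    using assms(2) by eventually_elim (simp add: B'_def)
  then have "((\<lambda>n. measure (M n) (B' n)) \<longlongrightarrow> 0) F"
    by (rule Lim_transform_eventually[OF lim])
  moreover have "B' n \<in> sets (M n) \<and> {\<omega> \<in> space (M n). P n \<omega>} \<subseteq> B' n" for n
    using B[of n] by (auto simp: B'_def)
  ultimately show ?thesis unfolding vanishing_prob_def by blast
qed

lemma vanishing_prob_disj:
  assumes "vanishing_prob F M P" "vanishing_prob F M Q"
  shows "vanishing_prob F M (\<lambda>n \<omega>. P n \<omega> \<or> Q n \<omega>)"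
proof -
  obtain A where A: "\<And>n. A n \<in> sets (M n)" "\<And>n. {\<omega> \<in> space (M n). P n \<omega>} \<subseteq> A n"
    and limA: "((\<lambda>n. measure (M n) (A n)) \<longlongrightarrow> 0) F"
    using assms(1) unfolding vanishing_prob_def by blast
  obtain B where B: "\<And>n. B n \<in> sets (M n)" "\<And>n. {\<omega> \<in> space (M n). Q n \<omega>} \<subseteq> B n"
    and limB: "((\<lambda>n. measure (M n) (B n)) \<longlongrightarrow> 0) F"
    using assms(2) unfolding vanishing_prob_def by blast
  have "((\<lambda>n. measure (M n) (A n \<union> B n)) \<longlongrightarrow> 0) F"
  proof (rule tendsto_sandwich[of "\<lambda>_. 0"])
    show "((\<lambda>n. measure (M n) (A n) + measure (M n) (B n)) \<longlongrightarrow> 0) F"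
      using tendsto_add[OF limA limB] by simp
    show "\<forall>\<^sub>F n in F. measure (M n) (A n \<union> B n) \<le> measure (M n) (A n) + measure (M n) (B n)"
      by (intro always_eventually allI measure_Un_le A B)
  qed simp_all
  moreover have "A n \<union> B n \<in> sets (M n) \<and> {\<omega> \<in> space (M n). P n \<omega> \<or> Q n \<omega>} \<subseteq> A n \<union> B n" for n
    using A[of n] B[of n] by auto
  ultimately show ?thesis unfolding vanishing_prob_def by (intro exI[of _ "\<lambda>n. A n \<union> B n"]) blast
qed

lemma prob_to_one_mono:
  assumes "prob_to_one F M Q" "\<forall>\<^sub>F n in F. \<forall>\<omega> \<in> space (M n). Q n \<omega> \<longrightarrow> P n \<omega>"
  shows "prob_to_one F M P"
  using assms(1) unfolding prob_to_one_def
  by (rule vanishing_prob_mono) (use assms(2) in \<open>auto elim: eventually_mono\<close>)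

lemma prob_to_one_conj:
  assumes "prob_to_one F M P" "prob_to_one F M Q"
  shows "prob_to_one F M (\<lambda>n \<omega>. P n \<omega> \<and> Q n \<omega>)"
  using vanishing_prob_disj[OF assms[unfolded prob_to_one_def]] unfolding prob_to_one_def by simp

lemma prob_to_one_always: "prob_to_one F M (\<lambda>n \<omega>. True)"
  unfolding prob_to_one_def vanishing_prob_def by (intro exI[of _ "\<lambda>_. {}"]) simp

lemma prob_to_one_ball:
  assumes "finite T" "\<And>s. s \<in> T \<Longrightarrow> prob_to_one F M (P s)"
  shows "prob_to_one F M (\<lambda>n \<omega>. \<forall>s\<in>T. P s n \<omega>)"
  using assms
proof (induction T)
  case empty
  then show ?case by (simp add: prob_to_one_always)
next
  case (insert s T)
  then have "prob_to_one F M (\<lambda>n \<omega>. P s n \<omega> \<and> (\<forall>s\<in>T. P s n \<omega>))"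
    by (intro prob_to_one_conj) auto
  then show ?case by simp
qed

lemma tendsto_in_prob_iff_prob_to_one:
  "tendsto_in_prob F M Y c \<longleftrightarrow> (\<forall>e>0. prob_to_one F M (\<lambda>n \<omega>. \<bar>Y n \<omega> - c\<bar> \<le> e))"
  by (simp add: tendsto_in_prob_def prob_to_one_def not_le)

lemma tendsto_in_probD:
  "tendsto_in_prob F M Y c \<Longrightarrow> 0 < e \<Longrightarrow> prob_to_one F M (\<lambda>n \<omega>. \<bar>Y n \<omega> - c\<bar> \<le> e)"
  by (simp add: tendsto_in_prob_iff_prob_to_one)

text \<open>A superset \<open>A n\<close> of the good event and a hull of the bad event together
  cover the space. Hence the probability of \<open>A n\<close> is at least one minus that of the
  hull, and only \<open>A n\<close> has to be measurable.\<close>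

lemma prob_to_one_eventually_measure_gt:
  assumes "\<And>n. prob_space (M n)" "prob_to_one F M P" "c < 1"
    "\<forall>\<^sub>F n in F. A n \<in> sets (M n) \<and> {\<omega> \<in> space (M n). P n \<omega>} \<subseteq> A n"
  shows "\<forall>\<^sub>F n in F. c < measure (M n) (A n)"
proof -
  obtain B where B: "\<And>n. B n \<in> sets (M n)" "\<And>n. {\<omega> \<in> space (M n). \<not> P n \<omega>} \<subseteq> B n"
    and lim: "((\<lambda>n. measure (M n) (B n)) \<longlongrightarrow> 0) F"
    using assms(2) unfolding prob_to_one_def vanishing_prob_def by blast
  have "\<forall>\<^sub>F n in F. measure (M n) (B n) < 1 - c"
    using lim by (rule order_tendstoD) (use assms(3) in simp)
  with assms(4) show ?thesis
  proof eventually_elim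
    case (elim n)
    interpret prob_space "M n" by (rule assms)
    have A: "A n \<in> events" using elim by simp
    have "space (M n) \<subseteq> A n \<union> B n" using elim B(2)[of n] by auto
    from finite_measure_mono[OF this sets.Un[OF A B(1)]]
    have "1 \<le> prob (A n \<union> B n)" by (simp add: prob_space)
    also have "\<dots> \<le> prob (A n) + prob (B n)" by (intro measure_Un_le A B(1))
    finally show ?case using elim by simp
  qed
qed

section \<open>Small balls for Gaussian vectors\<close>

lemma prob_space_normal_law: "0 \<le> var \<Longrightarrow> prob_space (normal_law mu var)"
  by (auto simp: normal_law_def intro!: prob_space_normal_density prob_space_return)

lemma sets_normal_law [measurable_cong]: "sets (normal_law mu var) = sets borel"
  by (simp add: normal_law_def)

text \<open>The factor adds \<open>1 / var\<close> to \<open>1 / (2 * var)\<close> in the exponent,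
  so the integrand is an unnormalised Gaussian density of variance \<open>var / 3\<close>; the root
  of 3 is the ratio of the normalising constants.\<close>

lemma nn_integral_normal_law_exp:
  assumes "0 < var"
  shows "(\<integral>\<^sup>+x. ennreal (exp (- x\<^sup>2 / var)) \<partial>normal_law 0 var) = ennreal (1 / sqrt 3)"
proof -
  have eq: "normal_density 0 (sqrt var) x * exp (- x\<^sup>2 / var)
      = 1 / sqrt 3 * normal_density 0 (sqrt (var / 3)) x" for x
  proof -
    have "sqrt (2 * pi * var) = sqrt 3 * sqrt (2 * pi * (var / 3))"
      by (simp add: real_sqrt_mult[symmetric])
    moreover have "- x\<^sup>2 / (2 * var) + - x\<^sup>2 / var = - x\<^sup>2 / (2 * (var / 3))"
      using assms by (simp add: field_simps)
    then have "exp (- x\<^sup>2 / (2 * var)) * exp (- x\<^sup>2 / var) = exp (- x\<^sup>2 / (2 * (var / 3)))"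
      by (metis exp_add)
    ultimately show ?thesis using assms by (simp add: normal_density_def)
  qed
  have "(\<integral>\<^sup>+x. ennreal (exp (- x\<^sup>2 / var)) \<partial>normal_law 0 var)
      = (\<integral>\<^sup>+x. ennreal (normal_density 0 (sqrt var) x) * ennreal (exp (- x\<^sup>2 / var)) \<partial>lborel)"
    using assms by (simp add: normal_law_def nn_integral_density)
  also have "\<dots> = (\<integral>\<^sup>+x. ennreal (1 / sqrt 3) * ennreal (normal_density 0 (sqrt (var / 3)) x) \<partial>lborel)"
  proof (intro nn_integral_cong)
    fix x :: real
    have "ennreal (normal_density 0 (sqrt var) x) * ennreal (exp (- x\<^sup>2 / var))
        = ennreal (1 / sqrt 3 * normal_density 0 (sqrt (var / 3)) x)"
      unfolding eq[symmetric] by (rule ennreal_mult[symmetric]) simp_all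
    also have "\<dots> = ennreal (1 / sqrt 3) * ennreal (normal_density 0 (sqrt (var / 3)) x)"
      by (rule ennreal_mult) simp_all
    finally show "ennreal (normal_density 0 (sqrt var) x) * ennreal (exp (- x\<^sup>2 / var))
        = ennreal (1 / sqrt 3) * ennreal (normal_density 0 (sqrt (var / 3)) x)" .
  qed
  also have "\<dots> = ennreal (1 / sqrt 3) * (\<integral>\<^sup>+x. ennreal (normal_density 0 (sqrt (var / 3)) x) \<partial>lborel)"
    by (rule nn_integral_cmult) simp
  also have "(\<integral>\<^sup>+x. ennreal (normal_density 0 (sqrt (var / 3)) x) \<partial>lborel) = 1"
    using prob_space.emeasure_space_1[OF prob_space_normal_density[of "sqrt (var / 3)" 0]] assms
    by (simp add: emeasure_density)
  finally show ?thesis by simp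
qed

text \<open>Probabilities of boxes determine the joint law as the product measure. The exponential
  of a sum then integrates to a product of equal one-dimensional integrals.\<close>

lemma nn_integral_exp_sum_squares_gaussian:
  assumes M: "prob_space M" and var: "0 < var" and I: "finite I"
    and Z: "\<And>p. p \<in> I \<Longrightarrow> Z p \<in> borel_measurable M"
    and law: "\<And>B. (\<And>p. p \<in> I \<Longrightarrow> B p \<in> sets (borel :: real measure)) \<Longrightarrow>
      measure M {\<omega> \<in> space M. \<forall>p\<in>I. Z p \<omega> \<in> B p} = (\<Prod>p\<in>I. measure (normal_law 0 var) (B p))"
  shows "(\<integral>\<^sup>+\<omega>. ennreal (exp (- (\<Sum>p\<in>I. (Z p \<omega>)\<^sup>2) / var)) \<partial>M) = ennreal ((1 / sqrt 3) ^ card I)"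
proof -
  interpret prob_space M by (rule M)
  let ?L = "normal_law 0 var"
  interpret L: prob_space ?L using var by (intro prob_space_normal_law) simp
  interpret P: product_prob_space "\<lambda>_. ?L" ..
  have spL: "space ?L = UNIV" using sets_eq_imp_space_eq[OF sets_normal_law] by simp
  define X where "X = (\<lambda>\<omega>. \<lambda>p\<in>I. Z p \<omega>)"
  have X_apply: "X \<omega> p = Z p \<omega>" if "p \<in> I" for \<omega> p using that by (simp add: X_def)
  have X: "X \<in> measurable M (Pi\<^sub>M I (\<lambda>_. ?L))"
    unfolding X_def using Z by (intro measurable_restrict) (simp add: measurable_cong_sets[OF refl sets_normal_law])
  have "distr M (Pi\<^sub>M I (\<lambda>_. ?L)) X = Pi\<^sub>M I (\<lambda>_. ?L)"
  proof (rule P.PiM_eqI[OF I])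
    fix A assume A: "\<And>p. p \<in> I \<Longrightarrow> A p \<in> sets ?L"
    have "emeasure (distr M (Pi\<^sub>M I (\<lambda>_. ?L)) X) (Pi\<^sub>E I A) = emeasure M (X -` Pi\<^sub>E I A \<inter> space M)"
      using A I by (intro emeasure_distr X sets_PiM_I_finite) auto
    also have "X -` Pi\<^sub>E I A \<inter> space M = {\<omega> \<in> space M. \<forall>p\<in>I. Z p \<omega> \<in> A p}"
      by (auto simp: PiE_iff X_def)
    also have "emeasure M \<dots> = ennreal (\<Prod>p\<in>I. measure ?L (A p))"
      unfolding emeasure_eq_measure using A by (subst law) (auto simp: sets_normal_law)
    finally show "emeasure (distr M (Pi\<^sub>M I (\<lambda>_. ?L)) X) (Pi\<^sub>E I A) = (\<Prod>p\<in>I. emeasure ?L (A p))"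
      by (simp add: L.emeasure_eq_measure prod_ennreal)
  qed simp
  note distr = this
  have "(\<lambda>x. \<Prod>p\<in>I. ennreal (exp (- (x p)\<^sup>2 / var))) \<in> borel_measurable (Pi\<^sub>M I (\<lambda>_. ?L))"
  proof (rule borel_measurable_prod_ennreal)
    fix p assume "p \<in> I"
    then have [measurable]: "(\<lambda>x. x p) \<in> borel_measurable (Pi\<^sub>M I (\<lambda>_. ?L))"
      using measurable_component_singleton[of p I "\<lambda>_. ?L"]
      by (simp add: measurable_cong_sets[OF refl sets_normal_law])
    show "(\<lambda>x. ennreal (exp (- (x p)\<^sup>2 / var))) \<in> borel_measurable (Pi\<^sub>M I (\<lambda>_. ?L))"
      by measurable
  qed
  note meas = this
  have "(\<integral>\<^sup>+\<omega>. ennreal (exp (- (\<Sum>p\<in>I. (Z p \<omega>)\<^sup>2) / var)) \<partial>M)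
      = (\<integral>\<^sup>+\<omega>. (\<Prod>p\<in>I. ennreal (exp (- (X \<omega> p)\<^sup>2 / var))) \<partial>M)"
  proof (intro nn_integral_cong)
    fix \<omega>
    have "- (\<Sum>p\<in>I. (Z p \<omega>)\<^sup>2) / var = (\<Sum>p\<in>I. - (X \<omega> p)\<^sup>2 / var)"
      by (simp add: sum_divide_distrib sum_negf X_apply)
    then show "ennreal (exp (- (\<Sum>p\<in>I. (Z p \<omega>)\<^sup>2) / var)) = (\<Prod>p\<in>I. ennreal (exp (- (X \<omega> p)\<^sup>2 / var)))"
      using I by (simp add: exp_sum prod_ennreal)
  qed
  also have "\<dots> = (\<integral>\<^sup>+x. (\<Prod>p\<in>I. ennreal (exp (- (x p)\<^sup>2 / var))) \<partial>distr M (Pi\<^sub>M I (\<lambda>_. ?L)) X)"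
    using meas by (subst nn_integral_distr[OF X]) simp_all
  also have "\<dots> = (\<Prod>p\<in>I. \<integral>\<^sup>+x. ennreal (exp (- x\<^sup>2 / var)) \<partial>?L)"
    unfolding distr by (rule P.product_nn_integral_prod[OF I]) measurable
  also have "\<dots> = ennreal ((1 / sqrt 3) ^ card I)"
    unfolding nn_integral_normal_law_exp[OF var] by (simp add: ennreal_power)
  finally show ?thesis .
qed

text \<open>Markov's inequality for the exponential of minus the sum of squares divided by
  \<open>var\<close>.\<close>

lemma gaussian_small_ball:
  assumes M: "prob_space M" and var: "0 < var" and I: "finite I"
    and Z: "\<And>p. p \<in> I \<Longrightarrow> Z p \<in> borel_measurable M"
    and law: "\<And>B. (\<And>p. p \<in> I \<Longrightarrow> B p \<in> sets (borel :: real measure)) \<Longrightarrow>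
      measure M {\<omega> \<in> space M. \<forall>p\<in>I. Z p \<omega> \<in> B p} = (\<Prod>p\<in>I. measure (normal_law 0 var) (B p))"
  shows "measure M {\<omega> \<in> space M. (\<Sum>p\<in>I. (Z p \<omega>)\<^sup>2) \<le> e} \<le> exp (e / var) * (1 / sqrt 3) ^ card I"
proof -
  interpret prob_space M by (rule M)
  let ?S = "\<lambda>\<omega>. \<Sum>p\<in>I. (Z p \<omega>)\<^sup>2"
  let ?A = "{\<omega> \<in> space M. ?S \<omega> \<le> e}"
  have S: "?S \<in> borel_measurable M" using Z by (intro borel_measurable_sum) simp
  then have A: "?A \<in> sets M" by measurable
  have "ennreal (exp (- e / var) * measure M ?A) = (\<integral>\<^sup>+\<omega>. ennreal (exp (- e / var)) * indicator ?A \<omega> \<partial>M)"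
    using A by (simp add: nn_integral_cmult_indicator emeasure_eq_measure ennreal_mult)
  also have "\<dots> \<le> (\<integral>\<^sup>+\<omega>. ennreal (exp (- ?S \<omega> / var)) \<partial>M)"
    using var by (intro nn_integral_mono) (auto simp: indicator_def divide_right_mono intro!: ennreal_leI)
  also have "\<dots> = ennreal ((1 / sqrt 3) ^ card I)"
    by (rule nn_integral_exp_sum_squares_gaussian[OF assms])
  finally have "exp (- e / var) * measure M ?A \<le> (1 / sqrt 3) ^ card I" by simp
  then have "exp (e / var) * (exp (- e / var) * measure M ?A) \<le> exp (e / var) * (1 / sqrt 3) ^ card I"
    by (rule mult_left_mono) simp
  then show ?thesis by (simp add: mult.assoc[symmetric] exp_add[symmetric])
qed

section \<open>From conditional to unconditional probabilities\<close>

lemma (in prob_space) integral_cond_prob_given: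
  assumes "subalgebra M F" "A \<in> sets M"
  shows "integrable M (cond_prob_given M F A)" "(\<integral>\<omega>. cond_prob_given M F A \<omega> \<partial>M) = prob A"
proof -
  interpret finite_measure_subalgebra M F by unfold_locales (rule assms)
  have "integrable M (indicator A :: 'a \<Rightarrow> real)"
    by (rule integrable_real_indicator) (use assms in \<open>auto simp: emeasure_eq_measure\<close>)
  from real_cond_exp_int[OF this] assms(2)
  show "integrable M (cond_prob_given M F A)" "(\<integral>\<omega>. cond_prob_given M F A \<omega> \<partial>M) = prob A"
    by (simp_all add: cond_prob_given_def[abs_def])
qed

text \<open>Tower property: an almost surely constant conditional probability equals the
  unconditional one. It turns the conditional Gaussian law of \<open>R\<close> into its law.\<close>

lemma (in prob_space) prob_eq_cond_prob_given:
  assumes "subalgebra M F" "A \<in> sets M" "AE \<omega> in M. cond_prob_given M F A \<omega> = c"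
  shows "prob A = c"
proof -
  have "prob A = (\<integral>\<omega>. cond_prob_given M F A \<omega> \<partial>M)" by (simp add: integral_cond_prob_given assms)
  also have "\<dots> = (\<integral>\<omega>. c \<partial>M)"
    using assms integral_cond_prob_given(1)[OF assms(1,2)]
    by (intro integral_cong_AE) (auto dest: borel_measurable_integrable)
  finally show ?thesis by (simp add: prob_space)
qed

lemma (in prob_space) prob_le_cond_prob_given:
  assumes "subalgebra M F" "A \<in> sets M" "AE \<omega> in M. cond_prob_given M F A \<omega> \<le> c"
  shows "prob A \<le> c"
proof -
  have "prob A = (\<integral>\<omega>. cond_prob_given M F A \<omega> \<partial>M)" by (simp add: integral_cond_prob_given assms)
  also have "\<dots> \<le> (\<integral>\<omega>. c \<partial>M)"
    using assms integral_cond_prob_given(1)[OF assms(1,2)] by (intro integral_mono_AE) auto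
  finally show ?thesis by (simp add: prob_space)
qed

section \<open>The Gaussian part of the limit layer vanishes\<close>

lemma max_norm_nonneg: "0 \<le> max_norm v"
  unfolding max_norm_def by (intro Max_ge) auto

lemma abs_index_le_max_norm: "i < dim_vec v \<Longrightarrow> \<bar>v $ i\<bar> \<le> max_norm v"
  unfolding max_norm_def by (intro Max_ge) auto

lemma max_norm_le_iff:
  assumes "0 \<le> b"
  shows "max_norm v \<le> b \<longleftrightarrow> (\<forall>i<dim_vec v. \<bar>v $ i\<bar> \<le> b)"
  unfolding max_norm_def using assms by (subst Max_le_iff) auto

lemma max_norm_smult_le: "max_norm (c \<cdot>\<^sub>v v) \<le> \<bar>c\<bar> * max_norm v"
  by (subst max_norm_le_iff)
    (auto simp: max_norm_nonneg abs_mult intro!: mult_left_mono abs_index_le_max_norm)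

text \<open>Finiteness is essential, since \<open>enn2real\<close> maps infinity to 0. Equal
  arguments are excluded from the supremum and treated separately.\<close>

lemma max_norm_lipschitz_bound:
  assumes fin: "max_norm_lipschitz \<psi> U < \<infinity>" and U: "v \<in> U" "w \<in> U"
    and car: "v \<in> carrier_vec n" "w \<in> carrier_vec n"
  shows "max_norm (\<psi> v - \<psi> w) \<le> enn2real (max_norm_lipschitz \<psi> U) * max_norm (v - w)"
proof (cases "v = w")
  case True
  have "max_norm (\<psi> w - \<psi> w) \<le> 0" by (subst max_norm_le_iff) auto
  then show ?thesis using True by (simp add: max_norm_nonneg order_trans)
next
  case False
  obtain i where i: "i < n" "v $ i \<noteq> w $ i" using False car by (auto simp: vec_eq_iff)
  have "0 < \<bar>(v - w) $ i\<bar>" using i car by simp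
  also have "\<dots> \<le> max_norm (v - w)" using i car by (intro abs_index_le_max_norm) simp
  finally have pos: "0 < max_norm (v - w)" .
  have "ennreal (max_norm (\<psi> v - \<psi> w) / max_norm (v - w)) \<le> max_norm_lipschitz \<psi> U"
    unfolding max_norm_lipschitz_def using U False by (intro SUP_upper2[of "(v, w)"]) auto
  also have "\<dots> = ennreal (enn2real (max_norm_lipschitz \<psi> U))" using fin by simp
  finally have "max_norm (\<psi> v - \<psi> w) / max_norm (v - w) \<le> enn2real (max_norm_lipschitz \<psi> U)"
    by (subst (asm) ennreal_le_iff) auto
  then show ?thesis using pos by (simp add: pos_divide_le_eq)
qed

text \<open>The log-probability is a coordinate minus the logarithm of the sum of exponentials. Both
  are 1-Lipschitz in the maximum norm, which explains the 2.\<close>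

lemma ln_softmax_lipschitz:
  assumes v: "v \<in> carrier_vec K" and w: "w \<in> carrier_vec K" and c: "c < K"
  shows "\<bar>ln (softmax v $ c) - ln (softmax w $ c)\<bar> \<le> 2 * max_norm (v - w)"
proof -
  define Z where "Z u = (\<Sum>j<K. exp (u $ j))" for u :: "real vec"
  have Zpos: "0 < Z u" for u using c unfolding Z_def by (intro sum_pos) auto
  have ln: "ln (softmax u $ c) = u $ c - ln (Z u)" if "u \<in> carrier_vec K" for u
    using that c Zpos[of u] by (simp add: softmax_def ln_div Z_def)
  have comp: "\<bar>v $ j - w $ j\<bar> \<le> max_norm (v - w)" if "j < K" for j
    using abs_index_le_max_norm[of j "v - w"] v w that by simp
  have le: "ln (Z a) \<le> max_norm (v - w) + ln (Z b)"
    if "\<And>j. j < K \<Longrightarrow> a $ j \<le> max_norm (v - w) + b $ j" for a b :: "real vec"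
  proof -
    have "Z a \<le> exp (max_norm (v - w)) * Z b"
      unfolding Z_def sum_distrib_left exp_add[symmetric] using that by (intro sum_mono) auto
    then have "ln (Z a) \<le> ln (exp (max_norm (v - w)) * Z b)" using Zpos by (subst ln_le_cancel_iff) auto
    then show ?thesis using Zpos[of b] by (simp add: ln_mult)
  qed
  have "ln (Z v) \<le> max_norm (v - w) + ln (Z w)" "ln (Z w) \<le> max_norm (v - w) + ln (Z v)"
    by (rule le, use comp in fastforce)+
  then show ?thesis using comp[OF c] unfolding ln[OF v] ln[OF w] by linarith
qed

lemma frob_inner_interp:
  assumes S: "S \<in> carrier_mat n m" and R: "R \<in> carrier_mat n m"
  shows "frob_inner (interp S R \<theta>) (interp S R \<theta>) =
    frob_inner S S + 2 * \<theta> * frob_inner S R + \<theta>\<^sup>2 * frob_inner R R"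
proof -
  have "frob_inner (interp S R \<theta>) (interp S R \<theta>) =
      (\<Sum>i<n. \<Sum>j<m. S $$ (i, j) * S $$ (i, j) + 2 * \<theta> * (S $$ (i, j) * R $$ (i, j))
        + \<theta>\<^sup>2 * (R $$ (i, j) * R $$ (i, j)))"
    using S R unfolding frob_inner_def
    by (intro sum.cong) (auto simp: interp_def power2_eq_square algebra_simps)
  also have "\<dots> = frob_inner S S + 2 * \<theta> * frob_inner S R + \<theta>\<^sup>2 * frob_inner R R"
    using S R by (simp add: frob_inner_def sum.distrib sum_distrib_left)
  finally show ?thesis .
qed

lemma interp_1:
  assumes "S \<in> carrier_mat n m" "R \<in> carrier_mat n m"
  shows "interp S R 1 = S + R"
  using assms unfolding interp_def by (intro eq_matI) auto

text \<open>In the penalty every summand except list index 1 cancels. The logarithms for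
  \<open>B\<close> carry the plus sign because of the minus in front of the data term.\<close>

lemma loss_set_W2_diff:
  assumes "2 \<le> length (weights a)"
  shows "loss X T C lam (set_W2 a A) - loss X T C lam (set_W2 a B) =
    1 / real (card T) * (\<Sum>s\<in>T. ln (softmax (X s (set_W2 a B)) $ (C s - 1))
      - ln (softmax (X s (set_W2 a A)) $ (C s - 1)))
    + lam * (frob_inner A A - frob_inner B B)"
proof -
  have W: "(\<Sum>l<length (weights (set_W2 a E)). (frob_norm (weights (set_W2 a E) ! l))\<^sup>2) =
      frob_inner E E + (\<Sum>l\<in>{..<length (weights a)} - {1}. (frob_norm (weights a ! l))\<^sup>2)" for E
  proof -
    have "(\<Sum>l<length (weights (set_W2 a E)). (frob_norm (weights (set_W2 a E) ! l))\<^sup>2) =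
        (frob_norm E)\<^sup>2 + (\<Sum>l\<in>{..<length (weights a)} - {1}. (frob_norm ((weights a)[1 := E] ! l))\<^sup>2)"
      using assms by (subst sum.remove[of _ 1]) (auto simp: set_W2_def)
    also have "(\<Sum>l\<in>{..<length (weights a)} - {1}. (frob_norm ((weights a)[1 := E] ! l))\<^sup>2)
        = (\<Sum>l\<in>{..<length (weights a)} - {1}. (frob_norm (weights a ! l))\<^sup>2)"
      by (intro sum.cong) auto
    finally show ?thesis by (simp add: frob_norm_power2)
  qed
  show ?thesis unfolding loss_def W by (simp add: sum_subtractf algebra_simps)
qed

section \<open>Energy balance at the limit layer\<close>

context gaussian_limit_layer
begin

lemma length_weights:
  assumes "1 \<le> N" "\<omega> \<in> space (M N)"
  shows "2 \<le> length (weights (\<alpha>s N \<omega>))"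
  using limit[OF assms(1)] shapes[OF assms(1)] assms(2) by (auto simp: random_params_def param_space_def)

text \<open>This brings \<open>\<alpha>s\<close> itself into the interpolation family, so that both
  losses in the difference quotient are covered by \<open>factorization\<close> and
  \<open>loss_set_W2_diff\<close>.\<close>

lemma set_W2_interp_1:
  assumes N: "1 \<le> N" and \<omega>: "\<omega> \<in> space (M N)"
  shows "set_W2 (\<alpha>s N \<omega>) (interp (S N \<omega>) (R N \<omega>) 1) = \<alpha>s N \<omega>"
  unfolding set_W2_def interp_1[OF S_carrier[OF assms] R_carrier[OF assms]]
    decomposition[OF assms, symmetric] W2_def by (simp add: list_update_id)

lemma loss_quotient_le:
  assumes N: "1 \<le> N" and \<omega>: "\<omega> \<in> space (M N)" and h: "0 < h" "h \<le> 1"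
    and small: "\<And>s. s \<in> T \<Longrightarrow> max_norm (R N \<omega> *\<^sub>v \<psi>\<^sub>1 N \<omega> s) \<le> d\<^sub>1 N * J (\<psi>\<^sub>1 N \<omega> s)"
    and a: "\<And>s. s \<in> T \<Longrightarrow>
      J (\<psi>\<^sub>1 N \<omega> s) * enn2real (max_norm_lipschitz (\<psi>\<^sub>2 N \<omega>) (U N \<omega> s)) * d\<^sub>1 N \<le> e"
  shows "(loss (X N) T C lam (set_W2 (\<alpha>s N \<omega>) (interp (S N \<omega>) (R N \<omega>) (1 - h)))
      - loss (X N) T C lam (\<alpha>s N \<omega>)) / h
    \<le> 2 * e - 2 * lam * frob_inner (S N \<omega>) (R N \<omega>) - lam * frob_inner (R N \<omega>) (R N \<omega>)"
proof -
  note SR = S_carrier[OF N \<omega>] R_carrier[OF N \<omega>]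
  let ?I = "\<lambda>\<theta>. interp (S N \<omega>) (R N \<omega>) \<theta>"
  let ?D = "\<lambda>s. ln (softmax (X N s (set_W2 (\<alpha>s N \<omega>) (?I 1))) $ (C s - 1))
      - ln (softmax (X N s (set_W2 (\<alpha>s N \<omega>) (?I (1 - h)))) $ (C s - 1))"
  have D: "?D s \<le> 2 * e * h" if s: "s \<in> T" for s
  proof -
    let ?p = "\<psi>\<^sub>1 N \<omega> s" and ?L = "enn2real (max_norm_lipschitz (\<psi>\<^sub>2 N \<omega>) (U N \<omega> s))"
    let ?v = "?I 1 *\<^sub>v ?p" and ?w = "?I (1 - h) *\<^sub>v ?p"
    have \<theta>: "(1::real) \<in> {0..1}" "1 - h \<in> {0..1}" using h by auto
    have p: "?p \<in> carrier_vec N" by (rule psi1_carrier[OF N \<omega>])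
    have U: "?v \<in> U N \<omega> s" "?w \<in> U N \<omega> s" using U_segment[OF N \<omega> s] \<theta> by auto
    then have car: "?v \<in> carrier_vec N" "?w \<in> carrier_vec N" using U_carrier[OF N \<omega> s] by auto
    have I: "?I \<theta> \<in> carrier_mat N N" for \<theta> using SR by (simp add: interp_def)
    \<comment> \<open>The two inputs of \<open>\<psi>\<^sub>2\<close> differ by \<open>h\<close>
      times \<open>R\<close> applied to \<open>\<psi>\<^sub>1\<close>; both lie in the set on which
      \<open>\<psi>\<^sub>2\<close> is Lipschitz.\<close>
    have "?v - ?w = (?I 1 - ?I (1 - h)) *\<^sub>v ?p"
      by (rule minus_mult_distrib_mat_vec[OF I I p, symmetric])
    also have "?I 1 - ?I (1 - h) = h \<cdot>\<^sub>m R N \<omega>"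
      using SR unfolding interp_def by (intro eq_matI) (auto simp: algebra_simps)
    also have "(h \<cdot>\<^sub>m R N \<omega>) *\<^sub>v ?p = h \<cdot>\<^sub>v (R N \<omega> *\<^sub>v ?p)"
      using SR p by (intro eq_vecI) auto
    finally have vw: "?v - ?w = h \<cdot>\<^sub>v (R N \<omega> *\<^sub>v ?p)" .
    \<comment> \<open>Classes run from 1 to \<open>K\<close>, so the truncated subtraction gives a
      valid vector index.\<close>
    have "C s - 1 < K" using training_set(3)[OF s] by auto
    then have "?D s \<le> 2 * max_norm (\<psi>\<^sub>2 N \<omega> ?v - \<psi>\<^sub>2 N \<omega> ?w)"
      unfolding factorization[OF N \<omega> \<theta>(1)] factorization[OF N \<omega> \<theta>(2)]
      using ln_softmax_lipschitz[OF psi2_carrier[OF N \<omega> car(1)] psi2_carrier[OF N \<omega> car(2)]]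
      by fastforce
    also have "max_norm (\<psi>\<^sub>2 N \<omega> ?v - \<psi>\<^sub>2 N \<omega> ?w) \<le> ?L * max_norm (?v - ?w)"
      by (rule max_norm_lipschitz_bound[OF U_lipschitz[OF N \<omega> s] U car])
    also have "max_norm (?v - ?w) \<le> h * (d\<^sub>1 N * J ?p)"
      unfolding vw using h small[OF s]
      by (intro order_trans[OF max_norm_smult_le]) (simp add: mult_left_mono)
    also have "2 * (?L * (h * (d\<^sub>1 N * J ?p))) = 2 * (J ?p * ?L * d\<^sub>1 N) * h" by simp
    also have "\<dots> \<le> 2 * e * h" using a[OF s] h by (intro mult_right_mono mult_left_mono) auto
    finally show ?thesis by (simp add: mult_left_mono)
  qed
  have "loss (X N) T C lam (set_W2 (\<alpha>s N \<omega>) (?I (1 - h))) - loss (X N) T C lam (\<alpha>s N \<omega>)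
      = 1 / real (card T) * (\<Sum>s\<in>T. ?D s)
        + lam * (frob_inner (?I (1 - h)) (?I (1 - h)) - frob_inner (?I 1) (?I 1))"
    using loss_set_W2_diff[OF length_weights[OF N \<omega>], of "X N" T C lam "?I (1 - h)" "?I 1"]
      set_W2_interp_1[OF N \<omega>] by simp
  also have "1 / real (card T) * (\<Sum>s\<in>T. ?D s) \<le> 1 / real (card T) * (real (card T) * (2 * e * h))"
    by (intro mult_left_mono sum_bounded_above D) auto
  also have "\<dots> = 2 * e * h" using training_set by simp
  also have "frob_inner (?I (1 - h)) (?I (1 - h)) - frob_inner (?I 1) (?I 1)
      = h * (- 2 * frob_inner (S N \<omega>) (R N \<omega>) - 2 * frob_inner (R N \<omega>) (R N \<omega>)
          + h * frob_inner (R N \<omega>) (R N \<omega>))"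
    unfolding frob_inner_interp[OF SR] by (simp add: power2_eq_square algebra_simps)
  finally have "loss (X N) T C lam (set_W2 (\<alpha>s N \<omega>) (?I (1 - h))) - loss (X N) T C lam (\<alpha>s N \<omega>)
    \<le> h * (2 * e + lam * (- 2 * frob_inner (S N \<omega>) (R N \<omega>) - 2 * frob_inner (R N \<omega>) (R N \<omega>)
          + h * frob_inner (R N \<omega>) (R N \<omega>)))"
    by (simp add: algebra_simps)
  \<comment> \<open>Here \<open>h \<le> 1\<close> absorbs the quadratic remainder into one of the
    two copies of the squared norm of \<open>R\<close>; what remains inside the bracket is free of
    \<open>h\<close>.\<close>
  also have "\<dots> \<le> h * (2 * e + lam * (- 2 * frob_inner (S N \<omega>) (R N \<omega>) - 2 * frob_inner (R N \<omega>) (R N \<omega>)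
          + 1 * frob_inner (R N \<omega>) (R N \<omega>)))"
    using h lam_pos by (intro mult_left_mono add_left_mono mult_right_mono) auto
  finally show ?thesis unfolding pos_divide_le_eq[OF h(1)] by (simp add: algebra_simps)
qed

text \<open>The bound on the difference quotient is the same for every \<open>h\<close> in the unit
  interval, so it also bounds the lower limit, which is at least
  \<open>- \<epsilon>\<close>.\<close>

lemma frob_inner_R_le:
  assumes N: "1 \<le> N" and \<omega>: "\<omega> \<in> space (M N)"
    and small: "\<And>s. s \<in> T \<Longrightarrow> max_norm (R N \<omega> *\<^sub>v \<psi>\<^sub>1 N \<omega> s) \<le> d\<^sub>1 N * J (\<psi>\<^sub>1 N \<omega> s)"
    and a: "\<And>s. s \<in> T \<Longrightarrow>
      J (\<psi>\<^sub>1 N \<omega> s) * enn2real (max_norm_lipschitz (\<psi>\<^sub>2 N \<omega>) (U N \<omega> s)) * d\<^sub>1 N \<le> e"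
    and min: "- ereal (\<epsilon> N \<omega>) \<le> Liminf (at_right 0) (\<lambda>h. ereal
        ((loss (X N) T C lam (set_W2 (\<alpha>s N \<omega>) (interp (S N \<omega>) (R N \<omega>) (1 - h)))
          - loss (X N) T C lam (\<alpha>s N \<omega>)) / h))"
  shows "lam * frob_inner (R N \<omega>) (R N \<omega>) \<le> \<epsilon> N \<omega> + 2 * e - 2 * lam * frob_inner (S N \<omega>) (R N \<omega>)"
proof -
  let ?c = "2 * e - 2 * lam * frob_inner (S N \<omega>) (R N \<omega>) - lam * frob_inner (R N \<omega>) (R N \<omega>)"
  have "\<forall>\<^sub>F h in at_right (0::real). h \<in> {0<..<1}"
    by (rule eventually_at_right_real) simp
  then have "Liminf (at_right 0) (\<lambda>h. ereal
        ((loss (X N) T C lam (set_W2 (\<alpha>s N \<omega>) (interp (S N \<omega>) (R N \<omega>) (1 - h)))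
          - loss (X N) T C lam (\<alpha>s N \<omega>)) / h)) \<le> Liminf (at_right (0::real)) (\<lambda>_. ereal ?c)"
    by (intro Liminf_mono) (auto elim!: eventually_mono intro!: loss_quotient_le[OF N \<omega> _ _ small a])
  also have "\<dots> = ereal ?c" by (rule Liminf_const) simp
  finally have "- ereal (\<epsilon> N \<omega>) \<le> ereal ?c" by (rule order_trans[OF min])
  then show ?thesis by simp
qed

text \<open>The coordinates of \<open>\<psi>\<^sub>1\<close> at \<open>s\<close> are among the
  generators of \<open>limit_algebra\<close>, so \<open>R_small\<close> applies to this random
  vector. Integrating the conditional bound leaves an exceptional probability of at most
  \<open>d\<^sub>2 N\<close>.\<close>

lemma prob_to_one_R_psi1_small:
  "prob_to_one sequentially M (\<lambda>N \<omega>. max_norm (R N \<omega> *\<^sub>v \<psi>\<^sub>1 N \<omega> s) \<le> d\<^sub>1 N * J (\<psi>\<^sub>1 N \<omega> s))"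
proof -
  let ?B = "\<lambda>N. {\<omega> \<in> space (M N). d\<^sub>1 N * J (\<psi>\<^sub>1 N \<omega> s) < max_norm (R N \<omega> *\<^sub>v \<psi>\<^sub>1 N \<omega> s)}"
  have B: "?B N \<in> sets (M N) \<and> measure (M N) (?B N) \<le> d\<^sub>2 N" if N: "1 \<le> N" for N
  proof -
    interpret prob_space "M N" by (rule prob)
    let ?F = "limit_algebra (M N) N K (S N) (\<psi>\<^sub>1 N) (\<psi>\<^sub>2 N)"
    let ?G = "{{\<omega> \<in> space (M N). S N \<omega> $$ (i, j) \<le> c} | i j c. i < N \<and> j < N} \<union>
     {{\<omega> \<in> space (M N). \<psi>\<^sub>1 N \<omega> s $ i \<le> c} | s i c. i < N} \<union>
     {{\<omega> \<in> space (M N). \<psi>\<^sub>2 N \<omega> v $ i \<le> c} | v i c. v \<in> carrier_vec N \<and> i < K}"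
    have G: "?G \<subseteq> Pow (space (M N))" by blast
    have "(\<lambda>\<omega>. \<psi>\<^sub>1 N \<omega> s $ i) \<in> borel_measurable ?F" if "i < N" for i
    proof (rule borel_measurable_iff_le[THEN iffD2], intro allI)
      fix c
      have "{\<omega> \<in> space (M N). \<psi>\<^sub>1 N \<omega> s $ i \<le> c} \<in> ?G" using that by blast
      then have "{\<omega> \<in> space (M N). \<psi>\<^sub>1 N \<omega> s $ i \<le> c} \<in> sets ?F"
        unfolding limit_algebra_def sets_measure_of[OF G] by (rule sigma_sets.Basic)
      moreover have "space ?F = space (M N)"
        unfolding limit_algebra_def by (rule space_measure_of[OF G])
      ultimately show "{\<omega> \<in> space ?F. \<psi>\<^sub>1 N \<omega> s $ i \<le> c} \<in> sets ?F" by simp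
    qed
    then have "?B N \<in> sets (M N) \<and> (AE \<omega> in M N. cond_prob_given (M N) ?F (?B N) \<omega> \<le> d\<^sub>2 N)"
      using psi1_carrier[OF N] by (intro R_small[OF N]) auto
    then show ?thesis using prob_le_cond_prob_given[OF sub_algebra[OF N]] by blast
  qed
  let ?B' = "\<lambda>N. if 1 \<le> N then ?B N else space (M N)"
  have "(\<lambda>N. measure (M N) (?B' N)) \<longlonglongrightarrow> 0"
  proof (rule tendsto_sandwich[of "\<lambda>_. 0"])
    show "\<forall>\<^sub>F N in sequentially. measure (M N) (?B' N) \<le> d\<^sub>2 N"
      using eventually_ge_at_top[of 1] by eventually_elim (use B in simp)
  qed (simp_all add: d_tendsto)
  moreover have "?B' N \<in> sets (M N)" for N using B[of N] by auto
  ultimately show ?thesis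
    unfolding prob_to_one_def vanishing_prob_def not_le
    by (intro exI[of _ ?B']) auto
qed

theorem frob_norm_R_tendsto: "tendsto_in_prob sequentially M (\<lambda>N \<omega>. frob_norm (R N \<omega>)) 0"
  unfolding tendsto_in_prob_iff_prob_to_one
proof (intro allI impI)
  fix e :: real assume e: "0 < e"
  \<comment> \<open>Five shares of the budget: one for \<open>\<epsilon>\<close>, two for the data
    term and two for the inner product of \<open>S\<close> and \<open>R\<close>.\<close>
  define b where "b = lam * e\<^sup>2 / 5"
  have b: "0 < b" "0 < b / lam" using e lam_pos by (auto simp: b_def)
  have "prob_to_one sequentially M (\<lambda>N \<omega>.
      (\<forall>s\<in>T. max_norm (R N \<omega> *\<^sub>v \<psi>\<^sub>1 N \<omega> s) \<le> d\<^sub>1 N * J (\<psi>\<^sub>1 N \<omega> s)) \<and>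
      (\<forall>s\<in>T. \<bar>J (\<psi>\<^sub>1 N \<omega> s) * enn2real (max_norm_lipschitz (\<psi>\<^sub>2 N \<omega>) (U N \<omega> s)) * d\<^sub>1 N - 0\<bar> \<le> b) \<and>
      \<bar>frob_inner (S N \<omega>) (R N \<omega>) - 0\<bar> \<le> b / lam \<and> \<bar>\<epsilon> N \<omega> - 0\<bar> \<le> b \<and>
      - ereal (\<epsilon> N \<omega>) \<le> Liminf (at_right 0) (\<lambda>h. ereal
        ((loss (X N) T C lam (set_W2 (\<alpha>s N \<omega>) (interp (S N \<omega>) (R N \<omega>) (1 - h)))
          - loss (X N) T C lam (\<alpha>s N \<omega>)) / h)))"
    using a_tendsto SR_tendsto eps_tendsto b unfolding tendsto_in_prob_iff_prob_to_one
    by (intro prob_to_one_conj prob_to_one_ball training_set(1) prob_to_one_R_psi1_small almost_minimal)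
      blast+
  then show "prob_to_one sequentially M (\<lambda>N \<omega>. \<bar>frob_norm (R N \<omega>) - 0\<bar> \<le> e)"
  proof (rule prob_to_one_mono)
    show "\<forall>\<^sub>F N in sequentially. \<forall>\<omega>\<in>space (M N).
      (\<forall>s\<in>T. max_norm (R N \<omega> *\<^sub>v \<psi>\<^sub>1 N \<omega> s) \<le> d\<^sub>1 N * J (\<psi>\<^sub>1 N \<omega> s)) \<and>
      (\<forall>s\<in>T. \<bar>J (\<psi>\<^sub>1 N \<omega> s) * enn2real (max_norm_lipschitz (\<psi>\<^sub>2 N \<omega>) (U N \<omega> s)) * d\<^sub>1 N - 0\<bar> \<le> b) \<and>
      \<bar>frob_inner (S N \<omega>) (R N \<omega>) - 0\<bar> \<le> b / lam \<and> \<bar>\<epsilon> N \<omega> - 0\<bar> \<le> b \<and>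
      - ereal (\<epsilon> N \<omega>) \<le> Liminf (at_right 0) (\<lambda>h. ereal
        ((loss (X N) T C lam (set_W2 (\<alpha>s N \<omega>) (interp (S N \<omega>) (R N \<omega>) (1 - h)))
          - loss (X N) T C lam (\<alpha>s N \<omega>)) / h)) \<longrightarrow> \<bar>frob_norm (R N \<omega>) - 0\<bar> \<le> e"
      using eventually_ge_at_top[of 1]
    proof (eventually_elim, intro ballI impI, elim conjE)
      fix N \<omega>
      assume N: "1 \<le> N" and \<omega>: "\<omega> \<in> space (M N)"
        and 1: "\<forall>s\<in>T. max_norm (R N \<omega> *\<^sub>v \<psi>\<^sub>1 N \<omega> s) \<le> d\<^sub>1 N * J (\<psi>\<^sub>1 N \<omega> s)"
        and 2: "\<forall>s\<in>T. \<bar>J (\<psi>\<^sub>1 N \<omega> s) * enn2real (max_norm_lipschitz (\<psi>\<^sub>2 N \<omega>) (U N \<omega> s)) * d\<^sub>1 N - 0\<bar> \<le> b"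
        and 3: "\<bar>frob_inner (S N \<omega>) (R N \<omega>) - 0\<bar> \<le> b / lam" "\<bar>\<epsilon> N \<omega> - 0\<bar> \<le> b"
        and 4: "- ereal (\<epsilon> N \<omega>) \<le> Liminf (at_right 0) (\<lambda>h. ereal
        ((loss (X N) T C lam (set_W2 (\<alpha>s N \<omega>) (interp (S N \<omega>) (R N \<omega>) (1 - h)))
          - loss (X N) T C lam (\<alpha>s N \<omega>)) / h))"
      have "lam * frob_inner (R N \<omega>) (R N \<omega>) \<le> \<epsilon> N \<omega> + 2 * b - 2 * lam * frob_inner (S N \<omega>) (R N \<omega>)"
        using 1 2 by (intro frob_inner_R_le[OF N \<omega> _ _ 4]) auto
      moreover have "- (2 * lam * frob_inner (S N \<omega>) (R N \<omega>)) \<le> 2 * b"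
      proof -
        have "lam * - frob_inner (S N \<omega>) (R N \<omega>) \<le> lam * (b / lam)"
          using 3(1) lam_pos by (intro mult_left_mono) auto
        then show ?thesis using lam_pos by simp
      qed
      ultimately have "lam * frob_inner (R N \<omega>) (R N \<omega>) \<le> 5 * b" using 3(2) by linarith
      then have "lam * frob_inner (R N \<omega>) (R N \<omega>) \<le> lam * e\<^sup>2" by (simp add: b_def)
      then have "(frob_norm (R N \<omega>))\<^sup>2 \<le> e\<^sup>2" using lam_pos by (simp add: frob_norm_power2)
      then have "frob_norm (R N \<omega>) \<le> e" by (rule power2_le_imp_le) (use e in simp)
      then show "\<bar>frob_norm (R N \<omega>) - 0\<bar> \<le> e" by simp
    qed
  qed
qed

section \<open>The law of the Gaussian part and the decay of its variance\<close>

lemma R_law: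
  assumes N: "1 \<le> N" and B: "\<And>p. p \<in> {..<N} \<times> {..<N} \<Longrightarrow> B p \<in> sets (borel :: real measure)"
  shows "measure (M N) {\<omega> \<in> space (M N). \<forall>p\<in>{..<N} \<times> {..<N}. R N \<omega> $$ p \<in> B p} =
    (\<Prod>p\<in>{..<N} \<times> {..<N}. measure (normal_law 0 (g N / real N)) (B p))"
proof -
  interpret prob_space "M N" by (rule prob)
  let ?A = "{\<omega> \<in> space (M N). \<forall>i<N. \<forall>j<N. R N \<omega> $$ (i, j) \<in> B (i, j)}"
  have "{\<omega> \<in> space (M N). R N \<omega> $$ (i, j) \<in> B (i, j)} \<in> sets (M N)" if "i < N" "j < N" for i j
  proof -
    have "{\<omega> \<in> space (M N). R N \<omega> $$ (i, j) \<in> B (i, j)} =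
        (\<lambda>\<omega>. R N \<omega> $$ (i, j)) -` B (i, j) \<inter> space (M N)" by blast
    moreover have "B (i, j) \<in> sets borel" using that by (intro B) blast
    ultimately show ?thesis using measurable_sets[OF R_measurable[OF N that]] by metis
  qed
  then have "{\<omega> \<in> space (M N). \<forall>i\<in>{..<N}. \<forall>j\<in>{..<N}. R N \<omega> $$ (i, j) \<in> B (i, j)} \<in> sets (M N)"
    using N by (intro sets.sets_Collect_finite_All') (auto simp: lessThan_empty_iff)
  then have A: "?A \<in> sets (M N)" by (simp only: Ball_def lessThan_iff)
  have "measure (M N) ?A = (\<Prod>i<N. \<Prod>j<N. measure (normal_law 0 (g N / real N)) (B (i, j)))"
    using B by (intro prob_eq_cond_prob_given[OF sub_algebra[OF N] A] R_cond_iid[OF N]) auto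
  moreover have "{\<omega> \<in> space (M N). \<forall>p\<in>{..<N} \<times> {..<N}. R N \<omega> $$ p \<in> B p} = ?A" by auto
  ultimately show ?thesis by (simp add: prod.cartesian_product)
qed

text \<open>If \<open>g N \<ge> \<gamma>\<close>, the Laplace transform of \<open>\<parallel>R\<parallel>\<^sup>2\<close> at \<open>N / g N\<close>, which equals
  \<open>3\<close> to the power \<open>- N\<^sup>2 / 2\<close>, shows that \<open>\<parallel>R\<parallel> \<le> 1\<close> is unlikely.\<close>

theorem g_tendsto: "g \<longlonglongrightarrow> 0"
proof (rule order_tendstoI)
  fix \<gamma> :: real assume \<gamma>: "0 < \<gamma>"
  let ?I = "\<lambda>N. {..<N} \<times> {..<N}"
  \<comment> \<open>Written as a sum over entries, the event is measurable for
    \<open>1 \<le> N\<close>, so its actual probability can be bounded from both sides.\<close>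
  let ?A = "\<lambda>N. {\<omega> \<in> space (M N). (\<Sum>p\<in>?I N. (R N \<omega> $$ p)\<^sup>2) \<le> 1}"
  have frob: "frob_inner (R N \<omega>) (R N \<omega>) = (\<Sum>p\<in>?I N. (R N \<omega> $$ p)\<^sup>2)"
    if "1 \<le> N" "\<omega> \<in> space (M N)" for N \<omega>
    using R_carrier[OF that] by (simp add: frob_inner_def sum.cartesian_product power2_eq_square case_prod_beta')
  have "prob_to_one sequentially M (\<lambda>N \<omega>. \<bar>frob_norm (R N \<omega>) - 0\<bar> \<le> 1)"
    using tendsto_in_probD[OF frob_norm_R_tendsto, of 1] by simp
  then have 1: "\<forall>\<^sub>F N in sequentially. 1 / 2 < measure (M N) (?A N)"
  proof (rule prob_to_one_eventually_measure_gt[OF prob])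
    show "\<forall>\<^sub>F N in sequentially. ?A N \<in> sets (M N) \<and>
        {\<omega> \<in> space (M N). \<bar>frob_norm (R N \<omega>) - 0\<bar> \<le> 1} \<subseteq> ?A N"
      using eventually_ge_at_top[of 1]
    proof eventually_elim
      case (elim N)
      have "(\<lambda>\<omega>. \<Sum>p\<in>?I N. (R N \<omega> $$ p)\<^sup>2) \<in> borel_measurable (M N)"
        using R_measurable[OF elim] by (intro borel_measurable_sum) auto
      then have "?A N \<in> sets (M N)" by measurable
      moreover have "(\<Sum>p\<in>?I N. (R N \<omega> $$ p)\<^sup>2) \<le> 1" if "\<omega> \<in> space (M N)" "frob_norm (R N \<omega>) \<le> 1" for \<omega>
        using power_mono[OF that(2), of 2] unfolding frob[OF elim that(1), symmetric]
        by (simp add: frob_norm_power2)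
      ultimately show ?case by auto
    qed
  qed simp
  \<comment> \<open>For variance \<open>g N / N\<close> and radius 1, the small-ball bound is an
    \<open>N\<close>-th power. Its base is at most \<open>exp (1 / \<gamma>)\<close> times the
    \<open>N\<close>-th power of \<open>1 / sqrt 3\<close> once \<open>\<gamma> \<le> g N\<close>,
    hence eventually below 1/2. The bound is then at most 1/2, against the lower bound in
    \<open>1\<close>.\<close>
  have "(\<lambda>N. exp (1 / \<gamma>) * (1 / sqrt 3) ^ N) \<longlonglongrightarrow> exp (1 / \<gamma>) * 0"
    by (intro tendsto_mult tendsto_const LIMSEQ_power_zero) simp
  then have "\<forall>\<^sub>F N in sequentially. exp (1 / \<gamma>) * (1 / sqrt 3) ^ N < 1 / 2"
    by (rule order_tendstoD) simp
  with 1 eventually_ge_at_top[of 1] show "\<forall>\<^sub>F N in sequentially. g N < \<gamma>"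
  proof eventually_elim
    case (elim N)
    show ?case
    proof (rule ccontr)
      assume "\<not> g N < \<gamma>"
      then have g: "\<gamma> \<le> g N" by simp
      have "measure (M N) (?A N) \<le> exp (1 / (g N / real N)) * (1 / sqrt 3) ^ card (?I N)"
        using g \<gamma> elim R_measurable[OF \<open>1 \<le> N\<close>]
        by (intro gaussian_small_ball prob R_law) auto
      also have "\<dots> = exp (real N * (1 / g N)) * ((1 / sqrt 3) ^ N) ^ N"
        by (simp add: power_mult[symmetric])
      also have "\<dots> \<le> exp (real N * (1 / \<gamma>)) * ((1 / sqrt 3) ^ N) ^ N"
        using g \<gamma> by (intro mult_right_mono) (auto simp: frac_le divide_left_mono)
      also have "\<dots> = (exp (1 / \<gamma>) * (1 / sqrt 3) ^ N) ^ N"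
        unfolding exp_of_nat_mult power_mult_distrib ..
      also have "\<dots> \<le> (1 / 2) ^ N" using elim by (intro power_mono) auto
      also have "\<dots> \<le> (1 / 2) ^ 1" using elim by (intro power_decreasing) auto
      finally show False using elim by simp
    qed
  qed
next
  fix \<gamma> :: real assume "\<gamma> < 0"
  then show "\<forall>\<^sub>F N in sequentially. \<gamma> < g N"
    by (intro always_eventually allI less_le_trans[OF _ g_nonneg])
qed

end

section \<open>Consistency of the spikes\<close>

text \<open>A form uniform in the matrices: the errors are \<open>\<rho>\<close> times a factor
  depending only on \<open>c\<close>, \<open>\<delta>\<close> and \<open>\<tau>\<close>. The
  constant \<open>L\<close> arises from the right-vector error with half-gap
  \<open>\<delta> / 2\<close> and both singular values replaced by \<open>c\<close>.\<close>

lemma sing_proj_perturbation: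
  assumes A: "A \<in> carrier_mat n m" and B: "B \<in> carrier_mat n m" and i: "i < m"
    and close: "\<And>x. x \<in> carrier_vec m \<Longrightarrow> euclid_norm (A *\<^sub>v x - B *\<^sub>v x) \<le> \<rho> * euclid_norm x"
    and gap: "\<And>j. j < m \<Longrightarrow> j \<noteq> i \<Longrightarrow> \<delta> \<le> \<bar>sing_val A (Suc i) - sing_val A (Suc j)\<bar>"
    and pos: "0 < \<delta>" "0 < \<tau>" "\<tau> \<le> sing_val A (Suc i)" "\<tau> \<le> sing_val B (Suc i)"
    and \<rho>: "0 \<le> \<rho>" "\<rho> \<le> \<delta> / 4"
    and c: "sing_val A 1 \<le> c" "sing_val B (Suc i) \<le> c"
    and L: "L = 8 * c / (\<delta> * \<tau>)"
  shows "\<exists>!Z. left_sing_proj (Suc i) A Z" "\<exists>!Z. left_sing_proj (Suc i) B Z"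
    "\<exists>!Z. right_sing_proj (Suc i) A Z" "\<exists>!Z. right_sing_proj (Suc i) B Z"
    and "left_sing_proj (Suc i) A P \<Longrightarrow> left_sing_proj (Suc i) B Q \<Longrightarrow>
      \<bar>op_norm (Q - P)\<bar> \<le> \<rho> * (2 * (2 + c * L) / \<tau>)"
    and "right_sing_proj (Suc i) A P \<Longrightarrow> right_sing_proj (Suc i) B Q \<Longrightarrow>
      \<bar>op_norm (Q - P)\<bar> \<le> \<rho> * (2 * L)"
proof -
  \<comment> \<open>Both singular values move by at most \<open>\<rho> \<le> \<delta> / 4\<close>,
    so half of the separation survives in \<open>B\<close>.\<close>
  have gapB: "\<delta> / 2 \<le> \<bar>sing_val B (Suc i) - sing_val B (Suc j)\<bar>" if "j < m" "j \<noteq> i" for j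
    using gap[OF that] weyl_sing_val[OF A B i close] weyl_sing_val[OF A B that(1) close] \<rho> pos(1)
    by linarith
  show "\<exists>!Z. left_sing_proj (Suc i) A Z" "\<exists>!Z. right_sing_proj (Suc i) A Z"
    using sing_proj_unique[OF A i pos(1) _ gap] pos by auto
  show "\<exists>!Z. left_sing_proj (Suc i) B Z" "\<exists>!Z. right_sing_proj (Suc i) B Z"
    using sing_proj_unique[OF B i _ _ gapB] pos by auto
  have \<sigma>1: "0 \<le> sing_val A 1" using sing_val_nonneg[OF A, of 0] i by simp
  define \<kappa> where "\<kappa> = 2 * (\<rho> * (sing_val A 1 + sing_val B (Suc i)) / (\<delta> / 2 * \<tau>))"
  have "\<kappa> = \<rho> * (4 * (sing_val A 1 + sing_val B (Suc i)) / (\<delta> * \<tau>))"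
    using pos by (simp add: \<kappa>_def)
  also have "\<dots> \<le> \<rho> * L"
    unfolding L using c pos \<rho> by (intro mult_left_mono divide_right_mono) auto
  finally have \<kappa>: "\<kappa> \<le> \<rho> * L" .
  have pert: "\<exists>d. \<bar>d\<bar> = 1 \<and> euclid_norm (y - d \<cdot>\<^sub>v x) \<le> \<kappa> \<and>
      euclid_norm (w - d \<cdot>\<^sub>v u) \<le> (2 * \<rho> + sing_val A 1 * \<kappa>) / \<tau>"
    if "sing_vec_pair A (Suc i) u x" "sing_vec_pair B (Suc i) w y" for u x w y
    by (rule sing_vec_pair_perturbation[OF A B i that close _ _ pos(2-4) \<rho>(1) _ \<kappa>_def])
      (use gap pos \<rho> in auto)
  show "\<bar>op_norm (Q - P)\<bar> \<le> \<rho> * (2 * (2 + c * L) / \<tau>)"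
    if P: "left_sing_proj (Suc i) A P" and Q: "left_sing_proj (Suc i) B Q"
  proof -
    obtain u x w y where ux: "sing_vec_pair A (Suc i) u x" "P = line_proj u"
      and wy: "sing_vec_pair B (Suc i) w y" "Q = line_proj w"
      using P Q unfolding left_sing_proj_def by blast
    note u = sing_vec_pair_carrier[OF ux(1) A] and w = sing_vec_pair_carrier[OF wy(1) B]
    obtain d where d: "\<bar>d\<bar> = 1" "euclid_norm (w - d \<cdot>\<^sub>v u) \<le> (2 * \<rho> + sing_val A 1 * \<kappa>) / \<tau>"
      using pert[OF ux(1) wy(1)] by blast
    have "\<bar>op_norm (Q - P)\<bar> \<le> 2 * ((2 * \<rho> + sing_val A 1 * \<kappa>) / \<tau>)"
      using op_norm_line_proj_diff[OF u(1) w(1) u(3) w(3) d] ux wy by simp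
    also have "\<dots> \<le> 2 * ((2 * \<rho> + c * (\<rho> * L)) / \<tau>)"
    proof -
      have "sing_val A 1 * \<kappa> \<le> sing_val A 1 * (\<rho> * L)" by (intro mult_left_mono \<kappa> \<sigma>1)
      also have "\<dots> \<le> c * (\<rho> * L)"
        using c \<sigma>1 \<rho> pos by (intro mult_right_mono) (auto simp: L)
      finally show ?thesis using pos by (simp add: divide_right_mono)
    qed
    finally show ?thesis by (simp add: algebra_simps)
  qed
  show "\<bar>op_norm (Q - P)\<bar> \<le> \<rho> * (2 * L)"
    if P: "right_sing_proj (Suc i) A P" and Q: "right_sing_proj (Suc i) B Q"
  proof -
    obtain u x w y where ux: "sing_vec_pair A (Suc i) u x" "P = line_proj x"
      and wy: "sing_vec_pair B (Suc i) w y" "Q = line_proj y"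
      using P Q unfolding right_sing_proj_def by blast
    note x = sing_vec_pair_carrier[OF ux(1) A] and y = sing_vec_pair_carrier[OF wy(1) B]
    obtain d where d: "\<bar>d\<bar> = 1" "euclid_norm (y - d \<cdot>\<^sub>v x) \<le> \<kappa>"
      using pert[OF ux(1) wy(1)] by blast
    have "\<bar>op_norm (Q - P)\<bar> \<le> 2 * \<kappa>"
      using op_norm_line_proj_diff[OF x(2) y(2) x(4) y(4) d] ux wy by simp
    with \<kappa> show ?thesis by simp
  qed
qed

text \<open>The inner root lies between \<open>s - 2 * sqrt t\<close> and \<open>s\<close>, so its
  average with \<open>s\<close> lies between \<open>s - sqrt t\<close> and \<open>s\<close>.\<close>

lemma inverse_bbp_close:
  fixes s :: real
  assumes "0 \<le> t" "2 * sqrt t \<le> s"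
  shows "0 \<le> s\<^sup>2 - 4 * t" "\<bar>1 / 2 * (s + sqrt (s\<^sup>2 - 4 * t)) - s\<bar> \<le> sqrt t"
proof -
  have t: "(2 * sqrt t)\<^sup>2 = 4 * t" using assms(1) by (simp add: power_mult_distrib)
  have "(2 * sqrt t)\<^sup>2 \<le> s\<^sup>2" using assms by (intro power_mono) auto
  then show nonneg: "0 \<le> s\<^sup>2 - 4 * t" using t by simp
  have "sqrt (s\<^sup>2 - 4 * t) \<le> sqrt (s\<^sup>2)" using assms(1) by (intro real_sqrt_le_mono) simp
  also have "\<dots> = s" using assms order_trans[of 0 "2 * sqrt t" s] by simp
  finally have "sqrt (s\<^sup>2 - 4 * t) \<le> s" .
  moreover have "s - 2 * sqrt t \<le> sqrt (s\<^sup>2 - 4 * t)"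
  proof (rule real_le_rsqrt)
    have "(s - a)\<^sup>2 \<le> s\<^sup>2 - a\<^sup>2" if "a * a \<le> a * s" for a
      using that by (simp add: power2_eq_square algebra_simps)
    moreover have "(2 * sqrt t) * (2 * sqrt t) \<le> (2 * sqrt t) * s"
      using assms by (intro mult_left_mono) auto
    ultimately show "(s - 2 * sqrt t)\<^sup>2 \<le> s\<^sup>2 - 4 * t" unfolding t[symmetric] by blast
  qed
  ultimately show "\<bar>1 / 2 * (s + sqrt (s\<^sup>2 - 4 * t)) - s\<bar> \<le> sqrt t" by (simp add: abs_le_iff)
qed

section \<open>From matrix bounds to convergence in probability\<close>

context gaussian_limit_layer
begin

lemma prob_to_one_frob_norm_R_le:
  assumes "0 < \<rho>"
  shows "prob_to_one sequentially M (\<lambda>N \<omega>. frob_norm (R N \<omega>) \<le> \<rho>)"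
  using tendsto_in_probD[OF frob_norm_R_tendsto assms] by simp

lemma W2_carrier: "1 \<le> N \<Longrightarrow> \<omega> \<in> space (M N) \<Longrightarrow> W2 (\<alpha>s N \<omega>) \<in> carrier_mat N N"
  using S_carrier R_carrier by (simp add: decomposition)

lemma S_W2_close:
  assumes N: "1 \<le> N" and \<omega>: "\<omega> \<in> space (M N)" and x: "x \<in> carrier_vec N"
    and \<rho>: "frob_norm (R N \<omega>) \<le> \<rho>"
  shows "euclid_norm (S N \<omega> *\<^sub>v x - W2 (\<alpha>s N \<omega>) *\<^sub>v x) \<le> \<rho> * euclid_norm x"
proof -
  note SR = S_carrier[OF N \<omega>] R_carrier[OF N \<omega>]
  have "W2 (\<alpha>s N \<omega>) *\<^sub>v x = S N \<omega> *\<^sub>v x + R N \<omega> *\<^sub>v x"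
    unfolding decomposition[OF N \<omega>] by (rule add_mult_distrib_mat_vec[OF SR x])
  then have "W2 (\<alpha>s N \<omega>) *\<^sub>v x - S N \<omega> *\<^sub>v x = R N \<omega> *\<^sub>v x"
    using SR x by (intro eq_vecI) auto
  then have "euclid_norm (S N \<omega> *\<^sub>v x - W2 (\<alpha>s N \<omega>) *\<^sub>v x) = euclid_norm (R N \<omega> *\<^sub>v x)"
    using euclid_norm_minus_commute[of "S N \<omega> *\<^sub>v x" "W2 (\<alpha>s N \<omega>) *\<^sub>v x"] SR W2_carrier[OF N \<omega>] by simp
  also have "\<dots> \<le> frob_norm (R N \<omega>) * euclid_norm x" by (rule euclid_norm_mult_mat_vec_le[OF SR(2) x])
  also have "\<dots> \<le> \<rho> * euclid_norm x" using \<rho> by (intro mult_right_mono) auto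
  finally show ?thesis .
qed

lemma sing_val_S_W2_close:
  assumes N: "i < N" and \<omega>: "\<omega> \<in> space (M N)" and \<rho>: "frob_norm (R N \<omega>) \<le> \<rho>"
  shows "\<bar>sing_val (S N \<omega>) (Suc i) - sing_val (W2 (\<alpha>s N \<omega>)) (Suc i)\<bar> \<le> \<rho>"
proof -
  have N1: "1 \<le> N" using N by simp
  show ?thesis
    by (rule weyl_sing_val[OF S_carrier[OF N1 \<omega>] W2_carrier[OF N1 \<omega>] N S_W2_close[OF N1 \<omega> _ \<rho>]])
qed

lemma sqrt_g_eventually_less:
  assumes "0 < b"
  shows "\<forall>\<^sub>F N in sequentially. sqrt (g N) < b"
proof -
  have "(\<lambda>N. sqrt (g N)) \<longlonglongrightarrow> sqrt 0" by (intro tendsto_real_sqrt g_tendsto)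
  then show ?thesis using assms by (intro order_tendstoD(2)[of _ 0]) simp_all
qed

lemma spike_supercritical:
  assumes b: "0 < b" and spike: "tendsto_in_prob sequentially M (\<lambda>N \<omega>. sing_val (S N \<omega>) i) b"
  shows "prob_to_one sequentially M (\<lambda>N \<omega>. sing_val (S N \<omega>) i > sqrt (g N))"
proof -
  have "prob_to_one sequentially M (\<lambda>N \<omega>. \<bar>sing_val (S N \<omega>) i - b\<bar> \<le> b / 2)"
    by (rule tendsto_in_probD[OF spike half_gt_zero[OF b]])
  moreover have "\<forall>\<^sub>F N in sequentially. \<forall>\<omega>\<in>space (M N).
      \<bar>sing_val (S N \<omega>) i - b\<bar> \<le> b / 2 \<longrightarrow> sqrt (g N) < sing_val (S N \<omega>) i"
    using sqrt_g_eventually_less[OF half_gt_zero[OF b]]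
  proof (eventually_elim, intro ballI impI)
    fix N \<omega>
    assume "sqrt (g N) < b / 2" "\<bar>sing_val (S N \<omega>) i - b\<bar> \<le> b / 2"
    then show "sqrt (g N) < sing_val (S N \<omega>) i" by linarith
  qed
  ultimately show ?thesis by (rule prob_to_one_mono)
qed

text \<open>On the good event the singular value of \<open>W2\<close> is at least
  \<open>b / 4\<close>, while eventually \<open>sqrt (g N) < b / 8\<close>. The radicand is then
  nonnegative and the arbitrary values of the estimator do not occur. The error is at most the Weyl
  shift plus \<open>sqrt (g N)\<close>, each at most \<open>e / 2\<close>.\<close>

lemma inverse_bbp_consistent:
  assumes b: "0 < b" and spike: "tendsto_in_prob sequentially M (\<lambda>N \<omega>. sing_val (S N \<omega>) (Suc i)) b"
    and hat: "\<And>N \<omega>. \<omega> \<in> space (M N) \<Longrightarrow> 0 \<le> (sing_val (W2 (\<alpha>s N \<omega>)) (Suc i))\<^sup>2 - 4 * g N \<Longrightarrow>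
      \<sigma>hat N \<omega> = 1 / 2 * (sing_val (W2 (\<alpha>s N \<omega>)) (Suc i)
        + sqrt ((sing_val (W2 (\<alpha>s N \<omega>)) (Suc i))\<^sup>2 - 4 * g N))"
  shows "tendsto_in_prob sequentially M (\<lambda>N \<omega>. \<sigma>hat N \<omega> - sing_val (S N \<omega>) (Suc i)) 0"
  unfolding tendsto_in_prob_iff_prob_to_one
proof (intro allI impI)
  fix e :: real assume e: "0 < e"
  define \<rho> where "\<rho> = min (b / 4) (e / 2)"
  have \<rho>: "0 < \<rho>" "\<rho> \<le> b / 4" "\<rho> \<le> e / 2" using b e by (auto simp: \<rho>_def)
  define t where "t = min (b / 8) (e / 2)"
  have t: "0 < t" "t \<le> b / 8" "t \<le> e / 2" using b e by (auto simp: t_def)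
  have "prob_to_one sequentially M (\<lambda>N \<omega>. \<bar>sing_val (S N \<omega>) (Suc i) - b\<bar> \<le> b / 2 \<and>
      frob_norm (R N \<omega>) \<le> \<rho>)"
    by (intro prob_to_one_conj tendsto_in_probD[OF spike half_gt_zero[OF b]]
      prob_to_one_frob_norm_R_le \<rho>(1))
  then show "prob_to_one sequentially M (\<lambda>N \<omega>. \<bar>\<sigma>hat N \<omega> - sing_val (S N \<omega>) (Suc i) - 0\<bar> \<le> e)"
  proof (rule prob_to_one_mono)
    show "\<forall>\<^sub>F N in sequentially. \<forall>\<omega>\<in>space (M N).
        \<bar>sing_val (S N \<omega>) (Suc i) - b\<bar> \<le> b / 2 \<and> frob_norm (R N \<omega>) \<le> \<rho> \<longrightarrow>
        \<bar>\<sigma>hat N \<omega> - sing_val (S N \<omega>) (Suc i) - 0\<bar> \<le> e"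
      using sqrt_g_eventually_less[OF t(1)] eventually_gt_at_top[of i]
    proof (eventually_elim, intro ballI impI, elim conjE)
      fix N \<omega>
      assume g: "sqrt (g N) < t" and N: "i < N" and \<omega>: "\<omega> \<in> space (M N)"
        and S: "\<bar>sing_val (S N \<omega>) (Suc i) - b\<bar> \<le> b / 2" and R: "frob_norm (R N \<omega>) \<le> \<rho>"
      let ?s = "sing_val (W2 (\<alpha>s N \<omega>)) (Suc i)"
      have close: "\<bar>sing_val (S N \<omega>) (Suc i) - ?s\<bar> \<le> \<rho>" by (rule sing_val_S_W2_close[OF N \<omega> R])
      then have "b / 4 \<le> ?s" using S \<rho>(2) by linarith
      then have "2 * sqrt (g N) \<le> ?s" using g t by linarith
      note bbp = inverse_bbp_close[OF g_nonneg this]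
      have "\<bar>\<sigma>hat N \<omega> - ?s\<bar> \<le> sqrt (g N)" unfolding hat[OF \<omega> bbp(1)] by (rule bbp(2))
      then show "\<bar>\<sigma>hat N \<omega> - sing_val (S N \<omega>) (Suc i) - 0\<bar> \<le> e"
        using close g t(3) \<rho>(3) by linarith
    qed
  qed
qed

lemma sing_proj_consistent:
  assumes b: "0 < b" and spike: "tendsto_in_prob sequentially M (\<lambda>N \<omega>. sing_val (S N \<omega>) (Suc i)) b"
    and top: "tendsto_in_prob sequentially M (\<lambda>N \<omega>. sing_val (S N \<omega>) 1) b1"
    and \<delta>: "0 < \<delta>" and separated: "prob_to_one sequentially M (\<lambda>N \<omega>. \<forall>j \<in> {1..N}. j \<noteq> Suc i \<longrightarrow>
      \<bar>sing_val (S N \<omega>) (Suc i) - sing_val (S N \<omega>) j\<bar> \<ge> \<delta>)"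
    and Q: "Q = left_sing_proj (Suc i) \<or> Q = right_sing_proj (Suc i)"
    and PW: "is_version Q M (\<lambda>N \<omega>. W2 (\<alpha>s N \<omega>)) PW" and PS: "is_version Q M S PS"
  shows "tendsto_in_prob sequentially M (\<lambda>N \<omega>. op_norm (PW N \<omega> - PS N \<omega>)) 0"
  unfolding tendsto_in_prob_iff_prob_to_one
proof (intro allI impI)
  fix e :: real assume e: "0 < e"
  \<comment> \<open>\<open>c\<close> dominates the top singular value of \<open>S\<close>, which
    stays within 1 of \<open>b1\<close>, and the spike of \<open>W2\<close>, which is at most
    \<open>b / 2 + b / 4\<close> above \<open>b\<close>. \<open>H\<close> adds the error factors for
    left and right projectors, so that one \<open>\<rho>\<close> serves both.\<close>
  define c where "c = max (\<bar>b1\<bar> + 1) (2 * b)"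
  define L where "L = 8 * c / (\<delta> * (b / 4))"
  define H where "H = 2 * (2 + c * L) / (b / 4) + 2 * L"
  have c: "0 < c" using b by (simp add: c_def)
  have L: "0 < L" using c b \<delta> by (simp add: L_def)
  have H: "2 * (2 + c * L) / (b / 4) \<le> H" "2 * L \<le> H" "0 < H"
    using c L b by (auto simp: H_def intro!: add_pos_pos divide_pos_pos)
  define \<rho> where "\<rho> = min (min (\<delta> / 4) (b / 4)) (e / H)"
  have "0 < \<rho>" using b e \<delta> H by (simp add: \<rho>_def)
  moreover have "\<rho> \<le> \<delta> / 4" "\<rho> \<le> b / 4" "\<rho> \<le> e / H" unfolding \<rho>_def by linarith+
  ultimately have \<rho>: "0 < \<rho>" "\<rho> \<le> \<delta> / 4" "\<rho> \<le> b / 4" "\<rho> \<le> e / H" .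
  have "\<rho> * H \<le> e" using \<rho>(4) H(3) by (simp add: pos_le_divide_eq)
  then have \<rho>H: "\<rho> * (2 * (2 + c * L) / (b / 4)) \<le> e" "\<rho> * (2 * L) \<le> e"
    using mult_left_mono[OF H(1), of \<rho>] mult_left_mono[OF H(2), of \<rho>] \<rho>(1) by linarith+
  have "prob_to_one sequentially M (\<lambda>N \<omega>. \<bar>sing_val (S N \<omega>) (Suc i) - b\<bar> \<le> b / 2 \<and>
      \<bar>sing_val (S N \<omega>) 1 - b1\<bar> \<le> 1 \<and> frob_norm (R N \<omega>) \<le> \<rho> \<and>
      (\<forall>j \<in> {1..N}. j \<noteq> Suc i \<longrightarrow> \<bar>sing_val (S N \<omega>) (Suc i) - sing_val (S N \<omega>) j\<bar> \<ge> \<delta>))"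
    by (intro prob_to_one_conj tendsto_in_probD[OF spike half_gt_zero[OF b]] tendsto_in_probD[OF top]
      prob_to_one_frob_norm_R_le \<rho>(1) separated) simp
  then show "prob_to_one sequentially M (\<lambda>N \<omega>. \<bar>op_norm (PW N \<omega> - PS N \<omega>) - 0\<bar> \<le> e)"
  proof (rule prob_to_one_mono)
    show "\<forall>\<^sub>F N in sequentially. \<forall>\<omega>\<in>space (M N). \<bar>sing_val (S N \<omega>) (Suc i) - b\<bar> \<le> b / 2 \<and>
      \<bar>sing_val (S N \<omega>) 1 - b1\<bar> \<le> 1 \<and> frob_norm (R N \<omega>) \<le> \<rho> \<and>
      (\<forall>j \<in> {1..N}. j \<noteq> Suc i \<longrightarrow> \<bar>sing_val (S N \<omega>) (Suc i) - sing_val (S N \<omega>) j\<bar> \<ge> \<delta>) \<longrightarrow>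
      \<bar>op_norm (PW N \<omega> - PS N \<omega>) - 0\<bar> \<le> e"
      using eventually_gt_at_top[of i]
    proof (eventually_elim, intro ballI impI, elim conjE)
      fix N \<omega>
      assume N: "i < N" and \<omega>: "\<omega> \<in> space (M N)"
        and S: "\<bar>sing_val (S N \<omega>) (Suc i) - b\<bar> \<le> b / 2" and S1: "\<bar>sing_val (S N \<omega>) 1 - b1\<bar> \<le> 1"
        and R: "frob_norm (R N \<omega>) \<le> \<rho>"
        and gap: "\<forall>j \<in> {1..N}. j \<noteq> Suc i \<longrightarrow>
          \<bar>sing_val (S N \<omega>) (Suc i) - sing_val (S N \<omega>) j\<bar> \<ge> \<delta>"
      have N1: "1 \<le> N" using N by simp
      let ?W = "W2 (\<alpha>s N \<omega>)"
      have "\<bar>sing_val (S N \<omega>) (Suc i) - sing_val ?W (Suc i)\<bar> \<le> \<rho>"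
        by (rule sing_val_S_W2_close[OF N \<omega> R])
      then have W: "b / 4 \<le> sing_val ?W (Suc i)" "sing_val ?W (Suc i) \<le> 2 * b"
        and S': "b / 4 \<le> sing_val (S N \<omega>) (Suc i)"
        using S \<rho>(3) b by linarith+
      have le_c: "sing_val (S N \<omega>) 1 \<le> c" "sing_val ?W (Suc i) \<le> c"
        using S1 W(2) by (auto simp: c_def)
      have gap': "\<delta> \<le> \<bar>sing_val (S N \<omega>) (Suc i) - sing_val (S N \<omega>) (Suc j)\<bar>"
        if "j < N" "j \<noteq> i" for j
        using gap[rule_format, of "Suc j"] that by simp
      have "0 < b / 4" "0 \<le> \<rho>" using b \<rho>(1) by auto
      note proj = sing_proj_perturbation[OF S_carrier[OF N1 \<omega>] W2_carrier[OF N1 \<omega>] N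
        S_W2_close[OF N1 \<omega> _ R] gap' \<delta> this(1) S' W(1) this(2) \<rho>(2) le_c L_def]
      have ver: "(\<exists>!Z. Q (S N \<omega>) Z) \<Longrightarrow> Q (S N \<omega>) (PS N \<omega>)" "(\<exists>!Z. Q ?W Z) \<Longrightarrow> Q ?W (PW N \<omega>)"
        using PS PW \<omega> unfolding is_version_def by blast+
      from Q show "\<bar>op_norm (PW N \<omega> - PS N \<omega>) - 0\<bar> \<le> e"
      proof
        assume Q: "Q = left_sing_proj (Suc i)"
        have "left_sing_proj (Suc i) (S N \<omega>) (PS N \<omega>)"
          by (rule ver(1)[unfolded Q], rule proj(1))
        moreover have "left_sing_proj (Suc i) ?W (PW N \<omega>)"
          by (rule ver(2)[unfolded Q], rule proj(2))
        ultimately have "\<bar>op_norm (PW N \<omega> - PS N \<omega>)\<bar> \<le> \<rho> * (2 * (2 + c * L) / (b / 4))"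
          by (intro proj(5))
        then show ?thesis using \<rho>H(1) by simp
      next
        assume Q: "Q = right_sing_proj (Suc i)"
        have "right_sing_proj (Suc i) (S N \<omega>) (PS N \<omega>)"
          by (rule ver(1)[unfolded Q], rule proj(3))
        moreover have "right_sing_proj (Suc i) ?W (PW N \<omega>)"
          by (rule ver(2)[unfolded Q], rule proj(4))
        ultimately have "\<bar>op_norm (PW N \<omega> - PS N \<omega>)\<bar> \<le> \<rho> * (2 * L)"
          by (intro proj(6))
        then show ?thesis using \<rho>H(2) by simp
      qed
    qed
  qed
qed

end

theorem corollary4p12:
  fixes M :: "nat \<Rightarrow> 'w measure"
    and K :: nat and T :: "'s set" and C :: "'s \<Rightarrow> nat" and lam :: real
    and X :: "nat \<Rightarrow> 's \<Rightarrow> params \<Rightarrow> real vec"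
    and sh :: "nat \<Rightarrow> (nat \<times> nat) list" and q :: "nat \<Rightarrow> nat"
    and \<alpha> :: "nat \<Rightarrow> real \<Rightarrow> 'w \<Rightarrow> params" and \<alpha>s :: "nat \<Rightarrow> 'w \<Rightarrow> params"
    and S R :: "nat \<Rightarrow> 'w \<Rightarrow> real mat"
    and \<psi>\<^sub>1 :: "nat \<Rightarrow> 'w \<Rightarrow> 's \<Rightarrow> real vec"
    and \<psi>\<^sub>2 :: "nat \<Rightarrow> 'w \<Rightarrow> real vec \<Rightarrow> real vec"
    and g :: "nat \<Rightarrow> real"
    and U :: "nat \<Rightarrow> 'w \<Rightarrow> 's \<Rightarrow> real vec set"
    and d\<^sub>1 d\<^sub>2 :: "nat \<Rightarrow> real" and J :: "real vec \<Rightarrow> real"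
    and \<epsilon> :: "nat \<Rightarrow> 'w \<Rightarrow> real"
    and r k :: nat and \<sigma>bar :: "nat \<Rightarrow> real"
  assumes layer: "gaussian_limit_layer M K T C lam X sh q \<alpha> \<alpha>s S R \<psi>\<^sub>1 \<psi>\<^sub>2 g U d\<^sub>1 d\<^sub>2 J \<epsilon>"
    and finite_rank: "\<And>N \<omega>. 1 \<le> N \<Longrightarrow> \<omega> \<in> space (M N) \<Longrightarrow> vec_space.rank N (S N \<omega>) \<le> r"
    and spikes: "\<And>i. i \<in> {1..k} \<Longrightarrow> 0 < \<sigma>bar i \<and>
      tendsto_in_prob sequentially M (\<lambda>N \<omega>. sing_val (S N \<omega>) i) (\<sigma>bar i)"
  shows "\<forall>i \<in> {1..k}.
    prob_to_one sequentially M (\<lambda>N \<omega>. sing_val (S N \<omega>) i > sqrt (g N)) \<and>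
    ((\<exists>\<delta>>0. prob_to_one sequentially M (\<lambda>N \<omega>.
        \<forall>j \<in> {1..N}. j \<noteq> i \<longrightarrow> \<bar>sing_val (S N \<omega>) i - sing_val (S N \<omega>) j\<bar> \<ge> \<delta>)) \<longrightarrow>
      (\<forall>PW PS. is_version (left_sing_proj i) M (\<lambda>N \<omega>. W2 (\<alpha>s N \<omega>)) PW \<and>
          is_version (left_sing_proj i) M S PS \<longrightarrow>
        tendsto_in_prob sequentially M (\<lambda>N \<omega>. op_norm (PW N \<omega> - PS N \<omega>)) 0) \<and>
      (\<forall>PW PS. is_version (right_sing_proj i) M (\<lambda>N \<omega>. W2 (\<alpha>s N \<omega>)) PW \<and>
          is_version (right_sing_proj i) M S PS \<longrightarrow>
        tendsto_in_prob sequentially M (\<lambda>N \<omega>. op_norm (PW N \<omega> - PS N \<omega>)) 0)) \<and>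
    (\<forall>\<sigma>hat :: nat \<Rightarrow> 'w \<Rightarrow> real.
      (\<forall>N. \<forall>\<omega> \<in> space (M N). 0 \<le> (sing_val (W2 (\<alpha>s N \<omega>)) i)\<^sup>2 - 4 * g N \<longrightarrow>
        \<sigma>hat N \<omega> = 1 / 2 * (sing_val (W2 (\<alpha>s N \<omega>)) i
          + sqrt ((sing_val (W2 (\<alpha>s N \<omega>)) i)\<^sup>2 - 4 * g N))) \<longrightarrow>
      tendsto_in_prob sequentially M (\<lambda>N \<omega>. \<sigma>hat N \<omega> - sing_val (S N \<omega>) i) 0)"
proof (intro ballI conjI impI allI)
  interpret gaussian_limit_layer M K T C lam X sh q \<alpha> \<alpha>s S R \<psi>\<^sub>1 \<psi>\<^sub>2 g U d\<^sub>1 d\<^sub>2 J \<epsilon>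
    by (rule layer)
  fix i assume i: "i \<in> {1..k}"
  then obtain j where j: "i = Suc j" by (cases i) auto
  note spike = spikes[OF i]
  \<comment> \<open>Since \<open>i\<close> lies in \<open>{1..k}\<close>, the index 1 is itself a
    persistent spike; its convergence keeps the norm of \<open>S\<close> bounded in
    probability.\<close>
  have top: "tendsto_in_prob sequentially M (\<lambda>N \<omega>. sing_val (S N \<omega>) 1) (\<sigma>bar 1)"
    using spikes[of 1] i by simp
  show "prob_to_one sequentially M (\<lambda>N \<omega>. sing_val (S N \<omega>) i > sqrt (g N))"
    using spike_supercritical spike by blast
  show "tendsto_in_prob sequentially M (\<lambda>N \<omega>. op_norm (PW N \<omega> - PS N \<omega>)) 0"
    if "\<exists>\<delta>>0. prob_to_one sequentially M (\<lambda>N \<omega>.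
        \<forall>j \<in> {1..N}. j \<noteq> i \<longrightarrow> \<bar>sing_val (S N \<omega>) i - sing_val (S N \<omega>) j\<bar> \<ge> \<delta>)"
      and "is_version (left_sing_proj i) M (\<lambda>N \<omega>. W2 (\<alpha>s N \<omega>)) PW \<and>
          is_version (left_sing_proj i) M S PS" for PW PS
    using that sing_proj_consistent[OF _ _ top, of "\<sigma>bar i" j _ "left_sing_proj i"] spike
    unfolding j by blast
  show "tendsto_in_prob sequentially M (\<lambda>N \<omega>. op_norm (PW N \<omega> - PS N \<omega>)) 0"
    if "\<exists>\<delta>>0. prob_to_one sequentially M (\<lambda>N \<omega>.
        \<forall>j \<in> {1..N}. j \<noteq> i \<longrightarrow> \<bar>sing_val (S N \<omega>) i - sing_val (S N \<omega>) j\<bar> \<ge> \<delta>)"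
      and "is_version (right_sing_proj i) M (\<lambda>N \<omega>. W2 (\<alpha>s N \<omega>)) PW \<and>
          is_version (right_sing_proj i) M S PS" for PW PS
    using that sing_proj_consistent[OF _ _ top, of "\<sigma>bar i" j _ "right_sing_proj i"] spike
    unfolding j by blast
  show "tendsto_in_prob sequentially M (\<lambda>N \<omega>. \<sigma>hat N \<omega> - sing_val (S N \<omega>) i) 0"
    if "\<forall>N. \<forall>\<omega> \<in> space (M N). 0 \<le> (sing_val (W2 (\<alpha>s N \<omega>)) i)\<^sup>2 - 4 * g N \<longrightarrow>
        \<sigma>hat N \<omega> = 1 / 2 * (sing_val (W2 (\<alpha>s N \<omega>)) i
          + sqrt ((sing_val (W2 (\<alpha>s N \<omega>)) i)\<^sup>2 - 4 * g N))" for \<sigma>hat :: "nat \<Rightarrow> 'w \<Rightarrow> real"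
    using spike that unfolding j by (intro inverse_bbp_consistent) auto
qed

end
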